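(* Let $R$ be a ring and let $\mathcal C$ be a class of right $R$-modules closed under finite direct sums. Assume that $\mathcal C$ is closed under extensions and that $\mathcal C$ consists of FP$_2$-modules. Then the class $\mathcal L = \varinjlim \mathcal C$ is closed under extensions.
   Context: $\varinjlim \mathcal C$ is the class of all right $R$-modules that are direct limits (in the category of right $R$-modules) of direct systems of modules from $\mathcal C$ indexed by directed posets. Modules are considered up to isomorphism. A module $C$ is an FP$_2$-module if it has a projective resolution $\dots\to P_2\to P_1\to P_0\to C\to 0$ with $P_0$, $P_1$, $P_2$ finitely generated. *)

theory Defs
  imports "HOL-Algebra.Ring" "HOL-Library.FuncSet"
begin

section \<open>Right modules\<close>

text \<open>
  The library's \<^locale>\<open>abelian_group\<close> is formulated for ring records, so a module record
  extends \<^typ>\<open>'m ring\<close>; its fields \<^const>\<open>mult\<close> and \<^const>\<open>one\<close> carry no meaning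
  (the same convention as in HOL-Algebra's own modules, which however require a commutative ring
  of scalars).
\<close>

record ('r, 'm) rmod = "'m ring" +
  ract :: "'m \<Rightarrow> 'r \<Rightarrow> 'm"  (infixl \<open>\<cdot>\<index>\<close> 70)

locale right_module = R?: ring R + M?: abelian_group M
  for R :: "('r, 'e) ring_scheme" (structure) and M :: "('r, 'm) rmod" (structure) +
  assumes ract_closed: "x \<in> carrier M \<Longrightarrow> a \<in> carrier R \<Longrightarrow> x \<cdot>\<^bsub>M\<^esub> a \<in> carrier M"
    and ract_add_left: "x \<in> carrier M \<Longrightarrow> y \<in> carrier M \<Longrightarrow> a \<in> carrier R \<Longrightarrow>
      (x \<oplus>\<^bsub>M\<^esub> y) \<cdot>\<^bsub>M\<^esub> a = x \<cdot>\<^bsub>M\<^esub> a \<oplus>\<^bsub>M\<^esub> y \<cdot>\<^bsub>M\<^esub> a"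
    and ract_add_right: "x \<in> carrier M \<Longrightarrow> a \<in> carrier R \<Longrightarrow> b \<in> carrier R \<Longrightarrow>
      x \<cdot>\<^bsub>M\<^esub> (a \<oplus>\<^bsub>R\<^esub> b) = x \<cdot>\<^bsub>M\<^esub> a \<oplus>\<^bsub>M\<^esub> x \<cdot>\<^bsub>M\<^esub> b"
    and ract_mult: "x \<in> carrier M \<Longrightarrow> a \<in> carrier R \<Longrightarrow> b \<in> carrier R \<Longrightarrow>
      x \<cdot>\<^bsub>M\<^esub> (a \<otimes>\<^bsub>R\<^esub> b) = (x \<cdot>\<^bsub>M\<^esub> a) \<cdot>\<^bsub>M\<^esub> b"
    and ract_one: "x \<in> carrier M \<Longrightarrow> x \<cdot>\<^bsub>M\<^esub> \<one>\<^bsub>R\<^esub> = x"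

definition rhom :: "('r, 'e) ring_scheme \<Rightarrow> ('r, 'm) rmod \<Rightarrow> ('r, 'n) rmod \<Rightarrow> ('m \<Rightarrow> 'n) set"
  where "rhom R M N =
    {h \<in> carrier M \<rightarrow> carrier N.
      (\<forall>x\<in>carrier M. \<forall>y\<in>carrier M. h (x \<oplus>\<^bsub>M\<^esub> y) = h x \<oplus>\<^bsub>N\<^esub> h y) \<and>
      (\<forall>x\<in>carrier M. \<forall>a\<in>carrier R. h (x \<cdot>\<^bsub>M\<^esub> a) = h x \<cdot>\<^bsub>N\<^esub> a)}"

definition rmod_iso :: "('r, 'e) ring_scheme \<Rightarrow> ('r, 'm) rmod \<Rightarrow> ('r, 'n) rmod \<Rightarrow> bool"
  where "rmod_iso R M N \<longleftrightarrow> (\<exists>h\<in>rhom R M N. bij_betw h (carrier M) (carrier N))"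

definition rker :: "('r, 'm) rmod \<Rightarrow> ('r, 'n) rmod \<Rightarrow> ('m \<Rightarrow> 'n) \<Rightarrow> 'm set"
  where "rker M N h = {x \<in> carrier M. h x = \<zero>\<^bsub>N\<^esub>}"

definition rsubmodule :: "('r, 'e) ring_scheme \<Rightarrow> ('r, 'm) rmod \<Rightarrow> 'm set \<Rightarrow> bool"
  where "rsubmodule R M N \<longleftrightarrow>
    N \<subseteq> carrier M \<and> \<zero>\<^bsub>M\<^esub> \<in> N \<and>
    (\<forall>x\<in>N. \<forall>y\<in>N. x \<oplus>\<^bsub>M\<^esub> y \<in> N) \<and> (\<forall>x\<in>N. \<forall>a\<in>carrier R. x \<cdot>\<^bsub>M\<^esub> a \<in> N)"

definition finitely_generated :: "('r, 'e) ring_scheme \<Rightarrow> ('r, 'm) rmod \<Rightarrow> bool"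
  where "finitely_generated R M \<longleftrightarrow>
    (\<exists>S. finite S \<and> S \<subseteq> carrier M \<and> (\<forall>N. rsubmodule R M N \<and> S \<subseteq> N \<longrightarrow> N = carrier M))"

definition extension ::
  "('r, 'e) ring_scheme \<Rightarrow> ('r, 'a) rmod \<Rightarrow> ('r, 'b) rmod \<Rightarrow> ('r, 'd) rmod \<Rightarrow> bool"
  where "extension R A B D \<longleftrightarrow>
      right_module R A \<and> right_module R B \<and> right_module R D \<and>
      (\<exists>f\<in>rhom R A B. \<exists>g\<in>rhom R B D.
         inj_on f (carrier A) \<and> f ` carrier A = rker B D g \<and> g ` carrier B = carrier D)"

definition direct_sum :: "'k set \<Rightarrow> ('k \<Rightarrow> ('r, 'm) rmod) \<Rightarrow> ('r, 'k \<Rightarrow> 'm) rmod"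
  where "direct_sum K X =
    \<lparr>carrier = {x \<in> (\<Pi>\<^sub>E k\<in>K. carrier (X k)). finite {k \<in> K. x k \<noteq> \<zero>\<^bsub>X k\<^esub>}},
     mult = undefined, one = undefined,
     zero = (\<lambda>k\<in>K. \<zero>\<^bsub>X k\<^esub>),
     add = (\<lambda>x y. \<lambda>k\<in>K. x k \<oplus>\<^bsub>X k\<^esub> y k),
     ract = (\<lambda>x a. \<lambda>k\<in>K. x k \<cdot>\<^bsub>X k\<^esub> a)\<rparr>"


section \<open>Projective modules and FP2-modules\<close>

text \<open>
  Quantifying over all modules of all types is impossible in HOL. The lifting property is required
  for epimorphisms onto modules on the type of \<open>P\<close> from modules on a type which has room for the
  free module with basis \<open>P\<close>; lemma \<open>projective_lift\<close> below shows that it then holds for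
  epimorphisms between modules on arbitrary types.
\<close>

definition projective :: "('r, 'e) ring_scheme \<Rightarrow> ('r, 'p) rmod \<Rightarrow> bool"
  where "projective R P \<longleftrightarrow> right_module R P \<and>
    (\<forall>(M :: ('r, 'p \<Rightarrow> 'r) rmod) (N :: ('r, 'p) rmod) g f.
       right_module R M \<and> right_module R N \<and>
       g \<in> rhom R M N \<and> g ` carrier M = carrier N \<and> f \<in> rhom R P N
       \<longrightarrow> (\<exists>h\<in>rhom R P M. \<forall>x\<in>carrier P. g (h x) = f x))"

text \<open>
  The type \<^typ>\<open>'p\<close> on which the modules of the resolution live is a parameter, again because a
  definition cannot quantify over types.
\<close>

definition FP2 :: "'p itself \<Rightarrow> ('r, 'e) ring_scheme \<Rightarrow> ('r, 'm) rmod \<Rightarrow> bool"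
  where "FP2 _ R X \<longleftrightarrow> right_module R X \<and>
    (\<exists>(P :: nat \<Rightarrow> ('r, 'p) rmod) d \<epsilon>.
       (\<forall>n. projective R (P n)) \<and>
       \<epsilon> \<in> rhom R (P 0) X \<and> \<epsilon> ` carrier (P 0) = carrier X \<and>
       (\<forall>n. d n \<in> rhom R (P (Suc n)) (P n)) \<and>
       d 0 ` carrier (P 1) = rker (P 0) X \<epsilon> \<and>
       (\<forall>n. d (Suc n) ` carrier (P (Suc (Suc n))) = rker (P (Suc n)) (P n) (d n)) \<and>
       finitely_generated R (P 0) \<and> finitely_generated R (P 1) \<and> finitely_generated R (P 2))"


section \<open>Direct limits\<close>

locale direct_system =
  fixes R :: "('r, 'e) ring_scheme"
    and I :: "'i set" and E :: "('i \<times> 'i) set"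
    and M :: "'i \<Rightarrow> ('r, 'm) rmod" and f :: "'i \<Rightarrow> 'i \<Rightarrow> 'm \<Rightarrow> 'm"
  assumes poset: "partial_order_on I E"
    and nonempty: "I \<noteq> {}"
    and directed: "i \<in> I \<Longrightarrow> j \<in> I \<Longrightarrow> \<exists>k\<in>I. (i, k) \<in> E \<and> (j, k) \<in> E"
    and modules: "i \<in> I \<Longrightarrow> right_module R (M i)"
    and homs: "(i, j) \<in> E \<Longrightarrow> f i j \<in> rhom R (M i) (M j)"
    and ident: "i \<in> I \<Longrightarrow> x \<in> carrier (M i) \<Longrightarrow> f i i x = x"
    and comp: "(i, j) \<in> E \<Longrightarrow> (j, k) \<in> E \<Longrightarrow> x \<in> carrier (M i) \<Longrightarrow> f j k (f i j x) = f i k x"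

text \<open>
  The direct limit as the quotient of the disjoint union by eventual equality. Lemmas
  \<open>dl_right_module\<close>, \<open>dl_cocone\<close> and \<open>dl_universal\<close> below show that it is the colimit of the
  system in the category of right modules.
\<close>

definition dl_rel ::
  "'i set \<Rightarrow> ('i \<times> 'i) set \<Rightarrow> ('i \<Rightarrow> ('r, 'm) rmod) \<Rightarrow> ('i \<Rightarrow> 'i \<Rightarrow> 'm \<Rightarrow> 'm) \<Rightarrow>
    (('i \<times> 'm) \<times> ('i \<times> 'm)) set"
  where "dl_rel I E M f =
    {((i, x), (j, y)) | i x j y. i \<in> I \<and> x \<in> carrier (M i) \<and> j \<in> I \<and> y \<in> carrier (M j) \<and>
       (\<exists>k. (i, k) \<in> E \<and> (j, k) \<in> E \<and> f i k x = f j k y)}"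

definition dl_class ::
  "'i set \<Rightarrow> ('i \<times> 'i) set \<Rightarrow> ('i \<Rightarrow> ('r, 'm) rmod) \<Rightarrow> ('i \<Rightarrow> 'i \<Rightarrow> 'm \<Rightarrow> 'm) \<Rightarrow>
    'i \<Rightarrow> 'm \<Rightarrow> ('i \<times> 'm) set"
  where "dl_class I E M f i x = dl_rel I E M f `` {(i, x)}"

definition direct_limit ::
  "'i set \<Rightarrow> ('i \<times> 'i) set \<Rightarrow> ('i \<Rightarrow> ('r, 'm) rmod) \<Rightarrow> ('i \<Rightarrow> 'i \<Rightarrow> 'm \<Rightarrow> 'm) \<Rightarrow>
    ('r, ('i \<times> 'm) set) rmod"
  where \<comment> \<open>each union below is a union of copies of one and the same equivalence class\<close>
    "direct_limit I E M f =
    \<lparr>carrier = (SIGMA i:I. carrier (M i)) // dl_rel I E M f,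
     mult = undefined, one = undefined,
     zero = \<Union>{dl_class I E M f i \<zero>\<^bsub>M i\<^esub> | i. i \<in> I},
     add = (\<lambda>X Y. \<Union>{dl_class I E M f k (f i k x \<oplus>\<^bsub>M k\<^esub> f j k y) | i x j y k.
              (i, x) \<in> X \<and> (j, y) \<in> Y \<and> (i, k) \<in> E \<and> (j, k) \<in> E}),
     ract = (\<lambda>X a. \<Union>{dl_class I E M f i (x \<cdot>\<^bsub>M i\<^esub> a) | i x. (i, x) \<in> X})\<rparr>"

text \<open>
  A direct limit may run over a poset of any size, but a definition cannot quantify over types, so
  the type \<^typ>\<open>'i\<close> of the indices is a parameter.
\<close>

definition dirlim_class ::
  "'i itself \<Rightarrow> ('r, 'e) ring_scheme \<Rightarrow> ('r, 'c) rmod set \<Rightarrow> ('r, 'm) rmod set"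
  where "dirlim_class _ R C =
    {L. right_module R L \<and>
      (\<exists>(I :: 'i set) E M f. direct_system R I E M f \<and> (\<forall>i\<in>I. M i \<in> C) \<and>
         rmod_iso R L (direct_limit I E M f))}"


section \<open>Closure properties of a class of modules\<close>

definition rmod_class :: "('r, 'e) ring_scheme \<Rightarrow> ('r, 'c) rmod set \<Rightarrow> bool"
  where "rmod_class R C \<longleftrightarrow> (\<forall>X\<in>C. right_module R X) \<and>
      (\<forall>X Y. X \<in> C \<and> right_module R Y \<and> rmod_iso R X Y \<longrightarrow> Y \<in> C)"

definition closed_finite_direct_sums :: "('r, 'e) ring_scheme \<Rightarrow> ('r, 'c) rmod set \<Rightarrow> bool"
  where "closed_finite_direct_sums R C \<longleftrightarrow>
    (\<forall>(n::nat) X. (\<forall>k<n. X k \<in> C) \<longrightarrow> (\<exists>S\<in>C. rmod_iso R S (direct_sum {..<n} X)))"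

definition closed_extensions :: "('r, 'e) ring_scheme \<Rightarrow> ('r, 'c) rmod set \<Rightarrow> bool"
  where "closed_extensions R C \<longleftrightarrow>
    (\<forall>X Y Z. X \<in> C \<and> Z \<in> C \<and> extension R X Y Z \<longrightarrow> Y \<in> C)"

text \<open>
  An index type with enough room for presenting a module \<open>L\<close> on \<^typ>\<open>'m\<close> as a direct limit of
  finitely presented modules: pairs of a finite set of generators (each element of \<open>L\<close> is
  available in countably many copies) and a submodule of the free module on them whose elements
  are relations holding in \<open>L\<close>, ordered by inclusion.
\<close>

type_synonym ('r, 'm) presentation_index = "('m \<times> nat) set \<times> ('m \<times> nat \<Rightarrow> 'r) set"


section \<open>Adequacy of the definitions of direct limits and projective modules\<close>

lemma rhomD:
  assumes "h \<in> rhom R M N"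
  shows rhom_closed: "x \<in> carrier M \<Longrightarrow> h x \<in> carrier N"
    and rhom_add: "x \<in> carrier M \<Longrightarrow> y \<in> carrier M \<Longrightarrow> h (x \<oplus>\<^bsub>M\<^esub> y) = h x \<oplus>\<^bsub>N\<^esub> h y"
    and rhom_ract: "x \<in> carrier M \<Longrightarrow> a \<in> carrier R \<Longrightarrow> h (x \<cdot>\<^bsub>M\<^esub> a) = h x \<cdot>\<^bsub>N\<^esub> a"
  using assms by (simp_all add: rhom_def Pi_iff)

lemma rhom_zero:
  assumes "h \<in> rhom R M N" "right_module R M" "right_module R N"
  shows "h \<zero>\<^bsub>M\<^esub> = \<zero>\<^bsub>N\<^esub>"
proof -
  interpret M: right_module R M by fact
  interpret N: right_module R N by fact
  have z: "h \<zero>\<^bsub>M\<^esub> \<in> carrier N" using rhom_closed[OF assms(1)] by simp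
  have "h \<zero>\<^bsub>M\<^esub> \<oplus>\<^bsub>N\<^esub> h \<zero>\<^bsub>M\<^esub> = h \<zero>\<^bsub>M\<^esub>"
    using rhom_add[OF assms(1), of "\<zero>\<^bsub>M\<^esub>" "\<zero>\<^bsub>M\<^esub>"] by simp
  then show ?thesis using N.M.add.r_cancel_one[of "h \<zero>\<^bsub>M\<^esub>" "h \<zero>\<^bsub>M\<^esub>"] z by simp
qed

context direct_system
begin

abbreviation "cls \<equiv> dl_class I E M f"
abbreviation "L \<equiv> direct_limit I E M f"

lemma le_in: "(i, j) \<in> E \<Longrightarrow> i \<in> I \<and> j \<in> I"
  using poset unfolding partial_order_on_def preorder_on_def by blast

lemma le_refl: "i \<in> I \<Longrightarrow> (i, i) \<in> E"
  using poset unfolding partial_order_on_def preorder_on_def refl_on_def by blast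

lemma le_trans: "(i, j) \<in> E \<Longrightarrow> (j, k) \<in> E \<Longrightarrow> (i, k) \<in> E"
  using poset unfolding partial_order_on_def preorder_on_def by (meson transD)

lemma f_closed: "(i, j) \<in> E \<Longrightarrow> x \<in> carrier (M i) \<Longrightarrow> f i j x \<in> carrier (M j)"
  by (rule rhom_closed[OF homs])

lemma ub: "i \<in> I \<Longrightarrow> j \<in> I \<Longrightarrow> \<exists>k. (i, k) \<in> E \<and> (j, k) \<in> E"
  using directed by blast

lemma dl_rel_iff:
  "((i, x), (j, y)) \<in> dl_rel I E M f \<longleftrightarrow>
     i \<in> I \<and> x \<in> carrier (M i) \<and> j \<in> I \<and> y \<in> carrier (M j) \<and>
     (\<exists>k. (i, k) \<in> E \<and> (j, k) \<in> E \<and> f i k x = f j k y)"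
  by (simp add: dl_rel_def)

lemma equiv: "equiv (SIGMA i:I. carrier (M i)) (dl_rel I E M f)"
proof (rule equivI)
  show "dl_rel I E M f \<subseteq> (SIGMA i:I. carrier (M i)) \<times> (SIGMA i:I. carrier (M i))"
    by (clarsimp simp: dl_rel_iff)
  show "refl_on (SIGMA i:I. carrier (M i)) (dl_rel I E M f)"
  proof (rule refl_onI)
    fix p assume p: "p \<in> (SIGMA i:I. carrier (M i))"
    obtain i x where ix: "p = (i, x)" by (cases p)
    have "i \<in> I" "x \<in> carrier (M i)" using p ix by simp_all
    moreover have "(i, i) \<in> E" using \<open>i \<in> I\<close> by (rule le_refl)
    ultimately show "(p, p) \<in> dl_rel I E M f" unfolding ix dl_rel_iff by blast
  qed
  show "sym (dl_rel I E M f)"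
  proof (rule symI)
    fix p q assume pq: "(p, q) \<in> dl_rel I E M f"
    obtain i x j y where ij: "p = (i, x)" "q = (j, y)" by (cases p, cases q)
    obtain k where "(i, k) \<in> E" "(j, k) \<in> E" "f j k y = f i k x"
      using pq unfolding ij dl_rel_iff by (elim conjE exE) simp
    then show "(q, p) \<in> dl_rel I E M f"
      using pq unfolding ij dl_rel_iff by blast
  qed
  show "trans (dl_rel I E M f)"
  proof (rule transI)
    fix p q s assume pq: "(p, q) \<in> dl_rel I E M f" and qs: "(q, s) \<in> dl_rel I E M f"
    obtain i x j y l z where ijl: "p = (i, x)" "q = (j, y)" "s = (l, z)"
      by (cases p, cases q, cases s)
    have el: "i \<in> I" "x \<in> carrier (M i)" "y \<in> carrier (M j)" "l \<in> I" "z \<in> carrier (M l)"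
      using pq qs unfolding ijl dl_rel_iff by simp_all
    obtain k where k: "(i, k) \<in> E" "(j, k) \<in> E" "f i k x = f j k y"
      using pq unfolding ijl dl_rel_iff by (elim conjE exE) simp
    obtain m where m: "(j, m) \<in> E" "(l, m) \<in> E" "f j m y = f l m z"
      using qs unfolding ijl dl_rel_iff by (elim conjE exE) simp
    obtain n where n: "(k, n) \<in> E" "(m, n) \<in> E"
      using ub[of k m] le_in[OF k(1)] le_in[OF m(1)] by blast
    have "f i n x = f k n (f i k x)" using comp[OF k(1) n(1) el(2)] by simp
    also have "\<dots> = f j n y" using comp[OF k(2) n(1) el(3)] k(3) by simp
    also have "\<dots> = f m n (f j m y)" using comp[OF m(1) n(2) el(3)] by simp
    also have "\<dots> = f l n z" using comp[OF m(2) n(2) el(5)] m(3) by simp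
    finally have "f i n x = f l n z" .
    moreover have "(i, n) \<in> E" "(l, n) \<in> E"
      using le_trans[OF k(1) n(1)] le_trans[OF m(2) n(2)] by simp_all
    ultimately show "(p, s) \<in> dl_rel I E M f"
      unfolding ijl dl_rel_iff using el by blast
  qed
qed

lemma cls_eq_iff:
  assumes "i \<in> I" "x \<in> carrier (M i)" "j \<in> I" "y \<in> carrier (M j)"
  shows "cls i x = cls j y \<longleftrightarrow> (\<exists>k. (i, k) \<in> E \<and> (j, k) \<in> E \<and> f i k x = f j k y)"
proof -
  have "cls i x = cls j y \<longleftrightarrow> ((i, x), (j, y)) \<in> dl_rel I E M f"
    unfolding dl_class_def using eq_equiv_class_iff[OF equiv] assms by simp
  then show ?thesis using assms by (simp add: dl_rel_iff)
qed

lemma cls_in: "i \<in> I \<Longrightarrow> x \<in> carrier (M i) \<Longrightarrow> cls i x \<in> carrier L"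
  by (auto simp: direct_limit_def dl_class_def intro!: quotientI)

lemma cls_f: "(i, j) \<in> E \<Longrightarrow> x \<in> carrier (M i) \<Longrightarrow> cls j (f i j x) = cls i x"
  using le_in[of i j] le_refl[of j] f_closed[of i j x] ident[of j "f i j x"]
  by (subst cls_eq_iff) auto

lemma cls_E:
  assumes "X \<in> carrier L"
  obtains i x where "i \<in> I" "x \<in> carrier (M i)" "X = cls i x"
  using assms by (auto simp: direct_limit_def dl_class_def elim!: quotientE)

lemma mem_cls:
  assumes "i \<in> I" "x \<in> carrier (M i)"
  shows "(j, y) \<in> cls i x \<longleftrightarrow> j \<in> I \<and> y \<in> carrier (M j) \<and> cls j y = cls i x"
proof
  assume "(j, y) \<in> cls i x"
  then have "((i, x), (j, y)) \<in> dl_rel I E M f" by (simp add: dl_class_def)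
  then show "j \<in> I \<and> y \<in> carrier (M j) \<and> cls j y = cls i x"
    using equiv_class_eq[OF equiv, of "(i,x)" "(j,y)"] by (simp add: dl_class_def dl_rel_iff)
next
  assume a: "j \<in> I \<and> y \<in> carrier (M j) \<and> cls j y = cls i x"
  then have "(j, y) \<in> cls j y"
    unfolding dl_class_def using equiv_class_self[OF equiv, of "(j,y)"] by simp
  then show "(j, y) \<in> cls i x" using a by simp
qed

lemma cls_ract:
  assumes "i \<in> I" "x \<in> carrier (M i)" "a \<in> carrier R"
  shows "cls i x \<cdot>\<^bsub>L\<^esub> a = cls i (x \<cdot>\<^bsub>M i\<^esub> a)"
proof -
  have "cls j (y \<cdot>\<^bsub>M j\<^esub> a) = cls i (x \<cdot>\<^bsub>M i\<^esub> a)" if y: "(j, y) \<in> cls i x" for j y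
  proof -
    have j: "j \<in> I" "y \<in> carrier (M j)" "cls j y = cls i x" using y mem_cls assms by auto
    then obtain k where k: "(i, k) \<in> E" "(j, k) \<in> E" "f i k x = f j k y"
      using cls_eq_iff[of j y i x] assms by metis
    have c: "y \<cdot>\<^bsub>M j\<^esub> a \<in> carrier (M j)" "x \<cdot>\<^bsub>M i\<^esub> a \<in> carrier (M i)"
      using right_module.ract_closed[OF modules] j assms by auto
    have "f j k (y \<cdot>\<^bsub>M j\<^esub> a) = f i k (x \<cdot>\<^bsub>M i\<^esub> a)"
      using rhom_ract[OF homs[OF k(1)]] rhom_ract[OF homs[OF k(2)]] j assms k by simp
    then show ?thesis using cls_f[OF k(1) c(2)] cls_f[OF k(2) c(1)] by simp
  qed
  moreover have "(i, x) \<in> cls i x" using mem_cls assms by simp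
  ultimately have "{cls j (y \<cdot>\<^bsub>M j\<^esub> a) | j y. (j, y) \<in> cls i x} = {cls i (x \<cdot>\<^bsub>M i\<^esub> a)}"
    by blast
  then show ?thesis by (simp add: direct_limit_def)
qed

lemma cls_add:
  assumes "l \<in> I" "x \<in> carrier (M l)" "y \<in> carrier (M l)"
  shows "cls l x \<oplus>\<^bsub>L\<^esub> cls l y = cls l (x \<oplus>\<^bsub>M l\<^esub> y)"
proof -
  have *: "cls k (f i k x' \<oplus>\<^bsub>M k\<^esub> f j k y') = cls l (x \<oplus>\<^bsub>M l\<^esub> y)"
    if x': "(i, x') \<in> cls l x" and y': "(j, y') \<in> cls l y" and ik: "(i, k) \<in> E" "(j, k) \<in> E"
    for i j k x' y'
  proof -
    have i: "i \<in> I" "x' \<in> carrier (M i)" "cls i x' = cls l x" using x' mem_cls assms by auto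
    have j: "j \<in> I" "y' \<in> carrier (M j)" "cls j y' = cls l y" using y' mem_cls assms by auto
    have k: "k \<in> I" using ik le_in by blast
    have fk: "f i k x' \<in> carrier (M k)" "f j k y' \<in> carrier (M k)" using f_closed ik i j by auto
    have "cls k (f i k x') = cls l x" "cls k (f j k y') = cls l y" using cls_f ik i j by auto
    then obtain m n where m: "(k, m) \<in> E" "(l, m) \<in> E" "f k m (f i k x') = f l m x"
      and n: "(k, n) \<in> E" "(l, n) \<in> E" "f k n (f j k y') = f l n y"
      using cls_eq_iff assms k fk by metis
    obtain p where p: "(m, p) \<in> E" "(n, p) \<in> E" 
      using ub[of m n] le_in[OF m(1)] le_in[OF n(1)] by blast
    have kp: "(k, p) \<in> E" "(l, p) \<in> E" using le_trans m p by blast+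
    have "f k p (f i k x') = f l p x" using comp[OF m(1) p(1) fk(1)] comp[OF m(2) p(1) assms(2)] m
      by simp
    moreover have "f k p (f j k y') = f l p y"
      using comp[OF n(1) p(2) fk(2)] comp[OF n(2) p(2) assms(3)] n by simp
    ultimately have "f k p (f i k x' \<oplus>\<^bsub>M k\<^esub> f j k y') = f l p (x \<oplus>\<^bsub>M l\<^esub> y)"
      using rhom_add[OF homs[OF kp(1)]] rhom_add[OF homs[OF kp(2)]] fk assms by simp
    moreover have "f i k x' \<oplus>\<^bsub>M k\<^esub> f j k y' \<in> carrier (M k)" "x \<oplus>\<^bsub>M l\<^esub> y \<in> carrier (M l)"
      using abelian_groupE(1)[OF right_module.axioms(2)[OF modules]] k assms fk by auto
    ultimately show ?thesis using cls_eq_iff k assms kp by blast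
  qed
  have "(l, x) \<in> cls l x" "(l, y) \<in> cls l y" "(l, l) \<in> E" using mem_cls assms le_refl by auto
  then have "{cls k (f i k x' \<oplus>\<^bsub>M k\<^esub> f j k y') | i x' j y' k.
     (i, x') \<in> cls l x \<and> (j, y') \<in> cls l y \<and> (i, k) \<in> E \<and> (j, k) \<in> E} = {cls l (x \<oplus>\<^bsub>M l\<^esub> y)}"
    (is "?S = _")
  proof -
    have "cls l (x \<oplus>\<^bsub>M l\<^esub> y) \<in> ?S"
      using \<open>(l, x) \<in> cls l x\<close> \<open>(l, y) \<in> cls l y\<close> \<open>(l, l) \<in> E\<close> ident[of l x] ident[of l y] assms
      by (intro CollectI exI[of _ l] exI[of _ x] exI[of _ y]) auto
    moreover have "?S \<subseteq> {cls l (x \<oplus>\<^bsub>M l\<^esub> y)}" using * by blast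
    ultimately show ?thesis by blast
  qed
  then show ?thesis by (simp add: direct_limit_def)
qed

lemma cls_zero:
  assumes "l \<in> I"
  shows "\<zero>\<^bsub>L\<^esub> = cls l \<zero>\<^bsub>M l\<^esub>"
proof -
  have "cls i \<zero>\<^bsub>M i\<^esub> = cls l \<zero>\<^bsub>M l\<^esub>" if i: "i \<in> I" for i
  proof -
    obtain k where k: "(i, k) \<in> E" "(l, k) \<in> E" using ub i assms by blast
    have "f i k \<zero>\<^bsub>M i\<^esub> = f l k \<zero>\<^bsub>M l\<^esub>"
      using rhom_zero[OF homs[OF k(1)] modules modules] rhom_zero[OF homs[OF k(2)] modules modules]
        le_in[OF k(1)] i assms by simp
    moreover have "\<zero>\<^bsub>M i\<^esub> \<in> carrier (M i)" "\<zero>\<^bsub>M l\<^esub> \<in> carrier (M l)"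
      using abelian_groupE(2)[OF right_module.axioms(2)[OF modules]] i assms by auto
    ultimately show ?thesis using cls_eq_iff i assms k by blast
  qed
  then have "{cls i \<zero>\<^bsub>M i\<^esub> | i. i \<in> I} = {cls l \<zero>\<^bsub>M l\<^esub>}" using assms by blast
  then show ?thesis by (simp add: direct_limit_def)
qed

lemma cls_E2:
  assumes "X \<in> carrier L" "Y \<in> carrier L"
  obtains i x y where "i \<in> I" "x \<in> carrier (M i)" "y \<in> carrier (M i)" "X = cls i x" "Y = cls i y"
proof -
  obtain i x where i: "i \<in> I" "x \<in> carrier (M i)" "X = cls i x" using assms(1) by (rule cls_E)
  obtain j y where j: "j \<in> I" "y \<in> carrier (M j)" "Y = cls j y" using assms(2) by (rule cls_E)
  obtain k where k: "(i, k) \<in> E" "(j, k) \<in> E" using ub i(1) j(1) by blast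
  show ?thesis
    using that[of k "f i k x" "f j k y"] le_in[OF k(1)] f_closed[OF k(1) i(2)]
      f_closed[OF k(2) j(2)] cls_f[OF k(1) i(2)] cls_f[OF k(2) j(2)] i(3) j(3) by simp
qed

lemma cls_E3:
  assumes "X \<in> carrier L" "Y \<in> carrier L" "Z \<in> carrier L"
  obtains i x y z where "i \<in> I" "x \<in> carrier (M i)" "y \<in> carrier (M i)" "z \<in> carrier (M i)"
    "X = cls i x" "Y = cls i y" "Z = cls i z"
proof -
  obtain i x y where i: "i \<in> I" "x \<in> carrier (M i)" "y \<in> carrier (M i)"
    "X = cls i x" "Y = cls i y" using assms(1,2) by (rule cls_E2)
  obtain j z where j: "j \<in> I" "z \<in> carrier (M j)" "Z = cls j z" using assms(3) by (rule cls_E)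
  obtain k where k: "(i, k) \<in> E" "(j, k) \<in> E" using ub i(1) j(1) by blast
  show ?thesis
    using that[of k "f i k x" "f i k y" "f j k z"] le_in[OF k(1)] f_closed[OF k(1) i(2)]
      f_closed[OF k(1) i(3)] f_closed[OF k(2) j(2)] cls_f[OF k(1) i(2)] cls_f[OF k(1) i(3)]
      cls_f[OF k(2) j(2)] i(4,5) j(3) by simp
qed

lemma dl_right_module: "right_module R L"
proof -
  have R: "ring R" using modules nonempty right_module.axioms(1) by blast
  have ag: "abelian_group (M i)" if "i \<in> I" for i
    using modules[OF that] right_module.axioms(2) by blast
  note agE = abelian_groupE[OF ag]
  note closed = agE(1) agE(2) right_module.ract_closed[OF modules]
  have "abelian_group L"
  proof (rule abelian_groupI)
    fix X Y assume "X \<in> carrier L" "Y \<in> carrier L"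
    then obtain i x y where "i \<in> I" "x \<in> carrier (M i)" "y \<in> carrier (M i)"
      "X = cls i x" "Y = cls i y" by (rule cls_E2)
    then show "X \<oplus>\<^bsub>L\<^esub> Y \<in> carrier L" "X \<oplus>\<^bsub>L\<^esub> Y = Y \<oplus>\<^bsub>L\<^esub> X"
      using agE(4)[of i x y] by (auto simp: cls_add intro!: cls_in closed)
  next
    show "\<zero>\<^bsub>L\<^esub> \<in> carrier L" using nonempty cls_zero cls_in closed by fastforce
  next
    fix X Y Z assume "X \<in> carrier L" "Y \<in> carrier L" "Z \<in> carrier L"
    then obtain i x y z where "i \<in> I" "x \<in> carrier (M i)" "y \<in> carrier (M i)" "z \<in> carrier (M i)"
      "X = cls i x" "Y = cls i y" "Z = cls i z" by (rule cls_E3)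
    then show "X \<oplus>\<^bsub>L\<^esub> Y \<oplus>\<^bsub>L\<^esub> Z = X \<oplus>\<^bsub>L\<^esub> (Y \<oplus>\<^bsub>L\<^esub> Z)"
      using agE(3)[of i x y z] by (simp add: cls_add closed)
  next
    fix X assume "X \<in> carrier L"
    then obtain i x where i: "i \<in> I" "x \<in> carrier (M i)" "X = cls i x" by (rule cls_E)
    then show "\<zero>\<^bsub>L\<^esub> \<oplus>\<^bsub>L\<^esub> X = X"
      using agE(5)[of i x] cls_zero[of i] by (simp add: cls_add closed)
    obtain y where "y \<in> carrier (M i)" "y \<oplus>\<^bsub>M i\<^esub> x = \<zero>\<^bsub>M i\<^esub>" using agE(6) i by blast
    then show "\<exists>Y\<in>carrier L. Y \<oplus>\<^bsub>L\<^esub> X = \<zero>\<^bsub>L\<^esub>"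
      using i cls_zero[of i] by (intro bexI[of _ "cls i y"]) (auto simp: cls_add cls_in)
  qed
  moreover have "right_module_axioms R L"
  proof
    fix X a assume X: "X \<in> carrier L" and a: "a \<in> carrier R"
    from X obtain i x where i: "i \<in> I" "x \<in> carrier (M i)" "X = cls i x" by (rule cls_E)
    then show "X \<cdot>\<^bsub>L\<^esub> a \<in> carrier L" using a by (simp add: cls_ract cls_in closed)
    fix b assume b: "b \<in> carrier R"
    have ab: "a \<oplus>\<^bsub>R\<^esub> b \<in> carrier R" "a \<otimes>\<^bsub>R\<^esub> b \<in> carrier R"
      using R a b by (auto intro: ring.ring_simprules)
    show "X \<cdot>\<^bsub>L\<^esub> (a \<oplus>\<^bsub>R\<^esub> b) = X \<cdot>\<^bsub>L\<^esub> a \<oplus>\<^bsub>L\<^esub> X \<cdot>\<^bsub>L\<^esub> b"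
      using i a b ab right_module.ract_add_right[OF modules]
      by (simp add: cls_ract cls_add closed)
    show "X \<cdot>\<^bsub>L\<^esub> (a \<otimes>\<^bsub>R\<^esub> b) = X \<cdot>\<^bsub>L\<^esub> a \<cdot>\<^bsub>L\<^esub> b"
      using i a b ab right_module.ract_mult[OF modules] by (simp add: cls_ract closed)
  next
    fix X Y a assume XY: "X \<in> carrier L" "Y \<in> carrier L" and a: "a \<in> carrier R"
    from XY obtain i x y where i: "i \<in> I" "x \<in> carrier (M i)" "y \<in> carrier (M i)"
      "X = cls i x" "Y = cls i y" by (rule cls_E2)
    then show "(X \<oplus>\<^bsub>L\<^esub> Y) \<cdot>\<^bsub>L\<^esub> a = X \<cdot>\<^bsub>L\<^esub> a \<oplus>\<^bsub>L\<^esub> Y \<cdot>\<^bsub>L\<^esub> a"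
      using a right_module.ract_add_left[OF modules] by (simp add: cls_ract cls_add closed)
  next
    fix X assume "X \<in> carrier L"
    then obtain i x where i: "i \<in> I" "x \<in> carrier (M i)" "X = cls i x" by (rule cls_E)
    then show "X \<cdot>\<^bsub>L\<^esub> \<one>\<^bsub>R\<^esub> = X"
      using right_module.ract_one[OF modules] R
      by (simp add: cls_ract ring.ring_simprules)
  qed
  ultimately show ?thesis using R by (simp add: right_module_def)
qed

lemma dl_cocone:
  shows "i \<in> I \<Longrightarrow> cls i \<in> rhom R (M i) L"
    and "(i, j) \<in> E \<Longrightarrow> x \<in> carrier (M i) \<Longrightarrow> cls j (f i j x) = cls i x"
proof -
  show "cls i \<in> rhom R (M i) L" if "i \<in> I"
    using that by (simp add: rhom_def Pi_iff cls_in cls_add cls_ract)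
  show "cls j (f i j x) = cls i x" if "(i, j) \<in> E" "x \<in> carrier (M i)"
    using that by (rule cls_f)
qed

lemma dl_universal:
  fixes N :: "('r, 'n) rmod"
  assumes N: "right_module R N"
    and g: "\<And>i. i \<in> I \<Longrightarrow> g i \<in> rhom R (M i) N"
    and compat: "\<And>i j x. (i, j) \<in> E \<Longrightarrow> x \<in> carrier (M i) \<Longrightarrow> g j (f i j x) = g i x"
  shows "\<exists>u\<in>rhom R L N. \<forall>i\<in>I. \<forall>x\<in>carrier (M i). u (cls i x) = g i x"
    and "\<lbrakk>u \<in> rhom R L N; v \<in> rhom R L N;
          \<And>i x. i \<in> I \<Longrightarrow> x \<in> carrier (M i) \<Longrightarrow> u (cls i x) = g i x;
          \<And>i x. i \<in> I \<Longrightarrow> x \<in> carrier (M i) \<Longrightarrow> v (cls i x) = g i x; X \<in> carrier L\<rbrakk>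
         \<Longrightarrow> u X = v X"
proof -
  define u where "u X = (SOME z. \<exists>i x. i \<in> I \<and> x \<in> carrier (M i) \<and> X = cls i x \<and> z = g i x)" for X
  have u: "u (cls i x) = g i x" if ix: "i \<in> I" "x \<in> carrier (M i)" for i x
  proof -
    have "\<exists>z j y. j \<in> I \<and> y \<in> carrier (M j) \<and> cls i x = cls j y \<and> z = g j y" using ix by blast
    from someI_ex[OF this] obtain j y where j: "j \<in> I" "y \<in> carrier (M j)" "cls i x = cls j y"
      "u (cls i x) = g j y" unfolding u_def[symmetric] by blast
    then obtain k where "(i, k) \<in> E" "(j, k) \<in> E" "f i k x = f j k y" using cls_eq_iff ix by metis
    then show ?thesis using compat ix j by metis
  qed
  have "u \<in> rhom R L N"
    unfolding rhom_def
  proof (intro CollectI conjI ballI Pi_I)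
    fix X assume "X \<in> carrier L"
    then obtain i x where i: "i \<in> I" "x \<in> carrier (M i)" "X = cls i x" by (rule cls_E)
    then show "u X \<in> carrier N" using u rhom_closed[OF g] by simp
    fix a assume "a \<in> carrier R"
    then show "u (X \<cdot>\<^bsub>L\<^esub> a) = u X \<cdot>\<^bsub>N\<^esub> a"
      using i u rhom_ract[OF g] right_module.ract_closed[OF modules] by (simp add: cls_ract)
  next
    fix X Y assume "X \<in> carrier L" "Y \<in> carrier L"
    then obtain i x y where i: "i \<in> I" "x \<in> carrier (M i)" "y \<in> carrier (M i)"
      "X = cls i x" "Y = cls i y" by (rule cls_E2)
    then show "u (X \<oplus>\<^bsub>L\<^esub> Y) = u X \<oplus>\<^bsub>N\<^esub> u Y"
      using u rhom_add[OF g] abelian_groupE(1)[OF right_module.axioms(2)[OF modules]]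
      by (simp add: cls_add)
  qed
  then show "\<exists>u\<in>rhom R L N. \<forall>i\<in>I. \<forall>x\<in>carrier (M i). u (cls i x) = g i x" using u by blast
next
  assume "\<And>i x. i \<in> I \<Longrightarrow> x \<in> carrier (M i) \<Longrightarrow> u (cls i x) = g i x"
    "\<And>i x. i \<in> I \<Longrightarrow> x \<in> carrier (M i) \<Longrightarrow> v (cls i x) = g i x" "X \<in> carrier L"
  then show "u X = v X" by (metis cls_E)
qed

end

context right_module
begin

lemma ract_zero_right: "x \<in> carrier M \<Longrightarrow> x \<cdot>\<^bsub>M\<^esub> \<zero>\<^bsub>R\<^esub> = \<zero>\<^bsub>M\<^esub>"
proof -
  assume x: "x \<in> carrier M"
  have "x \<cdot>\<^bsub>M\<^esub> \<zero>\<^bsub>R\<^esub> \<oplus>\<^bsub>M\<^esub> x \<cdot>\<^bsub>M\<^esub> \<zero>\<^bsub>R\<^esub> = x \<cdot>\<^bsub>M\<^esub> \<zero>\<^bsub>R\<^esub>"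
    using ract_add_right[OF x, of "\<zero>\<^bsub>R\<^esub>" "\<zero>\<^bsub>R\<^esub>"] by simp
  then show ?thesis
    using M.add.r_cancel_one[of "x \<cdot>\<^bsub>M\<^esub> \<zero>\<^bsub>R\<^esub>" "x \<cdot>\<^bsub>M\<^esub> \<zero>\<^bsub>R\<^esub>"] ract_closed[OF x, of "\<zero>\<^bsub>R\<^esub>"] by simp
qed

lemma ract_zero_left: "a \<in> carrier R \<Longrightarrow> \<zero>\<^bsub>M\<^esub> \<cdot>\<^bsub>M\<^esub> a = \<zero>\<^bsub>M\<^esub>"
proof -
  assume a: "a \<in> carrier R"
  have "\<zero>\<^bsub>M\<^esub> \<cdot>\<^bsub>M\<^esub> a \<oplus>\<^bsub>M\<^esub> \<zero>\<^bsub>M\<^esub> \<cdot>\<^bsub>M\<^esub> a = \<zero>\<^bsub>M\<^esub> \<cdot>\<^bsub>M\<^esub> a"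
    using ract_add_left[of "\<zero>\<^bsub>M\<^esub>" "\<zero>\<^bsub>M\<^esub>" a] a by simp
  then show ?thesis
    using M.add.r_cancel_one[of "\<zero>\<^bsub>M\<^esub> \<cdot>\<^bsub>M\<^esub> a" "\<zero>\<^bsub>M\<^esub> \<cdot>\<^bsub>M\<^esub> a"] ract_closed[of "\<zero>\<^bsub>M\<^esub>" a] a by simp
qed

lemma finsum_ract:
  assumes "finite T" "a \<in> carrier R" "\<And>p. p \<in> T \<Longrightarrow> w p \<in> carrier M"
  shows "finsum M w T \<cdot>\<^bsub>M\<^esub> a = finsum M (\<lambda>p. w p \<cdot>\<^bsub>M\<^esub> a) T"
  using assms(1,3)
proof (induction T)
  case empty
  then show ?case using assms(2) by (simp add: ract_zero_left)
next
  case (insert p T)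
  have w: "w \<in> T \<rightarrow> carrier M" "w p \<in> carrier M" using insert.prems by auto
  moreover from this have "(\<lambda>p. w p \<cdot>\<^bsub>M\<^esub> a) \<in> T \<rightarrow> carrier M" "w p \<cdot>\<^bsub>M\<^esub> a \<in> carrier M"
    using ract_closed assms(2) by auto
  ultimately show ?case
    using insert.hyps insert.IH insert.prems assms(2)
    by (simp add: M.finsum_insert ract_add_left M.finsum_closed)
qed

end

lemma rhom_finsum:
  assumes "h \<in> rhom R M N" "right_module R M" "right_module R N"
    and "finite T" "\<And>p. p \<in> T \<Longrightarrow> w p \<in> carrier M"
  shows "h (finsum M w T) = finsum N (\<lambda>p. h (w p)) T"
proof -
  interpret M: right_module R M by fact
  interpret N: right_module R N by fact
  show ?thesis
    using assms(4,5)
  proof (induction T)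
    case empty
    then show ?case using rhom_zero[OF assms(1-3)] by simp
  next
    case (insert p T)
    have w: "w \<in> T \<rightarrow> carrier M" "w p \<in> carrier M" using insert.prems by auto
    moreover from this have "(\<lambda>p. h (w p)) \<in> T \<rightarrow> carrier N" "h (w p) \<in> carrier N"
      using rhom_closed[OF assms(1)] by auto
    ultimately show ?case
      using insert.hyps insert.IH insert.prems rhom_add[OF assms(1)]
      by (simp add: M.M.finsum_insert N.M.finsum_insert M.M.finsum_closed)
  qed
qed

definition free_rmod :: "('r, 'e) ring_scheme \<Rightarrow> 'p set \<Rightarrow> ('r, 'p \<Rightarrow> 'r) rmod"
  where "free_rmod R S =
    \<lparr>carrier = {u. (\<forall>p. u p \<in> carrier R) \<and> finite {p. u p \<noteq> \<zero>\<^bsub>R\<^esub>} \<and> (\<forall>p. p \<notin> S \<longrightarrow> u p = \<zero>\<^bsub>R\<^esub>)},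
     mult = undefined, one = undefined,
     zero = (\<lambda>_. \<zero>\<^bsub>R\<^esub>),
     add = (\<lambda>u v p. u p \<oplus>\<^bsub>R\<^esub> v p),
     ract = (\<lambda>u a p. u p \<otimes>\<^bsub>R\<^esub> a)\<rparr>"

lemma free_right_module:
  assumes "ring R"
  shows "right_module R (free_rmod R S)" (is "right_module R ?F")
proof -
  interpret ring R by fact
  have add: "(\<lambda>p. u p \<oplus>\<^bsub>R\<^esub> v p) \<in> carrier ?F" if "u \<in> carrier ?F" "v \<in> carrier ?F" for u v
  proof -
    have "finite ({p. u p \<noteq> \<zero>\<^bsub>R\<^esub>} \<union> {p. v p \<noteq> \<zero>\<^bsub>R\<^esub>})" using that by (simp add: free_rmod_def)
    then have "finite {p. u p \<oplus>\<^bsub>R\<^esub> v p \<noteq> \<zero>\<^bsub>R\<^esub>}" by (rule rev_finite_subset) auto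
    then show ?thesis using that by (simp add: free_rmod_def)
  qed
  have act: "(\<lambda>p. u p \<otimes>\<^bsub>R\<^esub> a) \<in> carrier ?F" if "u \<in> carrier ?F" "a \<in> carrier R" for u a
  proof -
    have "finite {p. u p \<noteq> \<zero>\<^bsub>R\<^esub>}" using that by (simp add: free_rmod_def)
    then have "finite {p. u p \<otimes>\<^bsub>R\<^esub> a \<noteq> \<zero>\<^bsub>R\<^esub>}" by (rule rev_finite_subset) (auto simp: that)
    then show ?thesis using that by (simp add: free_rmod_def)
  qed
  have neg: "(\<lambda>p. \<ominus>\<^bsub>R\<^esub> u p) \<in> carrier ?F" if "u \<in> carrier ?F" for u
  proof -
    have "finite {p. u p \<noteq> \<zero>\<^bsub>R\<^esub>}" using that by (simp add: free_rmod_def)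
    then have "finite {p. \<ominus>\<^bsub>R\<^esub> u p \<noteq> \<zero>\<^bsub>R\<^esub>}" by (rule rev_finite_subset) auto
    then show ?thesis using that by (simp add: free_rmod_def)
  qed
  have R: "u \<in> carrier ?F \<Longrightarrow> u p \<in> carrier R" for u p by (simp add: free_rmod_def)
  have ops: "u \<oplus>\<^bsub>?F\<^esub> v = (\<lambda>p. u p \<oplus>\<^bsub>R\<^esub> v p)" "\<zero>\<^bsub>?F\<^esub> = (\<lambda>_. \<zero>\<^bsub>R\<^esub>)" "u \<cdot>\<^bsub>?F\<^esub> a = (\<lambda>p. u p \<otimes>\<^bsub>R\<^esub> a)"
    for u v a by (simp_all add: free_rmod_def)
  have "abelian_group ?F"
  proof (rule abelian_groupI)
    show "\<zero>\<^bsub>?F\<^esub> \<in> carrier ?F" by (simp add: free_rmod_def)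
    fix u assume u: "u \<in> carrier ?F"
    show "\<zero>\<^bsub>?F\<^esub> \<oplus>\<^bsub>?F\<^esub> u = u" using R[OF u] by (simp add: ops)
    show "\<exists>v\<in>carrier ?F. v \<oplus>\<^bsub>?F\<^esub> u = \<zero>\<^bsub>?F\<^esub>"
      using neg[OF u] R[OF u] by (intro bexI[of _ "\<lambda>p. \<ominus>\<^bsub>R\<^esub> u p"]) (simp_all add: ops l_neg)
    fix v assume v: "v \<in> carrier ?F"
    show "u \<oplus>\<^bsub>?F\<^esub> v \<in> carrier ?F" using add[OF u v] by (simp add: ops)
    show "u \<oplus>\<^bsub>?F\<^esub> v = v \<oplus>\<^bsub>?F\<^esub> u" using R[OF u] R[OF v] by (simp add: ops a_comm)
    fix w assume w: "w \<in> carrier ?F"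
    show "u \<oplus>\<^bsub>?F\<^esub> v \<oplus>\<^bsub>?F\<^esub> w = u \<oplus>\<^bsub>?F\<^esub> (v \<oplus>\<^bsub>?F\<^esub> w)"
      using R[OF u] R[OF v] R[OF w] by (simp add: ops a_assoc)
  qed
  moreover have "right_module_axioms R ?F"
    by unfold_locales (simp_all add: ops(1,3) act R l_distr r_distr m_assoc)
  ultimately show ?thesis using assms by (simp add: right_module_def)
qed

definition lin_ext :: "('r, 'e) ring_scheme \<Rightarrow> ('r, 'm) rmod \<Rightarrow> ('p \<Rightarrow> 'm) \<Rightarrow> ('p \<Rightarrow> 'r) \<Rightarrow> 'm"
  where "lin_ext R M m u = finsum M (\<lambda>p. m p \<cdot>\<^bsub>M\<^esub> u p) {p. u p \<noteq> \<zero>\<^bsub>R\<^esub>}"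

lemma lin_ext_eq:
  assumes "right_module R M" "u \<in> carrier (free_rmod R S)" "\<And>p. p \<in> S \<Longrightarrow> m p \<in> carrier M"
    and "finite T" "{p. u p \<noteq> \<zero>\<^bsub>R\<^esub>} \<subseteq> T" "T \<subseteq> S"
  shows "lin_ext R M m u = finsum M (\<lambda>p. m p \<cdot>\<^bsub>M\<^esub> u p) T"
proof -
  interpret right_module R M by fact
  have c: "u p \<in> carrier R" for p using assms(2) by (simp add: free_rmod_def)
  show ?thesis
    unfolding lin_ext_def
  proof (rule M.add.finprod_mono_neutral_cong_left)
    show "finite T" "{p. u p \<noteq> \<zero>\<^bsub>R\<^esub>} \<subseteq> T" by fact+
    show "m p \<cdot>\<^bsub>M\<^esub> u p = \<zero>\<^bsub>M\<^esub>" if "p \<in> T - {p. u p \<noteq> \<zero>\<^bsub>R\<^esub>}" for p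
    proof -
      have "m p \<in> carrier M" "u p = \<zero>\<^bsub>R\<^esub>" using that assms(3,6) by blast+
      then show ?thesis by (simp add: ract_zero_right)
    qed
    show "(\<lambda>p. m p \<cdot>\<^bsub>M\<^esub> u p) \<in> T \<rightarrow> carrier M"
      by (rule Pi_I, rule ract_closed[OF assms(3) c]) (rule subsetD[OF assms(6)])
  qed simp
qed

lemma free_supp:
  assumes "u \<in> carrier (free_rmod R S)"
  shows "finite {p. u p \<noteq> \<zero>\<^bsub>R\<^esub>}" "{p. u p \<noteq> \<zero>\<^bsub>R\<^esub>} \<subseteq> S" "u p \<in> carrier R"
proof -
  have *: "\<forall>p. u p \<in> carrier R" "finite {p. u p \<noteq> \<zero>\<^bsub>R\<^esub>}" "\<forall>p. p \<notin> S \<longrightarrow> u p = \<zero>\<^bsub>R\<^esub>"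
    using assms by (simp_all add: free_rmod_def)
  show "finite {p. u p \<noteq> \<zero>\<^bsub>R\<^esub>}" by (rule *(2))
  show "{p. u p \<noteq> \<zero>\<^bsub>R\<^esub>} \<subseteq> S" using *(3) by blast
  show "u p \<in> carrier R" using *(1) by blast
qed

lemma lin_ext_rhom:
  assumes "right_module R M" "\<And>p. p \<in> S \<Longrightarrow> m p \<in> carrier M"
  shows "lin_ext R M m \<in> rhom R (free_rmod R S) M"
proof -
  interpret right_module R M by fact
  let ?F = "free_rmod R S"
  interpret F: right_module R ?F by (rule free_right_module) (rule R.ring_axioms)
  have eq: "lin_ext R M m u = finsum M (\<lambda>p. m p \<cdot>\<^bsub>M\<^esub> u p) T"
    if "u \<in> carrier ?F" "finite T" "{p. u p \<noteq> \<zero>\<^bsub>R\<^esub>} \<subseteq> T" "T \<subseteq> S" for u T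
    using assms(1) that(1) assms(2) that(2-4) by (rule lin_ext_eq)
  have mc: "m p \<cdot>\<^bsub>M\<^esub> u p \<in> carrier M" if "p \<in> S" "u \<in> carrier ?F" for p u
    by (rule ract_closed[OF assms(2)[OF that(1)] free_supp(3)[OF that(2)]])
  show ?thesis
    unfolding rhom_def
  proof (intro CollectI conjI Pi_I ballI)
    fix u assume u: "u \<in> carrier ?F"
    note fu = free_supp[OF u]
    show "lin_ext R M m u \<in> carrier M"
      unfolding lin_ext_def by (rule M.finsum_closed, rule Pi_I, rule mc[OF subsetD[OF fu(2)] u])
    fix a assume a: "a \<in> carrier R"
    have ua: "u \<cdot>\<^bsub>?F\<^esub> a = (\<lambda>p. u p \<otimes>\<^bsub>R\<^esub> a)" by (simp add: free_rmod_def)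
    have uaF: "u \<cdot>\<^bsub>?F\<^esub> a \<in> carrier ?F" using u a by (rule F.ract_closed)
    have sub: "{p. (u \<cdot>\<^bsub>?F\<^esub> a) p \<noteq> \<zero>\<^bsub>R\<^esub>} \<subseteq> {p. u p \<noteq> \<zero>\<^bsub>R\<^esub>}" unfolding ua using a by auto
    have "lin_ext R M m (u \<cdot>\<^bsub>?F\<^esub> a) = finsum M (\<lambda>p. m p \<cdot>\<^bsub>M\<^esub> (u p \<otimes>\<^bsub>R\<^esub> a)) {p. u p \<noteq> \<zero>\<^bsub>R\<^esub>}"
      using eq[OF uaF fu(1) sub fu(2)] unfolding ua .
    also have "\<dots> = finsum M (\<lambda>p. (m p \<cdot>\<^bsub>M\<^esub> u p) \<cdot>\<^bsub>M\<^esub> a) {p. u p \<noteq> \<zero>\<^bsub>R\<^esub>}"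
    proof (rule M.finsum_cong')
      fix p assume "p \<in> {p. u p \<noteq> \<zero>\<^bsub>R\<^esub>}"
      then have p: "p \<in> S" using fu(2) by blast
      show "m p \<cdot>\<^bsub>M\<^esub> (u p \<otimes>\<^bsub>R\<^esub> a) = (m p \<cdot>\<^bsub>M\<^esub> u p) \<cdot>\<^bsub>M\<^esub> a"
        using ract_mult[OF assms(2)[OF p] fu(3) a] .
    next
      show "(\<lambda>p. (m p \<cdot>\<^bsub>M\<^esub> u p) \<cdot>\<^bsub>M\<^esub> a) \<in> {p. u p \<noteq> \<zero>\<^bsub>R\<^esub>} \<rightarrow> carrier M"
        by (rule Pi_I, rule ract_closed[OF mc[OF subsetD[OF fu(2)] u] a])
    qed simp
    also have "\<dots> = lin_ext R M m u \<cdot>\<^bsub>M\<^esub> a"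
      unfolding lin_ext_def
      by (rule finsum_ract[symmetric, OF fu(1) a]) (rule mc[OF subsetD[OF fu(2)] u])
    finally show "lin_ext R M m (u \<cdot>\<^bsub>?F\<^esub> a) = lin_ext R M m u \<cdot>\<^bsub>M\<^esub> a" .
  next
    fix u v assume u: "u \<in> carrier ?F" and v: "v \<in> carrier ?F"
    note fu = free_supp[OF u] and fv = free_supp[OF v]
    let ?T = "{p. u p \<noteq> \<zero>\<^bsub>R\<^esub>} \<union> {p. v p \<noteq> \<zero>\<^bsub>R\<^esub>}"
    have T: "finite ?T" "?T \<subseteq> S" using fu fv by auto
    have uv: "u \<oplus>\<^bsub>?F\<^esub> v = (\<lambda>p. u p \<oplus>\<^bsub>R\<^esub> v p)" by (simp add: free_rmod_def)
    have uvF: "u \<oplus>\<^bsub>?F\<^esub> v \<in> carrier ?F" using u v by (rule F.M.a_closed)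
    have sub: "{p. (u \<oplus>\<^bsub>?F\<^esub> v) p \<noteq> \<zero>\<^bsub>R\<^esub>} \<subseteq> ?T" unfolding uv by auto
    have "lin_ext R M m (u \<oplus>\<^bsub>?F\<^esub> v) = finsum M (\<lambda>p. m p \<cdot>\<^bsub>M\<^esub> (u p \<oplus>\<^bsub>R\<^esub> v p)) ?T"
      using eq[OF uvF T(1) sub T(2)] unfolding uv .
    also have "\<dots> = finsum M (\<lambda>p. m p \<cdot>\<^bsub>M\<^esub> u p \<oplus>\<^bsub>M\<^esub> m p \<cdot>\<^bsub>M\<^esub> v p) ?T"
    proof (rule M.finsum_cong')
      fix p assume "p \<in> ?T"
      then have p: "p \<in> S" using T(2) by blast
      show "m p \<cdot>\<^bsub>M\<^esub> (u p \<oplus>\<^bsub>R\<^esub> v p) = m p \<cdot>\<^bsub>M\<^esub> u p \<oplus>\<^bsub>M\<^esub> m p \<cdot>\<^bsub>M\<^esub> v p"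
        using ract_add_right[OF assms(2)[OF p] fu(3) fv(3)] .
    next
      show "(\<lambda>p. m p \<cdot>\<^bsub>M\<^esub> u p \<oplus>\<^bsub>M\<^esub> m p \<cdot>\<^bsub>M\<^esub> v p) \<in> ?T \<rightarrow> carrier M"
        by (rule Pi_I, rule M.a_closed[OF mc[OF subsetD[OF T(2)] u] mc[OF subsetD[OF T(2)] v]])
    qed simp
    also have "\<dots> = finsum M (\<lambda>p. m p \<cdot>\<^bsub>M\<^esub> u p) ?T \<oplus>\<^bsub>M\<^esub> finsum M (\<lambda>p. m p \<cdot>\<^bsub>M\<^esub> v p) ?T"
      by (rule M.finsum_addf)
        (rule Pi_I, rule mc[OF subsetD[OF T(2)] u] mc[OF subsetD[OF T(2)] v], assumption)+
    also have "\<dots> = lin_ext R M m u \<oplus>\<^bsub>M\<^esub> lin_ext R M m v"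
      using eq[OF u T(1) Un_upper1 T(2)] eq[OF v T(1) Un_upper2 T(2)] by simp
    finally show "lin_ext R M m (u \<oplus>\<^bsub>?F\<^esub> v) = lin_ext R M m u \<oplus>\<^bsub>M\<^esub> lin_ext R M m v" .
  qed
qed

lemma rhom_lin_ext:
  assumes "h \<in> rhom R M N" "right_module R M" "right_module R N"
    and u: "u \<in> carrier (free_rmod R S)" and m: "\<And>p. p \<in> S \<Longrightarrow> m p \<in> carrier M"
    and n: "\<And>p. p \<in> S \<Longrightarrow> n p = h (m p)"
  shows "h (lin_ext R M m u) = lin_ext R N n u"
proof -
  interpret M: right_module R M by fact
  interpret N: right_module R N by fact
  note fu = free_supp[OF u]
  have m': "m p \<in> carrier M" if "p \<in> {p. u p \<noteq> \<zero>\<^bsub>R\<^esub>}" for p using that m fu(2) by blast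
  have "h (lin_ext R M m u) = finsum N (\<lambda>p. h (m p \<cdot>\<^bsub>M\<^esub> u p)) {p. u p \<noteq> \<zero>\<^bsub>R\<^esub>}"
    unfolding lin_ext_def
    by (rule rhom_finsum[OF assms(1-3) fu(1)]) (rule M.ract_closed[OF m' fu(3)])
  also have "\<dots> = lin_ext R N n u"
    unfolding lin_ext_def
  proof (rule N.M.finsum_cong')
    fix p assume p: "p \<in> {p. u p \<noteq> \<zero>\<^bsub>R\<^esub>}"
    then have "n p = h (m p)" using n fu(2) by blast
    then show "h (m p \<cdot>\<^bsub>M\<^esub> u p) = n p \<cdot>\<^bsub>N\<^esub> u p" using rhom_ract[OF assms(1) m'[OF p] fu(3)] by simp
  next
    show "(\<lambda>p. n p \<cdot>\<^bsub>N\<^esub> u p) \<in> {p. u p \<noteq> \<zero>\<^bsub>R\<^esub>} \<rightarrow> carrier N"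
    proof (rule Pi_I)
      fix p assume p: "p \<in> {p. u p \<noteq> \<zero>\<^bsub>R\<^esub>}"
      then have "n p = h (m p)" using n fu(2) by blast
      then show "n p \<cdot>\<^bsub>N\<^esub> u p \<in> carrier N"
        using N.ract_closed[OF rhom_closed[OF assms(1) m'[OF p]] fu(3)] by simp
    qed
  qed simp
  finally show ?thesis .
qed

lemma projective_lift:
  fixes P :: "('r, 'p) rmod" and M :: "('r, 'm) rmod" and N :: "('r, 'n) rmod"
  assumes P: "projective R P" and M: "right_module R M" and N: "right_module R N"
    and g: "g \<in> rhom R M N" "g ` carrier M = carrier N" and f: "f \<in> rhom R P N"
  shows "\<exists>h\<in>rhom R P M. \<forall>x\<in>carrier P. g (h x) = f x"
proof -
  let ?F = "free_rmod R (carrier P)"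
  have PM: "right_module R P" using P by (simp add: projective_def)
  interpret P: right_module R P by (rule PM)
  have F: "right_module R ?F" by (rule free_right_module) (rule P.R.ring_axioms)
  have \<pi>: "lin_ext R P (\<lambda>p. p) \<in> rhom R ?F P" using PM by (rule lin_ext_rhom) simp
  have surj: "lin_ext R P (\<lambda>p. p) ` carrier ?F = carrier P"
  proof
    show "lin_ext R P (\<lambda>p. p) ` carrier ?F \<subseteq> carrier P" using rhom_closed[OF \<pi>] by blast
    show "carrier P \<subseteq> lin_ext R P (\<lambda>p. p) ` carrier ?F"
    proof
      fix q assume q: "q \<in> carrier P"
      define u where "u = (\<lambda>p. if p = q then \<one>\<^bsub>R\<^esub> else \<zero>\<^bsub>R\<^esub>)"
      have sub: "{p. u p \<noteq> \<zero>\<^bsub>R\<^esub>} \<subseteq> {q}" by (auto simp: u_def)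
      have u: "u \<in> carrier ?F"
        using q finite_subset[OF sub] by (auto simp: free_rmod_def u_def)
      have "lin_ext R P (\<lambda>p. p) u = finsum P (\<lambda>p. p \<cdot>\<^bsub>P\<^esub> u p) {q}"
        using PM u by (rule lin_ext_eq) (use q sub in simp_all)
      also have "\<dots> = q"
        using q P.ract_one[OF q] by (simp add: P.M.finsum_insert u_def)
      finally show "q \<in> lin_ext R P (\<lambda>p. p) ` carrier ?F" using u by (metis imageI)
    qed
  qed
  have "(\<lambda>x. x) \<in> rhom R P P" by (simp add: rhom_def)
  then obtain s where s: "s \<in> rhom R P ?F" "\<And>x. x \<in> carrier P \<Longrightarrow> lin_ext R P (\<lambda>p. p) (s x) = x"
    using P F PM \<pi> surj unfolding projective_def by blast
  have "\<forall>p\<in>carrier P. \<exists>y. y \<in> carrier M \<and> g y = f p"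
    using g(2) rhom_closed[OF f] by (metis imageE)
  then obtain m where m: "\<And>p. p \<in> carrier P \<Longrightarrow> m p \<in> carrier M"
    "\<And>p. p \<in> carrier P \<Longrightarrow> f p = g (m p)" by metis
  have \<mu>: "lin_ext R M m \<in> rhom R ?F M" using M m(1) by (rule lin_ext_rhom)
  define h where "h x = lin_ext R M m (s x)" for x
  have "h \<in> rhom R P M"
    unfolding rhom_def h_def
    using rhom_closed[OF s(1)] rhom_add[OF s(1)] rhom_ract[OF s(1)]
      rhom_closed[OF \<mu>] rhom_add[OF \<mu>] rhom_ract[OF \<mu>] by simp
  moreover have "g (h x) = f x" if x: "x \<in> carrier P" for x
  proof -
    have sx: "s x \<in> carrier ?F" using rhom_closed[OF s(1) x] .
    have "g (h x) = lin_ext R N f (s x)"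
      unfolding h_def using g(1) M N sx m by (rule rhom_lin_ext)
    also have "\<dots> = f (lin_ext R P (\<lambda>p. p) (s x))"
      using rhom_lin_ext[OF f PM N sx, of "\<lambda>p. p" f] by simp
    also have "\<dots> = f x" using s(2)[OF x] by simp
    finally show ?thesis .
  qed
  ultimately show ?thesis by blast
qed

end

theory Submission
  imports Defs
begin

text \<open>
  A module is a direct limit of modules from a class \<open>C\<close> of finitely presented modules as soon as
  every homomorphism into it from a finitely presented module factors through a module in \<open>C\<close>
  (Lenzing's criterion, \<open>dirlim_class_if_factors\<close>). So it suffices to factor, for an extension
  \<open>0 \<rightarrow> A \<rightarrow> B \<rightarrow> D \<rightarrow> 0\<close> with \<open>A = lim A\<^sub>i\<close> and \<open>D = lim D\<^sub>j\<close>, a homomorphism \<open>F \<rightarrow> B\<close> from a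
  finitely presented module \<open>F\<close>. This is \<open>extension_factors_through\<close>.

  The composite \<open>F \<rightarrow> B \<rightarrow> D\<close> factors through some \<open>Z = D\<^sub>j\<close>. The pullback of the extension along
  \<open>Z \<rightarrow> D\<close> is an extension of \<open>Z\<close> by \<open>A\<close>. Since \<open>Z\<close> is FP2, the functor \<open>Ext\<^sup>1(Z, -)\<close> commutes with
  direct limits, and hence this extension is the pushout of an extension \<open>0 \<rightarrow> A\<^sub>i \<rightarrow> Y \<rightarrow> Z \<rightarrow> 0\<close>.
  The module \<open>Y\<close> is in \<open>C\<close>, and after enlarging \<open>i\<close> the homomorphism \<open>F \<rightarrow> B\<close> factors through \<open>Y\<close>.

  The part of this about \<open>Ext\<^sup>1\<close> can be done by hand with a projective resolution
  \<open>P\<^sub>2 \<rightarrow> P\<^sub>1 \<rightarrow> P\<^sub>0 \<rightarrow> Z\<close>. Lifting \<open>P\<^sub>0 \<rightarrow> Z \<rightarrow> D\<close> to \<open>P\<^sub>0 \<rightarrow> B\<close> yields a cocycle \<open>P\<^sub>1 \<rightarrow> A\<close>. As \<open>P\<^sub>1\<close> is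
  projective and finitely generated, the cocycle lifts to some \<open>A\<^sub>i\<close>; as \<open>P\<^sub>2\<close> is finitely generated,
  the lift becomes a cocycle at a later index (\<open>lift_resolution\<close>). A cocycle is the same as a
  homomorphism from the kernel of \<open>P\<^sub>0 \<rightarrow> Z\<close> to \<open>A\<^sub>i\<close>, and \<open>Y\<close> is the pushout of \<open>P\<^sub>0\<close> along it
  (\<open>pushout_extension\<close>).

  Finitely presented modules appear only through finite sets \<open>S\<close> of generators and \<open>U\<close> of relations
  between them, so that neither \<open>F\<close> nor the pullback has to be constructed.
\<close>

section \<open>Homomorphisms and submodules\<close>

lemma rhom_comp:
  assumes "h \<in> rhom R M N" "k \<in> rhom R N Q"
  shows "(\<lambda>x. k (h x)) \<in> rhom R M Q"
  using assms by (simp add: rhom_def Pi_iff)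

lemma rhom_inv:
  assumes h: "h \<in> rhom R M N" and bij: "bij_betw h (carrier M) (carrier N)"
    and M: "right_module R M"
  shows "inv_into (carrier M) h \<in> rhom R N M"
proof -
  interpret M: right_module R M by fact
  let ?g = "inv_into (carrier M) h"
  have g: "?g y \<in> carrier M" "h (?g y) = y" if "y \<in> carrier N" for y
    using that bij by (metis bij_betw_def inv_into_into, metis bij_betw_def f_inv_into_f)
  have gh: "?g (h x) = x" if "x \<in> carrier M" for x
    using that bij by (simp add: bij_betw_def)
  have "?g (y \<oplus>\<^bsub>N\<^esub> z) = ?g y \<oplus>\<^bsub>M\<^esub> ?g z" if "y \<in> carrier N" "z \<in> carrier N" for y z
    using gh[of "?g y \<oplus>\<^bsub>M\<^esub> ?g z"] rhom_add[OF h] g that by simp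
  moreover have "?g (y \<cdot>\<^bsub>N\<^esub> a) = ?g y \<cdot>\<^bsub>M\<^esub> a" if "y \<in> carrier N" "a \<in> carrier R" for y a
    using gh[of "?g y \<cdot>\<^bsub>M\<^esub> a"] rhom_ract[OF h] M.ract_closed g that by simp
  ultimately show ?thesis using g by (simp add: rhom_def)
qed

lemma rhom_a_inv:
  assumes h: "h \<in> rhom R M N" and M: "right_module R M" and N: "right_module R N"
    and x: "x \<in> carrier M"
  shows "h (\<ominus>\<^bsub>M\<^esub> x) = \<ominus>\<^bsub>N\<^esub> h x"
proof -
  interpret M: right_module R M by fact
  interpret N: right_module R N by fact
  have "h (\<ominus>\<^bsub>M\<^esub> x) \<oplus>\<^bsub>N\<^esub> h x = \<zero>\<^bsub>N\<^esub>"
    using rhom_add[OF h, of "\<ominus>\<^bsub>M\<^esub> x" x] rhom_zero[OF h M N] x by (simp add: M.M.l_neg)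
  then show ?thesis
    using rhom_closed[OF h] x N.M.minus_equality by simp
qed

lemma rhom_minus:
  assumes h: "h \<in> rhom R M N" and M: "right_module R M" and N: "right_module R N"
    and x: "x \<in> carrier M" and y: "y \<in> carrier M"
  shows "h (x \<ominus>\<^bsub>M\<^esub> y) = h x \<ominus>\<^bsub>N\<^esub> h y"
proof -
  interpret M: right_module R M by fact
  show ?thesis
    using rhom_a_inv[OF h M N y] rhom_add[OF h x] y by (simp add: a_minus_def)
qed

lemma (in right_module) minus_eq_zero_iff:
  assumes "x \<in> carrier M" "y \<in> carrier M"
  shows "x \<ominus>\<^bsub>M\<^esub> y = \<zero>\<^bsub>M\<^esub> \<longleftrightarrow> x = y"
proof
  assume "x \<ominus>\<^bsub>M\<^esub> y = \<zero>\<^bsub>M\<^esub>"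
  then have "\<ominus>\<^bsub>M\<^esub> (\<ominus>\<^bsub>M\<^esub> y) = x"
    unfolding a_minus_def using assms by (intro M.minus_equality) simp_all
  then show "x = y" using assms by simp
next
  assume "x = y"
  then show "x \<ominus>\<^bsub>M\<^esub> y = \<zero>\<^bsub>M\<^esub>" using assms by (simp add: a_minus_def M.r_neg)
qed

lemma rhom_eq_iff:
  assumes h: "h \<in> rhom R M N" and M: "right_module R M" and N: "right_module R N"
    and x: "x \<in> carrier M" and y: "y \<in> carrier M"
  shows "h x = h y \<longleftrightarrow> h (x \<ominus>\<^bsub>M\<^esub> y) = \<zero>\<^bsub>N\<^esub>"
proof -
  interpret N: right_module R N by fact
  have "h x = h y \<longleftrightarrow> h x \<ominus>\<^bsub>N\<^esub> h y = \<zero>\<^bsub>N\<^esub>"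
    using rhom_closed[OF h] x y by (metis N.minus_eq_zero_iff)
  then show ?thesis by (simp only: rhom_minus[OF h M N x y])
qed

lemma (in right_module) ract_minus_one:
  assumes x: "x \<in> carrier M"
  shows "x \<cdot>\<^bsub>M\<^esub> (\<ominus>\<^bsub>R\<^esub> \<one>\<^bsub>R\<^esub>) = \<ominus>\<^bsub>M\<^esub> x"
proof -
  have "x \<cdot>\<^bsub>M\<^esub> (\<ominus>\<^bsub>R\<^esub> \<one>\<^bsub>R\<^esub>) \<oplus>\<^bsub>M\<^esub> x = x \<cdot>\<^bsub>M\<^esub> (\<ominus>\<^bsub>R\<^esub> \<one>\<^bsub>R\<^esub> \<oplus>\<^bsub>R\<^esub> \<one>\<^bsub>R\<^esub>)"
    using ract_add_right[OF x, of "\<ominus>\<^bsub>R\<^esub> \<one>\<^bsub>R\<^esub>" "\<one>\<^bsub>R\<^esub>"] ract_one[OF x] by simp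
  also have "\<dots> = \<zero>\<^bsub>M\<^esub>" using x by (simp add: R.l_neg ract_zero_right)
  finally show ?thesis using x ract_closed M.minus_equality by simp
qed

lemma (in right_module) ract_minus:
  assumes "x \<in> carrier M" "y \<in> carrier M" "a \<in> carrier R"
  shows "(x \<ominus>\<^bsub>M\<^esub> y) \<cdot>\<^bsub>M\<^esub> a = x \<cdot>\<^bsub>M\<^esub> a \<ominus>\<^bsub>M\<^esub> y \<cdot>\<^bsub>M\<^esub> a"
proof -
  have "(\<ominus>\<^bsub>M\<^esub> y) \<cdot>\<^bsub>M\<^esub> a \<oplus>\<^bsub>M\<^esub> y \<cdot>\<^bsub>M\<^esub> a = \<zero>\<^bsub>M\<^esub>"
    using ract_add_left[of "\<ominus>\<^bsub>M\<^esub> y" y a] assms by (simp add: M.l_neg ract_zero_left)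
  then have "(\<ominus>\<^bsub>M\<^esub> y) \<cdot>\<^bsub>M\<^esub> a = \<ominus>\<^bsub>M\<^esub> (y \<cdot>\<^bsub>M\<^esub> a)"
    using M.minus_equality[of "(\<ominus>\<^bsub>M\<^esub> y) \<cdot>\<^bsub>M\<^esub> a" "y \<cdot>\<^bsub>M\<^esub> a"] ract_closed assms by simp
  then show ?thesis using assms by (simp add: a_minus_def ract_add_left)
qed

lemma rhom_diff:
  assumes h: "h \<in> rhom R M N" and k: "k \<in> rhom R M N" and N: "right_module R N"
  shows "(\<lambda>x. h x \<ominus>\<^bsub>N\<^esub> k x) \<in> rhom R M N"
proof -
  interpret N: right_module R N by fact
  note c = rhom_closed[OF h] rhom_closed[OF k]
  have "h (x \<oplus>\<^bsub>M\<^esub> y) \<ominus>\<^bsub>N\<^esub> k (x \<oplus>\<^bsub>M\<^esub> y) = (h x \<ominus>\<^bsub>N\<^esub> k x) \<oplus>\<^bsub>N\<^esub> (h y \<ominus>\<^bsub>N\<^esub> k y)"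
    if "x \<in> carrier M" "y \<in> carrier M" for x y
    using that c rhom_add[OF h] rhom_add[OF k] by (simp add: a_minus_def N.M.minus_add N.M.a_ac)
  moreover have "h (x \<cdot>\<^bsub>M\<^esub> a) \<ominus>\<^bsub>N\<^esub> k (x \<cdot>\<^bsub>M\<^esub> a) = (h x \<ominus>\<^bsub>N\<^esub> k x) \<cdot>\<^bsub>N\<^esub> a"
    if "x \<in> carrier M" "a \<in> carrier R" for x a
    using that c rhom_ract[OF h] rhom_ract[OF k] by (simp add: N.ract_minus)
  ultimately show ?thesis using c by (simp add: rhom_def Pi_iff)
qed

lemma rsubmodule_a_inv:
  assumes "right_module R M" "rsubmodule R M N" "x \<in> N"
  shows "\<ominus>\<^bsub>M\<^esub> x \<in> N"
proof -
  interpret right_module R M by fact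
  show ?thesis
    using ract_minus_one[of x] assms(2,3) unfolding rsubmodule_def
    by (metis R.add.inv_closed R.one_closed subsetD)
qed

lemma rsubmodule_right_module:
  assumes M: "right_module R M" and N: "rsubmodule R M N"
  shows "right_module R (M\<lparr>carrier := N\<rparr>)" (is "right_module R ?N")
proof -
  interpret right_module R M by fact
  have NM: "x \<in> carrier M" if "x \<in> N" for x using that N by (auto simp: rsubmodule_def)
  have "abelian_group ?N"
  proof (rule abelian_groupI)
    fix x assume x: "x \<in> carrier ?N"
    show "\<exists>y\<in>carrier ?N. y \<oplus>\<^bsub>?N\<^esub> x = \<zero>\<^bsub>?N\<^esub>"
      using rsubmodule_a_inv[OF M N] x NM by (intro bexI[of _ "\<ominus>\<^bsub>M\<^esub> x"]) (simp_all add: M.l_neg)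
  qed (use N NM in \<open>simp_all add: rsubmodule_def M.a_ac\<close>)
  moreover have "right_module_axioms R ?N"
    using N NM by unfold_locales
      (simp_all add: rsubmodule_def ract_add_left ract_add_right ract_mult ract_one)
  ultimately show ?thesis using R.ring_axioms by (simp add: right_module_def)
qed

lemma rsubmodule_vimage:
  assumes h: "h \<in> rhom R M N" and M: "right_module R M" and N: "right_module R N"
    and K: "rsubmodule R N K"
  shows "rsubmodule R M {x \<in> carrier M. h x \<in> K}"
proof -
  interpret right_module R M by fact
  show ?thesis
    using K rhom_add[OF h] rhom_ract[OF h] rhom_zero[OF h M N]
    by (simp add: rsubmodule_def ract_closed)
qed

lemma rsubmodule_image:
  assumes h: "h \<in> rhom R M N" and M: "right_module R M" and N: "right_module R N"
    and K: "rsubmodule R M K"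
  shows "rsubmodule R N (h ` K)"
  unfolding rsubmodule_def
proof (intro conjI ballI)
  have KM: "K \<subseteq> carrier M" using K by (simp add: rsubmodule_def)
  show "h ` K \<subseteq> carrier N" using rhom_closed[OF h] KM by blast
  show "\<zero>\<^bsub>N\<^esub> \<in> h ` K" using rhom_zero[OF h M N] K by (metis imageI rsubmodule_def)
  show "x \<oplus>\<^bsub>N\<^esub> y \<in> h ` K" if xy: "x \<in> h ` K" "y \<in> h ` K" for x y
  proof -
    obtain x' y' where "x' \<in> K" "x = h x'" "y' \<in> K" "y = h y'" using xy by blast
    then show ?thesis
      using rhom_add[OF h, of x' y'] KM K by (metis imageI rsubmodule_def subsetD)
  qed
  show "x \<cdot>\<^bsub>N\<^esub> a \<in> h ` K" if xa: "x \<in> h ` K" "a \<in> carrier R" for x a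
  proof -
    obtain x' where "x' \<in> K" "x = h x'" using xa by blast
    then show ?thesis
      using rhom_ract[OF h, of x' a] KM K xa(2) by (metis imageI rsubmodule_def subsetD)
  qed
qed

lemma rsubmodule_carrier: "right_module R M \<Longrightarrow> rsubmodule R M (carrier M)"
proof -
  assume "right_module R M"
  then interpret right_module R M .
  show ?thesis by (simp add: rsubmodule_def ract_closed)
qed

lemma rsubmodule_zero: "right_module R M \<Longrightarrow> rsubmodule R M {\<zero>\<^bsub>M\<^esub>}"
proof -
  assume "right_module R M"
  then interpret right_module R M .
  show ?thesis by (simp add: rsubmodule_def ract_zero_left)
qed

lemma rsubmodule_rker:
  assumes "h \<in> rhom R M N" "right_module R M" "right_module R N"
  shows "rsubmodule R M (rker M N h)"
  using rsubmodule_vimage[OF assms rsubmodule_zero[OF assms(3)]] by (simp add: rker_def)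

text \<open>
  The universal property of a quotient, for any surjection that plays the role of the projection.
\<close>

lemma rhom_factor:
  assumes p: "p \<in> rhom R M X" "p ` carrier M = carrier X" and h: "h \<in> rhom R M N"
    and M: "right_module R M" and X: "right_module R X" and N: "right_module R N"
    and ker: "\<And>x. x \<in> carrier M \<Longrightarrow> p x = \<zero>\<^bsub>X\<^esub> \<Longrightarrow> h x = \<zero>\<^bsub>N\<^esub>"
  shows "\<exists>k\<in>rhom R X N. \<forall>x\<in>carrier M. k (p x) = h x"
proof -
  interpret M: right_module R M by fact
  let ?s = "inv_into (carrier M) p"
  have s: "?s y \<in> carrier M" "p (?s y) = y" if "y \<in> carrier X" for y
    using that p(2) by (metis inv_into_into, metis f_inv_into_f)
  have wd: "h x = h y" if "x \<in> carrier M" "y \<in> carrier M" "p x = p y" for x y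
    using that rhom_eq_iff[OF p(1) M X] rhom_eq_iff[OF h M N] ker by simp
  have k: "h (?s (p x)) = h x" if "x \<in> carrier M" for x
    using that wd s[of "p x"] rhom_closed[OF p(1)] by blast
  have "(\<lambda>y. h (?s y)) \<in> rhom R X N"
    unfolding rhom_def
  proof (intro CollectI conjI Pi_I ballI)
    show "h (?s y) \<in> carrier N" if "y \<in> carrier X" for y using s[OF that] rhom_closed[OF h] by simp
    show "h (?s (y \<oplus>\<^bsub>X\<^esub> z)) = h (?s y) \<oplus>\<^bsub>N\<^esub> h (?s z)" if "y \<in> carrier X" "z \<in> carrier X" for y z
      using k[of "?s y \<oplus>\<^bsub>M\<^esub> ?s z"] rhom_add[OF p(1)] rhom_add[OF h] s that by simp
    show "h (?s (y \<cdot>\<^bsub>X\<^esub> a)) = h (?s y) \<cdot>\<^bsub>N\<^esub> a" if "y \<in> carrier X" "a \<in> carrier R" for y a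
      using k[of "?s y \<cdot>\<^bsub>M\<^esub> a"] rhom_ract[OF p(1)] rhom_ract[OF h] s that M.ract_closed by simp
  qed
  then show ?thesis using k by (intro bexI[of _ "\<lambda>y. h (?s y)"] ballI) simp_all
qed

lemma finitely_generatedE:
  assumes "finitely_generated R M"
  obtains T where "finite T" "T \<subseteq> carrier M"
    "\<forall>K. rsubmodule R M K \<longrightarrow> T \<subseteq> K \<longrightarrow> K = carrier M"
proof -
  from assms obtain T where "finite T \<and> T \<subseteq> carrier M \<and> (\<forall>N. rsubmodule R M N \<and> T \<subseteq> N \<longrightarrow> N = carrier M)"
    unfolding finitely_generated_def by (rule exE)
  then show thesis by (intro that[of T]) simp_all
qed

lemma finitely_generated_image:
  assumes h: "h \<in> rhom R M N" "h ` carrier M = carrier N"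
    and M: "right_module R M" and N: "right_module R N" and fg: "finitely_generated R M"
  shows "finitely_generated R N"
proof -
  obtain T where T: "finite T" "T \<subseteq> carrier M"
    "\<forall>K. rsubmodule R M K \<longrightarrow> T \<subseteq> K \<longrightarrow> K = carrier M"
    using fg by (rule finitely_generatedE)
  have "K = carrier N" if K: "rsubmodule R N K" "h ` T \<subseteq> K" for K
  proof -
    have "{x \<in> carrier M. h x \<in> K} = carrier M"
      using rsubmodule_vimage[OF h(1) M N K(1)] T(2) K(2) by (intro T(3)[rule_format]) auto
    then have "h x \<in> K" if "x \<in> carrier M" for x using that by (metis (lifting) mem_Collect_eq)
    then have "carrier N \<subseteq> K" unfolding h(2)[symmetric] by (rule image_subsetI)
    then show ?thesis using K(1) by (auto simp: rsubmodule_def)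
  qed
  moreover have "h ` T \<subseteq> carrier N" unfolding h(2)[symmetric] using T(2) by (rule image_mono)
  ultimately show ?thesis
    using T(1) unfolding finitely_generated_def by (intro exI[of _ "h ` T"] conjI allI impI) simp_all
qed

section \<open>Free modules\<close>

definition unit_vector :: "('r, 'e) ring_scheme \<Rightarrow> 'p \<Rightarrow> 'p \<Rightarrow> 'r"
  where "unit_vector R s = (\<lambda>p. if p = s then \<one>\<^bsub>R\<^esub> else \<zero>\<^bsub>R\<^esub>)"

lemma unit_vector_in: "ring R \<Longrightarrow> s \<in> S \<Longrightarrow> unit_vector R s \<in> carrier (free_rmod R S)"
proof -
  assume "ring R" and s: "s \<in> S"
  then interpret ring R by simp
  have "{p. unit_vector R s p \<noteq> \<zero>\<^bsub>R\<^esub>} \<subseteq> {s}" by (auto simp: unit_vector_def)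
  then have "finite {p. unit_vector R s p \<noteq> \<zero>\<^bsub>R\<^esub>}" by (rule finite_subset) simp
  then show ?thesis using s by (auto simp: free_rmod_def unit_vector_def)
qed

lemma lin_ext_unit_vector:
  assumes "right_module R M" "s \<in> S" "\<And>p. p \<in> S \<Longrightarrow> m p \<in> carrier M"
  shows "lin_ext R M m (unit_vector R s) = m s"
proof -
  interpret right_module R M by fact
  have sub: "{p. unit_vector R s p \<noteq> \<zero>\<^bsub>R\<^esub>} \<subseteq> {s}" by (auto simp: unit_vector_def)
  have "lin_ext R M m (unit_vector R s) = finsum M (\<lambda>p. m p \<cdot>\<^bsub>M\<^esub> unit_vector R s p) {s}"
    using assms(1) unit_vector_in[OF R.ring_axioms assms(2)]
    by (rule lin_ext_eq) (use assms(2,3) sub in auto)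
  also have "\<dots> = m s"
    using assms(2,3) ract_one by (simp add: M.finsum_insert unit_vector_def)
  finally show ?thesis .
qed

lemma free_rmod_generated:
  assumes R: "ring R" and N: "rsubmodule R (free_rmod R S) N"
    and gen: "\<And>s. s \<in> S \<Longrightarrow> unit_vector R s \<in> N"
  shows "N = carrier (free_rmod R S)"
proof
  interpret ring R by fact
  let ?F = "free_rmod R S"
  show "N \<subseteq> carrier ?F" using N by (simp add: rsubmodule_def)
  have "u \<in> N" if "finite T" "u \<in> carrier ?F" "{p. u p \<noteq> \<zero>\<^bsub>R\<^esub>} \<subseteq> T" for u T
    using that
  proof (induction T arbitrary: u)
    case empty
    then have "u = \<zero>\<^bsub>?F\<^esub>" by (auto simp: free_rmod_def)
    then show ?case using N by (simp add: rsubmodule_def)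
  next
    case (insert s T)
    note u = free_supp[OF insert.prems(1)]
    show ?case
    proof (cases "u s = \<zero>\<^bsub>R\<^esub>")
      case True
      then have "{p. u p \<noteq> \<zero>\<^bsub>R\<^esub>} \<subseteq> T" using insert.prems(2) by auto
      then show ?thesis by (rule insert.IH[OF insert.prems(1)])
    next
      case False
      then have s: "s \<in> S" using u(2) by blast
      have fin: "finite {p. (u(s := \<zero>\<^bsub>R\<^esub>)) p \<noteq> \<zero>\<^bsub>R\<^esub>}"
        using u(1) by (rule rev_finite_subset) auto
      have "u(s := \<zero>\<^bsub>R\<^esub>) \<in> carrier ?F"
        using insert.prems(1) fin by (simp add: free_rmod_def)
      moreover have "{p. (u(s := \<zero>\<^bsub>R\<^esub>)) p \<noteq> \<zero>\<^bsub>R\<^esub>} \<subseteq> T" using insert.prems(2) by auto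
      ultimately have "u(s := \<zero>\<^bsub>R\<^esub>) \<in> N" by (rule insert.IH)
      moreover have "unit_vector R s \<cdot>\<^bsub>?F\<^esub> u s \<in> N"
        using gen[OF s] N u(3) by (simp add: rsubmodule_def)
      moreover have "u = u(s := \<zero>\<^bsub>R\<^esub>) \<oplus>\<^bsub>?F\<^esub> (unit_vector R s \<cdot>\<^bsub>?F\<^esub> u s)"
        using u(3) by (auto simp: free_rmod_def unit_vector_def fun_eq_iff)
      ultimately show ?thesis using N unfolding rsubmodule_def by metis
    qed
  qed
  then show "carrier ?F \<subseteq> N" using free_supp(1) by blast
qed

lemma free_rmod_mono:
  assumes "S \<subseteq> T"
  shows "carrier (free_rmod R S) \<subseteq> carrier (free_rmod R T)"
  using assms by (auto simp: free_rmod_def)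

lemma free_rmod_ops [simp]:
  "\<zero>\<^bsub>free_rmod R S\<^esub> = (\<lambda>_. \<zero>\<^bsub>R\<^esub>)"
  "u \<oplus>\<^bsub>free_rmod R S\<^esub> v = (\<lambda>p. u p \<oplus>\<^bsub>R\<^esub> v p)"
  "u \<cdot>\<^bsub>free_rmod R S\<^esub> a = (\<lambda>p. u p \<otimes>\<^bsub>R\<^esub> a)"
  by (simp_all add: free_rmod_def)

lemma rsubmodule_free_Int:
  assumes R: "ring R" and N: "rsubmodule R (free_rmod R T) N"
  shows "rsubmodule R (free_rmod R S) (N \<inter> carrier (free_rmod R S))"
proof -
  interpret F: right_module R "free_rmod R S" by (rule free_right_module) fact
  show ?thesis
    using N F.ract_closed F.M.a_closed F.M.zero_closed by (auto simp: rsubmodule_def)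
qed

lemma free_rhom_eqI:
  assumes M: "right_module R M"
    and h: "h \<in> rhom R (free_rmod R S) M" and k: "k \<in> rhom R (free_rmod R S) M"
    and eq: "\<And>s. s \<in> S \<Longrightarrow> h (unit_vector R s) = k (unit_vector R s)"
    and u: "u \<in> carrier (free_rmod R S)"
  shows "h u = k u"
proof -
  let ?F = "free_rmod R S"
  interpret M: right_module R M by fact
  have R: "ring R" by (rule M.R.ring_axioms)
  have F: "right_module R ?F" using R by (rule free_right_module)
  have d: "(\<lambda>x. h x \<ominus>\<^bsub>M\<^esub> k x) \<in> rhom R ?F M" using h k M by (rule rhom_diff)
  have "rker ?F M (\<lambda>x. h x \<ominus>\<^bsub>M\<^esub> k x) = carrier ?F"
    using R rsubmodule_rker[OF d F M]
  proof (rule free_rmod_generated)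
    show "unit_vector R s \<in> rker ?F M (\<lambda>x. h x \<ominus>\<^bsub>M\<^esub> k x)" if s: "s \<in> S" for s
      using eq[OF s] rhom_closed[OF k unit_vector_in[OF R s]] unit_vector_in[OF R s]
      by (metis (mono_tags, lifting) M.minus_eq_zero_iff mem_Collect_eq rker_def)
  qed
  then have "h u \<ominus>\<^bsub>M\<^esub> k u = \<zero>\<^bsub>M\<^esub>" using u by (auto simp: rker_def)
  then show ?thesis using rhom_closed[OF h u] rhom_closed[OF k u] by (metis M.minus_eq_zero_iff)
qed

section \<open>Finitely presented modules\<close>

text \<open>
  Generation is expressed inside the ambient module: the index order of the direct limit below
  compares kernels in free modules of different ranks, and this form can be tested directly against
  the trace of a submodule of a larger free module.
\<close>

definition finitely_generated_in :: "('r, 'e) ring_scheme \<Rightarrow> ('r, 'm) rmod \<Rightarrow> 'm set \<Rightarrow> bool"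
  where "finitely_generated_in R M K \<longleftrightarrow>
    (\<exists>U. finite U \<and> U \<subseteq> K \<and> (\<forall>N. rsubmodule R M N \<and> U \<subseteq> N \<longrightarrow> K \<subseteq> N))"

lemma FP2_right_module: "FP2 T R X \<Longrightarrow> right_module R X"
  by (simp add: FP2_def)

lemma FP2_resolution:
  fixes X :: "('r, 'm) rmod"
  assumes "FP2 TYPE('p) R X"
  obtains P0 P1 P2 :: "('r, 'p) rmod" and \<epsilon> d0 d1
  where "projective R P0" "projective R P1" "projective R P2"
    "finitely_generated R P0" "finitely_generated R P1" "finitely_generated R P2"
    "\<epsilon> \<in> rhom R P0 X" "\<epsilon> ` carrier P0 = carrier X"
    "d0 \<in> rhom R P1 P0" "d0 ` carrier P1 = rker P0 X \<epsilon>"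
    "d1 \<in> rhom R P2 P1" "d1 ` carrier P2 = rker P1 P0 d0"
proof -
  from assms obtain P :: "nat \<Rightarrow> ('r, 'p) rmod" and d \<epsilon> where
    "\<forall>n. projective R (P n)" "\<epsilon> \<in> rhom R (P 0) X" "\<epsilon> ` carrier (P 0) = carrier X"
    "\<forall>n. d n \<in> rhom R (P (Suc n)) (P n)" "d 0 ` carrier (P 1) = rker (P 0) X \<epsilon>"
    "\<forall>n. d (Suc n) ` carrier (P (Suc (Suc n))) = rker (P (Suc n)) (P n) (d n)"
    "finitely_generated R (P 0)" "finitely_generated R (P 1)" "finitely_generated R (P 2)"
    unfolding FP2_def by (elim conjE exE) (rule that)
  then show thesis
    by (intro that[of "P 0" "P 1" "P 2" \<epsilon> "d 0" "d 1"]) (simp_all add: numeral_2_eq_2)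
qed

lemma FP2_finitely_generated:
  fixes X :: "('r, 'm) rmod"
  assumes "FP2 TYPE('p) R X"
  shows "finitely_generated R X"
proof -
  obtain P0 P1 P2 :: "('r, 'p) rmod" and \<epsilon> d0 d1 where P: "projective R P0"
    "finitely_generated R P0" "\<epsilon> \<in> rhom R P0 X" "\<epsilon> ` carrier P0 = carrier X"
    by (rule FP2_resolution[OF assms]) blast
  then show ?thesis
    using finitely_generated_image[OF P(3,4) _ FP2_right_module[OF assms]]
    by (simp add: projective_def)
qed

text \<open>
  This is Schanuel's argument. Compare \<open>P\<^sub>0 \<rightarrow> X\<close> and the given free cover \<open>e\<close> by lifts
  \<open>\<alpha>\<close> of \<open>P\<^sub>0\<close> along \<open>e\<close> and \<open>\<beta>\<close> back. An element \<open>u\<close> of the kernel is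
  \<open>(u - \<alpha> \<beta> u) + \<alpha> \<beta> u\<close>: the first summand lies in the span of the finitely many elements
  \<open>s - \<alpha> \<beta> s\<close> with \<open>s\<close> in the basis, and the second one in the image under \<open>\<alpha>\<close> of the kernel of
  \<open>P\<^sub>0 \<rightarrow> X\<close>, which is an image of \<open>P\<^sub>1\<close>.
\<close>

lemma FP2_kernel_finitely_generated:
  fixes X :: "('r, 'm) rmod"
  assumes X: "FP2 TYPE('p) R X" and S: "finite S"
    and e: "e \<in> rhom R (free_rmod R S) X" "e ` carrier (free_rmod R S) = carrier X"
  shows "finitely_generated_in R (free_rmod R S) (rker (free_rmod R S) X e)"
proof -
  let ?F = "free_rmod R S"
  obtain P0 P1 P2 :: "('r, 'p) rmod" and \<epsilon> d0 d1 where P: "projective R P0" "projective R P1"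
    "finitely_generated R P1"
    "\<epsilon> \<in> rhom R P0 X" "\<epsilon> ` carrier P0 = carrier X"
    "d0 \<in> rhom R P1 P0" "d0 ` carrier P1 = rker P0 X \<epsilon>"
    by (rule FP2_resolution[OF X]) blast
  have XM: "right_module R X" using X by (rule FP2_right_module)
  then interpret X: right_module R X .
  have R: "ring R" by (rule X.R.ring_axioms)
  have F: "right_module R ?F" using R by (rule free_right_module)
  then interpret F: right_module R ?F .
  have P0: "right_module R P0" and P1: "right_module R P1"
    using P(1,2) by (simp_all add: projective_def)
  obtain \<alpha> where \<alpha>: "\<alpha> \<in> rhom R P0 ?F" "\<And>x. x \<in> carrier P0 \<Longrightarrow> e (\<alpha> x) = \<epsilon> x"
    using projective_lift[OF P(1) F XM e P(4)] by blast
  have "\<exists>b. \<forall>s\<in>S. b s \<in> carrier P0 \<and> \<epsilon> (b s) = e (unit_vector R s)"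
    using P(5) rhom_closed[OF e(1) unit_vector_in[OF R]] by (intro bchoice) (metis imageE)
  then obtain b where b: "\<And>s. s \<in> S \<Longrightarrow> b s \<in> carrier P0"
    "\<And>s. s \<in> S \<Longrightarrow> \<epsilon> (b s) = e (unit_vector R s)" by blast
  define \<beta> where "\<beta> = lin_ext R P0 b"
  have \<beta>: "\<beta> \<in> rhom R ?F P0" unfolding \<beta>_def using P0 b(1) by (rule lin_ext_rhom)
  have bunit: "\<beta> (unit_vector R s) = b s" if "s \<in> S" for s
    unfolding \<beta>_def using P0 that b(1) by (rule lin_ext_unit_vector)
  have eb: "\<epsilon> (\<beta> u) = e u" if u: "u \<in> carrier ?F" for u
    using XM rhom_comp[OF \<beta> P(4)] e(1) _ u
    by (rule free_rhom_eqI) (simp add: bunit b(2))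
  define \<gamma> where "\<gamma> u = u \<ominus>\<^bsub>?F\<^esub> \<alpha> (\<beta> u)" for u
  have \<gamma>: "\<gamma> \<in> rhom R ?F ?F"
    unfolding \<gamma>_def using rhom_comp[OF \<beta> \<alpha>(1)] F by (intro rhom_diff) (simp_all add: rhom_def)
  obtain T where T: "finite T" "T \<subseteq> carrier P1"
    "\<forall>K. rsubmodule R P1 K \<longrightarrow> T \<subseteq> K \<longrightarrow> K = carrier P1"
    using P(3) by (rule finitely_generatedE)
  have \<alpha>d: "(\<lambda>q. \<alpha> (d0 q)) \<in> rhom R P1 ?F" using P(6) \<alpha>(1) by (rule rhom_comp)
  define U where "U = (\<lambda>q. \<alpha> (d0 q)) ` T \<union> (\<lambda>s. \<gamma> (unit_vector R s)) ` S"
  have "finite U" using T(1) S by (simp add: U_def)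
  moreover have "U \<subseteq> rker ?F X e"
  proof -
    have "\<alpha> (d0 q) \<in> rker ?F X e" if "q \<in> carrier P1" for q
    proof -
      have "d0 q \<in> rker P0 X \<epsilon>" using P(7) that by blast
      then show ?thesis
        using \<alpha>(2)[of "d0 q"] rhom_closed[OF \<alpha>d that] by (simp add: rker_def)
    qed
    moreover have "\<gamma> u \<in> rker ?F X e" if u: "u \<in> carrier ?F" for u
    proof -
      have b: "\<beta> u \<in> carrier P0" using rhom_closed[OF \<beta> u] .
      have "e u = e (\<alpha> (\<beta> u))" using \<alpha>(2)[OF b] eb[OF u] by simp
      then have "e (\<gamma> u) = \<zero>\<^bsub>X\<^esub>"
        unfolding \<gamma>_def using rhom_eq_iff[OF e(1) F XM u rhom_closed[OF \<alpha>(1) b]] by simp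
      then show ?thesis using rhom_closed[OF \<gamma> u] by (simp add: rker_def)
    qed
    ultimately show ?thesis
      using subsetD[OF T(2)] unit_vector_in[OF R, of _ S] unfolding U_def
      by (intro Un_least image_subsetI) auto
  qed
  moreover have "rker ?F X e \<subseteq> N" if N: "rsubmodule R ?F N" and UN: "U \<subseteq> N" for N
  proof
    fix u assume uk: "u \<in> rker ?F X e"
    then have u: "u \<in> carrier ?F" "e u = \<zero>\<^bsub>X\<^esub>" by (simp_all add: rker_def)
    have "{q \<in> carrier P1. \<alpha> (d0 q) \<in> N} = carrier P1"
      using rsubmodule_vimage[OF \<alpha>d P1 F N] T(2) UN by (intro T(3)[rule_format]) (auto simp: U_def)
    moreover have "\<beta> u \<in> d0 ` carrier P1"
      using eb[OF u(1)] u rhom_closed[OF \<beta>] unfolding P(7) by (simp add: rker_def)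
    ultimately have 1: "\<alpha> (\<beta> u) \<in> N" by (metis (lifting) imageE mem_Collect_eq)
    have "{u \<in> carrier ?F. \<gamma> u \<in> N} = carrier ?F"
      using R rsubmodule_vimage[OF \<gamma> F F N]
      by (rule free_rmod_generated) (use UN unit_vector_in[OF R] in \<open>auto simp: U_def\<close>)
    then have 2: "\<gamma> u \<in> N" using u(1) by (metis (lifting) mem_Collect_eq)
    have ab: "\<alpha> (\<beta> u) \<in> carrier ?F" using rhom_closed[OF \<alpha>(1) rhom_closed[OF \<beta> u(1)]] .
    have "u = \<gamma> u \<oplus>\<^bsub>?F\<^esub> \<alpha> (\<beta> u)"
      unfolding \<gamma>_def a_minus_def
      by (subst F.M.a_assoc) (use u(1) ab F.M.l_neg F.M.r_zero in \<open>simp_all del: free_rmod_ops\<close>)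
    then show "u \<in> N" using 1 2 N unfolding rsubmodule_def by metis
  qed
  ultimately show ?thesis
    unfolding finitely_generated_in_def by (intro exI[of _ U] conjI allI impI) simp_all
qed

section \<open>Quotients on a prescribed carrier and pushout extensions\<close>

lemma (in right_module) minus_zero_right:
  assumes "x \<in> carrier M"
  shows "x \<ominus>\<^bsub>M\<^esub> \<zero>\<^bsub>M\<^esub> = x"
proof -
  have "\<ominus>\<^bsub>M\<^esub> \<zero>\<^bsub>M\<^esub> = \<zero>\<^bsub>M\<^esub>" using M.minus_equality[of "\<zero>\<^bsub>M\<^esub>" "\<zero>\<^bsub>M\<^esub>"] by simp
  then show ?thesis using assms by (simp add: a_minus_def)
qed

lemma (in right_module) minus_add_minus:
  assumes "x \<in> carrier M" "y \<in> carrier M" "z \<in> carrier M"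
  shows "(x \<ominus>\<^bsub>M\<^esub> y) \<oplus>\<^bsub>M\<^esub> (y \<ominus>\<^bsub>M\<^esub> z) = x \<ominus>\<^bsub>M\<^esub> z"
  using assms by (simp add: a_minus_def M.a_assoc M.r_neg1)

lemma (in right_module) add_minus_swap:
  assumes "x \<in> carrier M" "y \<in> carrier M" "z \<in> carrier M"
  shows "(x \<oplus>\<^bsub>M\<^esub> y) \<ominus>\<^bsub>M\<^esub> z = (x \<ominus>\<^bsub>M\<^esub> z) \<oplus>\<^bsub>M\<^esub> y"
  using assms by (simp add: a_minus_def M.a_ac)

lemma (in right_module) add_minus_add:
  assumes "x \<in> carrier M" "y \<in> carrier M" "z \<in> carrier M" "w \<in> carrier M"
  shows "(x \<oplus>\<^bsub>M\<^esub> y) \<ominus>\<^bsub>M\<^esub> (z \<oplus>\<^bsub>M\<^esub> w) = (x \<ominus>\<^bsub>M\<^esub> z) \<oplus>\<^bsub>M\<^esub> (y \<ominus>\<^bsub>M\<^esub> w)"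
  using assms by (simp add: a_minus_def M.minus_add M.a_ac)

text \<open>
  A class of modules lives on one type, so quotients must be formed on that type. All that is needed
  is a map \<open>\<phi>\<close> whose fibres are the cosets of \<open>N\<close>: its image then carries the structure of the
  quotient by \<open>N\<close>.
\<close>

lemma quotient_on_carrier:
  fixes M :: "('r, 'm) rmod" and \<phi> :: "'m \<Rightarrow> 'y"
  assumes M: "right_module R M" and N: "rsubmodule R M N"
    and fib: "\<And>x y. x \<in> carrier M \<Longrightarrow> y \<in> carrier M \<Longrightarrow> \<phi> x = \<phi> y \<longleftrightarrow> x \<ominus>\<^bsub>M\<^esub> y \<in> N"
  obtains Y :: "('r, 'y) rmod" where "right_module R Y" "\<phi> \<in> rhom R M Y"
    "\<phi> ` carrier M = carrier Y" "rker M Y \<phi> = N"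
proof -
  interpret M: right_module R M by fact
  define s where "s = inv_into (carrier M) \<phi>"
  have s: "s (\<phi> x) \<in> carrier M" "\<phi> (s (\<phi> x)) = \<phi> x" if "x \<in> carrier M" for x
    using that unfolding s_def by (auto intro: inv_into_into f_inv_into_f)
  define Y :: "('r, 'y) rmod" where "Y =
    \<lparr>carrier = \<phi> ` carrier M, mult = undefined, one = undefined, zero = \<phi> \<zero>\<^bsub>M\<^esub>,
     add = (\<lambda>x y. \<phi> (s x \<oplus>\<^bsub>M\<^esub> s y)), ract = (\<lambda>x a. \<phi> (s x \<cdot>\<^bsub>M\<^esub> a))\<rparr>"
  have Y: "carrier Y = \<phi> ` carrier M" "\<zero>\<^bsub>Y\<^esub> = \<phi> \<zero>\<^bsub>M\<^esub>" by (simp_all add: Y_def)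
  have add: "\<phi> x \<oplus>\<^bsub>Y\<^esub> \<phi> y = \<phi> (x \<oplus>\<^bsub>M\<^esub> y)" if xy: "x \<in> carrier M" "y \<in> carrier M" for x y
  proof -
    have "s (\<phi> x) \<ominus>\<^bsub>M\<^esub> x \<in> N" "s (\<phi> y) \<ominus>\<^bsub>M\<^esub> y \<in> N" using fib s xy by metis+
    then have "(s (\<phi> x) \<oplus>\<^bsub>M\<^esub> s (\<phi> y)) \<ominus>\<^bsub>M\<^esub> (x \<oplus>\<^bsub>M\<^esub> y) \<in> N"
      using N s xy by (simp add: M.add_minus_add rsubmodule_def)
    then have "\<phi> (s (\<phi> x) \<oplus>\<^bsub>M\<^esub> s (\<phi> y)) = \<phi> (x \<oplus>\<^bsub>M\<^esub> y)"
      by (subst fib) (use s xy in simp_all)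
    then show ?thesis by (simp add: Y_def)
  qed
  have act: "\<phi> x \<cdot>\<^bsub>Y\<^esub> a = \<phi> (x \<cdot>\<^bsub>M\<^esub> a)" if x: "x \<in> carrier M" and a: "a \<in> carrier R" for x a
  proof -
    have "s (\<phi> x) \<ominus>\<^bsub>M\<^esub> x \<in> N" using fib s x by metis
    then have "s (\<phi> x) \<cdot>\<^bsub>M\<^esub> a \<ominus>\<^bsub>M\<^esub> x \<cdot>\<^bsub>M\<^esub> a \<in> N"
      using N s x a by (simp add: M.ract_minus[symmetric] rsubmodule_def)
    then have "\<phi> (s (\<phi> x) \<cdot>\<^bsub>M\<^esub> a) = \<phi> (x \<cdot>\<^bsub>M\<^esub> a)"
      by (subst fib) (use s x a M.ract_closed in simp_all)
    then show ?thesis by (simp add: Y_def)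
  qed
  have YE: "\<exists>x. x \<in> carrier M \<and> y = \<phi> x" if "y \<in> carrier Y" for y using that Y(1) by blast
  have "abelian_group Y"
  proof (rule abelian_groupI)
    show "\<zero>\<^bsub>Y\<^esub> \<in> carrier Y" by (simp add: Y)
    fix x assume "x \<in> carrier Y"
    then obtain x' where x: "x' \<in> carrier M" "x = \<phi> x'" using YE by blast
    show "\<zero>\<^bsub>Y\<^esub> \<oplus>\<^bsub>Y\<^esub> x = x" using x by (simp add: Y add)
    show "\<exists>y\<in>carrier Y. y \<oplus>\<^bsub>Y\<^esub> x = \<zero>\<^bsub>Y\<^esub>"
      using x by (intro bexI[of _ "\<phi> (\<ominus>\<^bsub>M\<^esub> x')"]) (simp_all add: Y add M.l_neg)
    fix y assume "y \<in> carrier Y"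
    then obtain y' where y: "y' \<in> carrier M" "y = \<phi> y'" using YE by blast
    show "x \<oplus>\<^bsub>Y\<^esub> y \<in> carrier Y" using x y by (simp add: Y add)
    show "x \<oplus>\<^bsub>Y\<^esub> y = y \<oplus>\<^bsub>Y\<^esub> x" using x y by (simp add: Y add M.a_comm)
    fix z assume "z \<in> carrier Y"
    then obtain z' where z: "z' \<in> carrier M" "z = \<phi> z'" using YE by blast
    show "x \<oplus>\<^bsub>Y\<^esub> y \<oplus>\<^bsub>Y\<^esub> z = x \<oplus>\<^bsub>Y\<^esub> (y \<oplus>\<^bsub>Y\<^esub> z)" using x y z by (simp add: Y add M.a_assoc)
  qed
  moreover have "right_module_axioms R Y"
  proof
    fix x a assume "x \<in> carrier Y" and a: "a \<in> carrier R"
    then obtain x' where x: "x' \<in> carrier M" "x = \<phi> x'" using YE by blast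
    show "x \<cdot>\<^bsub>Y\<^esub> a \<in> carrier Y" using x a M.ract_closed by (simp add: Y act)
    fix b assume b: "b \<in> carrier R"
    show "x \<cdot>\<^bsub>Y\<^esub> (a \<oplus>\<^bsub>R\<^esub> b) = x \<cdot>\<^bsub>Y\<^esub> a \<oplus>\<^bsub>Y\<^esub> x \<cdot>\<^bsub>Y\<^esub> b"
      using x a b M.ract_closed by (simp add: act add M.ract_add_right)
    show "x \<cdot>\<^bsub>Y\<^esub> (a \<otimes>\<^bsub>R\<^esub> b) = x \<cdot>\<^bsub>Y\<^esub> a \<cdot>\<^bsub>Y\<^esub> b"
      using x a b M.ract_closed by (simp add: act M.ract_mult)
  next
    fix x y a assume "x \<in> carrier Y" "y \<in> carrier Y" and a: "a \<in> carrier R"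
    then obtain x' y' where x: "x' \<in> carrier M" "x = \<phi> x'" "y' \<in> carrier M" "y = \<phi> y'"
      using YE by metis
    then show "(x \<oplus>\<^bsub>Y\<^esub> y) \<cdot>\<^bsub>Y\<^esub> a = x \<cdot>\<^bsub>Y\<^esub> a \<oplus>\<^bsub>Y\<^esub> y \<cdot>\<^bsub>Y\<^esub> a"
      using a M.ract_closed by (simp add: act add M.ract_add_left)
  next
    fix x assume "x \<in> carrier Y"
    then obtain x' where x: "x' \<in> carrier M" "x = \<phi> x'" using YE by blast
    then show "x \<cdot>\<^bsub>Y\<^esub> \<one>\<^bsub>R\<^esub> = x" by (simp add: act M.ract_one)
  qed
  ultimately have YM: "right_module R Y" using M.R.ring_axioms by (simp add: right_module_def)
  have "\<phi> \<in> rhom R M Y" by (simp add: rhom_def Y add act)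
  moreover have "rker M Y \<phi> = N"
  proof -
    have "\<phi> x = \<zero>\<^bsub>Y\<^esub> \<longleftrightarrow> x \<in> N" if "x \<in> carrier M" for x
      using fib[OF that M.M.zero_closed] that by (simp add: Y M.minus_zero_right)
    then show ?thesis using N by (auto simp: rker_def rsubmodule_def)
  qed
  ultimately show thesis using YM Y(1) by (intro that[of Y]) simp_all
qed

definition prod_rmod :: "('r, 'm) rmod \<Rightarrow> ('r, 'n) rmod \<Rightarrow> ('r, 'm \<times> 'n) rmod"
  where "prod_rmod M N =
    \<lparr>carrier = carrier M \<times> carrier N, mult = undefined, one = undefined, zero = (\<zero>\<^bsub>M\<^esub>, \<zero>\<^bsub>N\<^esub>),
     add = (\<lambda>x y. (fst x \<oplus>\<^bsub>M\<^esub> fst y, snd x \<oplus>\<^bsub>N\<^esub> snd y)),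
     ract = (\<lambda>x a. (fst x \<cdot>\<^bsub>M\<^esub> a, snd x \<cdot>\<^bsub>N\<^esub> a))\<rparr>"

lemma prod_rmod_simps [simp]:
  "carrier (prod_rmod M N) = carrier M \<times> carrier N"
  "\<zero>\<^bsub>prod_rmod M N\<^esub> = (\<zero>\<^bsub>M\<^esub>, \<zero>\<^bsub>N\<^esub>)"
  "x \<oplus>\<^bsub>prod_rmod M N\<^esub> y = (fst x \<oplus>\<^bsub>M\<^esub> fst y, snd x \<oplus>\<^bsub>N\<^esub> snd y)"
  "x \<cdot>\<^bsub>prod_rmod M N\<^esub> a = (fst x \<cdot>\<^bsub>M\<^esub> a, snd x \<cdot>\<^bsub>N\<^esub> a)"
  by (simp_all add: prod_rmod_def)

lemma prod_right_module:
  assumes "right_module R M" "right_module R N"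
  shows "right_module R (prod_rmod M N)" (is "right_module R ?P")
proof -
  interpret M: right_module R M by fact
  interpret N: right_module R N by fact
  have "abelian_group ?P"
  proof (rule abelian_groupI)
    fix x assume x: "x \<in> carrier ?P"
    show "\<exists>y\<in>carrier ?P. y \<oplus>\<^bsub>?P\<^esub> x = \<zero>\<^bsub>?P\<^esub>"
      using x by (intro bexI[of _ "(\<ominus>\<^bsub>M\<^esub> fst x, \<ominus>\<^bsub>N\<^esub> snd x)"]) (auto simp: M.M.l_neg N.M.l_neg)
  qed (auto simp: M.M.a_ac N.M.a_ac)
  moreover have "right_module_axioms R ?P"
    by unfold_locales (auto simp: M.ract_closed N.ract_closed M.ract_add_left N.ract_add_left
      M.ract_add_right N.ract_add_right M.ract_mult N.ract_mult M.ract_one N.ract_one)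
  ultimately show ?thesis using M.R.ring_axioms by (simp add: right_module_def)
qed

lemma fst_rhom: "fst \<in> rhom R (prod_rmod M N) M"
  and snd_rhom: "snd \<in> rhom R (prod_rmod M N) N"
  by (auto simp: rhom_def)

lemma rhom_on_rsubmodule:
  assumes K: "rsubmodule R P K" and P: "right_module R P" and A: "right_module R A"
    and \<nu>: "\<nu> \<in> rhom R (P\<lparr>carrier := K\<rparr>) A"
  shows "\<nu> \<zero>\<^bsub>P\<^esub> = \<zero>\<^bsub>A\<^esub>"
    and "p \<in> K \<Longrightarrow> q \<in> K \<Longrightarrow> \<nu> (p \<oplus>\<^bsub>P\<^esub> q) = \<nu> p \<oplus>\<^bsub>A\<^esub> \<nu> q"
    and "p \<in> K \<Longrightarrow> a \<in> carrier R \<Longrightarrow> \<nu> (p \<cdot>\<^bsub>P\<^esub> a) = \<nu> p \<cdot>\<^bsub>A\<^esub> a"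
    and "p \<in> K \<Longrightarrow> \<nu> p \<in> carrier A"
  using rhom_zero[OF \<nu> rsubmodule_right_module[OF P K] A] rhom_add[OF \<nu>] rhom_ract[OF \<nu>]
    rhom_closed[OF \<nu>] by simp_all

text \<open>
  The pushout of \<open>0 \<rightarrow> ker \<epsilon> \<rightarrow> P \<rightarrow> Z \<rightarrow> 0\<close> along \<open>\<nu>\<close> is the quotient of \<open>A \<oplus> P\<close> by the elements
  \<open>(-\<nu> p, p)\<close> with \<open>\<epsilon> p = 0\<close>. To place it on the type of the values of \<open>\<theta>\<close>, choose a set-theoretic
  section \<open>\<sigma>\<close> of \<open>\<epsilon>\<close>: the class of \<open>(a, p)\<close> has exactly one representative of the form
  \<open>(b, \<sigma> z)\<close>, and \<open>\<theta>\<close> encodes the pair \<open>(b, z)\<close>. The kernel of \<open>\<phi>\<close> is recorded because it governs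
  which maps out of \<open>A \<oplus> P\<close> descend to the pushout.
\<close>

lemma pushout_extension:
  fixes A :: "('r, 'a) rmod" and P :: "('r, 'p) rmod" and Z :: "('r, 'z) rmod"
    and \<theta> :: "'a \<times> 'z \<Rightarrow> 'y"
  assumes A: "right_module R A" and P: "right_module R P" and Z: "right_module R Z"
    and \<epsilon>: "\<epsilon> \<in> rhom R P Z" "\<epsilon> ` carrier P = carrier Z"
    and \<nu>: "\<nu> \<in> rhom R (P\<lparr>carrier := rker P Z \<epsilon>\<rparr>) A"
    and \<theta>: "inj_on \<theta> (carrier A \<times> carrier Z)"
  obtains Y :: "('r, 'y) rmod" and \<phi> where "extension R A Y Z"
    "\<phi> \<in> rhom R (prod_rmod A P) Y" "\<phi> ` (carrier A \<times> carrier P) = carrier Y"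
    "\<And>a p. a \<in> carrier A \<Longrightarrow> p \<in> carrier P \<Longrightarrow>
      \<phi> (a, p) = \<zero>\<^bsub>Y\<^esub> \<longleftrightarrow> \<epsilon> p = \<zero>\<^bsub>Z\<^esub> \<and> a \<oplus>\<^bsub>A\<^esub> \<nu> p = \<zero>\<^bsub>A\<^esub>"
proof -
  interpret A: right_module R A by fact
  interpret P: right_module R P by fact
  interpret Z: right_module R Z by fact
  let ?AP = "prod_rmod A P" and ?K = "rker P Z \<epsilon>"
  have AP: "right_module R ?AP" using A P by (rule prod_right_module)
  then interpret AP: right_module R ?AP .
  have K: "rsubmodule R P ?K" using \<epsilon>(1) P Z by (rule rsubmodule_rker)
  note \<nu>' = rhom_on_rsubmodule[OF K P A \<nu>]
  have K_iff: "p \<in> ?K \<longleftrightarrow> p \<in> carrier P \<and> \<epsilon> p = \<zero>\<^bsub>Z\<^esub>" for p by (simp add: rker_def)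
  define N where "N = {x \<in> carrier ?AP. snd x \<in> ?K \<and> fst x \<oplus>\<^bsub>A\<^esub> \<nu> (snd x) = \<zero>\<^bsub>A\<^esub>}"
  have "rsubmodule R ?AP N"
    unfolding rsubmodule_def
  proof (intro conjI ballI)
    show "N \<subseteq> carrier ?AP" by (auto simp: N_def)
    show "\<zero>\<^bsub>?AP\<^esub> \<in> N" using K by (simp add: N_def \<nu>'(1) rsubmodule_def)
    fix x assume "x \<in> N"
    then have x: "fst x \<in> carrier A" "snd x \<in> carrier P" "snd x \<in> ?K"
      "fst x \<oplus>\<^bsub>A\<^esub> \<nu> (snd x) = \<zero>\<^bsub>A\<^esub>" by (auto simp: N_def)
    show "x \<oplus>\<^bsub>?AP\<^esub> y \<in> N" if "y \<in> N" for y
    proof -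
      have y: "fst y \<in> carrier A" "snd y \<in> carrier P" "snd y \<in> ?K"
        "fst y \<oplus>\<^bsub>A\<^esub> \<nu> (snd y) = \<zero>\<^bsub>A\<^esub>" using that by (auto simp: N_def)
      have "(fst x \<oplus>\<^bsub>A\<^esub> fst y) \<oplus>\<^bsub>A\<^esub> (\<nu> (snd x) \<oplus>\<^bsub>A\<^esub> \<nu> (snd y)) =
          (fst x \<oplus>\<^bsub>A\<^esub> \<nu> (snd x)) \<oplus>\<^bsub>A\<^esub> (fst y \<oplus>\<^bsub>A\<^esub> \<nu> (snd y))"
        using x(1,3) y(1,3) \<nu>'(4) by (simp add: A.M.a_ac)
      then show ?thesis using x y K by (simp add: N_def \<nu>'(2) rsubmodule_def)
    qed
    show "x \<cdot>\<^bsub>?AP\<^esub> a \<in> N" if a: "a \<in> carrier R" for a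
    proof -
      have "fst x \<cdot>\<^bsub>A\<^esub> a \<oplus>\<^bsub>A\<^esub> \<nu> (snd x) \<cdot>\<^bsub>A\<^esub> a = \<zero>\<^bsub>A\<^esub>"
        using A.ract_add_left[OF x(1) \<nu>'(4)[OF x(3)] a] x(4) A.ract_zero_left[OF a] by simp
      then show ?thesis
        using x K a by (simp add: N_def \<nu>'(3) rsubmodule_def A.ract_closed P.ract_closed)
    qed
  qed
  define \<sigma> where "\<sigma> = inv_into (carrier P) \<epsilon>"
  have \<sigma>: "\<sigma> (\<epsilon> p) \<in> carrier P" "\<epsilon> (\<sigma> (\<epsilon> p)) = \<epsilon> p" if "p \<in> carrier P" for p
    using that unfolding \<sigma>_def by (auto intro: inv_into_into f_inv_into_f)
  define \<phi> where "\<phi> x = \<theta> (fst x \<oplus>\<^bsub>A\<^esub> \<nu> (snd x \<ominus>\<^bsub>P\<^esub> \<sigma> (\<epsilon> (snd x))), \<epsilon> (snd x))" for x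
  have in_K: "p \<ominus>\<^bsub>P\<^esub> q \<in> ?K \<longleftrightarrow> \<epsilon> p = \<epsilon> q" if "p \<in> carrier P" "q \<in> carrier P" for p q
    using rhom_eq_iff[OF \<epsilon>(1) P Z that] that by (simp add: K_iff)
  have fib: "\<phi> x = \<phi> y \<longleftrightarrow> x \<ominus>\<^bsub>?AP\<^esub> y \<in> N" if x: "x \<in> carrier ?AP" and y: "y \<in> carrier ?AP" for x y
  proof -
    have xy: "fst x \<in> carrier A" "snd x \<in> carrier P" "fst y \<in> carrier A" "snd y \<in> carrier P"
      using x y by auto
    have d: "fst (x \<ominus>\<^bsub>?AP\<^esub> y) = fst x \<ominus>\<^bsub>A\<^esub> fst y" "snd (x \<ominus>\<^bsub>?AP\<^esub> y) = snd x \<ominus>\<^bsub>P\<^esub> snd y"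
      using rhom_minus[OF fst_rhom AP A x y] rhom_minus[OF snd_rhom AP P x y] by simp_all
    let ?s = "\<sigma> (\<epsilon> (snd x))" and ?t = "\<sigma> (\<epsilon> (snd y))"
    have in1: "snd x \<ominus>\<^bsub>P\<^esub> ?s \<in> ?K" "snd y \<ominus>\<^bsub>P\<^esub> ?t \<in> ?K"
      using xy \<sigma> by (simp_all add: in_K)
    have "\<phi> x = \<phi> y \<longleftrightarrow> fst x \<oplus>\<^bsub>A\<^esub> \<nu> (snd x \<ominus>\<^bsub>P\<^esub> ?s) = fst y \<oplus>\<^bsub>A\<^esub> \<nu> (snd y \<ominus>\<^bsub>P\<^esub> ?t) \<and>
        \<epsilon> (snd x) = \<epsilon> (snd y)"
      unfolding \<phi>_def using xy in1 \<nu>'(4) rhom_closed[OF \<epsilon>(1)]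
      by (subst inj_on_eq_iff[OF \<theta>]) auto
    also have "\<dots> \<longleftrightarrow> (fst x \<ominus>\<^bsub>A\<^esub> fst y) \<oplus>\<^bsub>A\<^esub> \<nu> (snd x \<ominus>\<^bsub>P\<^esub> snd y) = \<zero>\<^bsub>A\<^esub> \<and>
        \<epsilon> (snd x) = \<epsilon> (snd y)"
    proof (rule rev_conj_cong[OF refl])
      assume e: "\<epsilon> (snd x) = \<epsilon> (snd y)"
      let ?d = "\<nu> (snd x \<ominus>\<^bsub>P\<^esub> snd y)" and ?w = "\<nu> (snd y \<ominus>\<^bsub>P\<^esub> ?t)"
      have dK: "snd x \<ominus>\<^bsub>P\<^esub> snd y \<in> ?K" using xy e by (simp add: in_K)
      have c: "?d \<in> carrier A" "?w \<in> carrier A" using \<nu>'(4) dK in1 by simp_all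
      have "snd x \<ominus>\<^bsub>P\<^esub> ?s = (snd x \<ominus>\<^bsub>P\<^esub> snd y) \<oplus>\<^bsub>P\<^esub> (snd y \<ominus>\<^bsub>P\<^esub> ?t)"
        using P.minus_add_minus[OF xy(2,4) \<sigma>(1)[OF xy(4)]] e by simp
      then have "\<nu> (snd x \<ominus>\<^bsub>P\<^esub> ?s) = ?d \<oplus>\<^bsub>A\<^esub> ?w" using \<nu>'(2) dK in1 by simp
      then have "fst x \<oplus>\<^bsub>A\<^esub> \<nu> (snd x \<ominus>\<^bsub>P\<^esub> ?s) = (fst x \<oplus>\<^bsub>A\<^esub> ?d) \<oplus>\<^bsub>A\<^esub> ?w"
        using xy c by (simp add: A.M.a_assoc)
      then have "fst x \<oplus>\<^bsub>A\<^esub> \<nu> (snd x \<ominus>\<^bsub>P\<^esub> ?s) = fst y \<oplus>\<^bsub>A\<^esub> ?w \<longleftrightarrow> fst x \<oplus>\<^bsub>A\<^esub> ?d = fst y"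
        using xy c by simp
      also have "\<dots> \<longleftrightarrow> (fst x \<oplus>\<^bsub>A\<^esub> ?d) \<ominus>\<^bsub>A\<^esub> fst y = \<zero>\<^bsub>A\<^esub>"
        using A.minus_eq_zero_iff[of "fst x \<oplus>\<^bsub>A\<^esub> ?d" "fst y"] xy c by simp
      also have "\<dots> \<longleftrightarrow> (fst x \<ominus>\<^bsub>A\<^esub> fst y) \<oplus>\<^bsub>A\<^esub> ?d = \<zero>\<^bsub>A\<^esub>"
        using A.add_minus_swap xy c by simp
      finally show "fst x \<oplus>\<^bsub>A\<^esub> \<nu> (snd x \<ominus>\<^bsub>P\<^esub> ?s) = fst y \<oplus>\<^bsub>A\<^esub> ?w \<longleftrightarrow>
          (fst x \<ominus>\<^bsub>A\<^esub> fst y) \<oplus>\<^bsub>A\<^esub> ?d = \<zero>\<^bsub>A\<^esub>" .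
    qed
    also have "\<dots> \<longleftrightarrow> x \<ominus>\<^bsub>?AP\<^esub> y \<in> N"
      using AP.M.minus_closed[OF x y] xy by (simp add: N_def d in_K conj_commute del: prod_rmod_simps)
    finally show ?thesis .
  qed
  obtain Y :: "('r, 'y) rmod" where Y: "right_module R Y" "\<phi> \<in> rhom R ?AP Y"
    "\<phi> ` carrier ?AP = carrier Y" "rker ?AP Y \<phi> = N"
    using AP \<open>rsubmodule R ?AP N\<close> fib by (rule quotient_on_carrier)
  have ker: "\<phi> (a, p) = \<zero>\<^bsub>Y\<^esub> \<longleftrightarrow> \<epsilon> p = \<zero>\<^bsub>Z\<^esub> \<and> a \<oplus>\<^bsub>A\<^esub> \<nu> p = \<zero>\<^bsub>A\<^esub>"
    if "a \<in> carrier A" "p \<in> carrier P" for a p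
  proof -
    have "\<phi> (a, p) = \<zero>\<^bsub>Y\<^esub> \<longleftrightarrow> (a, p) \<in> rker ?AP Y \<phi>" using that by (simp add: rker_def)
    then show ?thesis unfolding Y(4) using that by (simp add: N_def K_iff)
  qed
  have "(\<lambda>x. \<epsilon> (snd x)) \<in> rhom R ?AP Z" using snd_rhom \<epsilon>(1) by (rule rhom_comp)
  then have "\<exists>g\<in>rhom R Y Z. \<forall>x\<in>carrier ?AP. g (\<phi> x) = \<epsilon> (snd x)"
    by (rule rhom_factor[OF Y(2,3) _ AP Y(1) Z]) (use ker in auto)
  then obtain g where g: "g \<in> rhom R Y Z" "\<And>x. x \<in> carrier ?AP \<Longrightarrow> g (\<phi> x) = \<epsilon> (snd x)"
    by (elim bexE) (rule that, assumption, rule bspec)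
  have \<iota>: "(\<lambda>a. (a, \<zero>\<^bsub>P\<^esub>)) \<in> rhom R A ?AP" by (simp add: rhom_def P.ract_zero_left)
  have f: "(\<lambda>a. \<phi> (a, \<zero>\<^bsub>P\<^esub>)) \<in> rhom R A Y" using \<iota> Y(2) by (rule rhom_comp)
  have "inj_on (\<lambda>a. \<phi> (a, \<zero>\<^bsub>P\<^esub>)) (carrier A)"
  proof (rule inj_onI)
    fix a b assume ab: "a \<in> carrier A" "b \<in> carrier A" "\<phi> (a, \<zero>\<^bsub>P\<^esub>) = \<phi> (b, \<zero>\<^bsub>P\<^esub>)"
    have "\<phi> (a \<ominus>\<^bsub>A\<^esub> b, \<zero>\<^bsub>P\<^esub>) = \<zero>\<^bsub>Y\<^esub>" using rhom_eq_iff[OF f A Y(1) ab(1,2)] ab(3) by simp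
    then have "a \<ominus>\<^bsub>A\<^esub> b = \<zero>\<^bsub>A\<^esub>" using ker[of "a \<ominus>\<^bsub>A\<^esub> b" "\<zero>\<^bsub>P\<^esub>"] ab \<nu>'(1) by simp
    then show "a = b" using A.minus_eq_zero_iff ab by simp
  qed
  moreover have "(\<lambda>a. \<phi> (a, \<zero>\<^bsub>P\<^esub>)) ` carrier A = rker Y Z g"
  proof
    show "(\<lambda>a. \<phi> (a, \<zero>\<^bsub>P\<^esub>)) ` carrier A \<subseteq> rker Y Z g"
      using rhom_closed[OF f] g(2) rhom_zero[OF \<epsilon>(1) P Z] by (auto simp: rker_def)
    show "rker Y Z g \<subseteq> (\<lambda>a. \<phi> (a, \<zero>\<^bsub>P\<^esub>)) ` carrier A"
    proof
      fix y assume "y \<in> rker Y Z g"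
      then have y: "y \<in> carrier Y" "g y = \<zero>\<^bsub>Z\<^esub>" by (simp_all add: rker_def)
      obtain x where x: "x \<in> carrier ?AP" "y = \<phi> x" using y(1) Y(3) by (metis imageE)
      have a: "fst x \<in> carrier A" and p: "snd x \<in> carrier P" using x(1) by auto
      have pK: "snd x \<in> ?K" using g(2)[OF x(1)] x(2) y(2) p by (simp add: K_iff)
      let ?b = "fst x \<oplus>\<^bsub>A\<^esub> \<nu> (snd x)"
      have b: "?b \<in> carrier A" using a \<nu>'(4)[OF pK] by simp
      have bAP: "(?b, \<zero>\<^bsub>P\<^esub>) \<in> carrier ?AP" using b by simp
      have "fst (x \<ominus>\<^bsub>?AP\<^esub> (?b, \<zero>\<^bsub>P\<^esub>)) \<oplus>\<^bsub>A\<^esub> \<nu> (snd x) = (fst x \<ominus>\<^bsub>A\<^esub> ?b) \<oplus>\<^bsub>A\<^esub> \<nu> (snd x)"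
        using rhom_minus[OF fst_rhom AP A x(1) bAP] by simp
      also have "\<dots> = ?b \<ominus>\<^bsub>A\<^esub> ?b" using A.add_minus_swap[OF a \<nu>'(4)[OF pK] b] by simp
      also have "\<dots> = \<zero>\<^bsub>A\<^esub>" using A.minus_eq_zero_iff[OF b b] by simp
      finally have "fst (x \<ominus>\<^bsub>?AP\<^esub> (?b, \<zero>\<^bsub>P\<^esub>)) \<oplus>\<^bsub>A\<^esub> \<nu> (snd x) = \<zero>\<^bsub>A\<^esub>" .
      moreover have "snd (x \<ominus>\<^bsub>?AP\<^esub> (?b, \<zero>\<^bsub>P\<^esub>)) = snd x"
        using rhom_minus[OF snd_rhom AP P x(1) bAP] p by (simp add: P.minus_zero_right)
      ultimately have "x \<ominus>\<^bsub>?AP\<^esub> (?b, \<zero>\<^bsub>P\<^esub>) \<in> N"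
        using AP.M.minus_closed[OF x(1) bAP] pK by (simp add: N_def del: prod_rmod_simps)
      then have "y = \<phi> (?b, \<zero>\<^bsub>P\<^esub>)" using fib[OF x(1) bAP] x(2) by simp
      then show "y \<in> (\<lambda>a. \<phi> (a, \<zero>\<^bsub>P\<^esub>)) ` carrier A" using b by blast
    qed
  qed
  moreover have "g ` carrier Y = carrier Z"
  proof
    show "g ` carrier Y \<subseteq> carrier Z" using rhom_closed[OF g(1)] by blast
    show "carrier Z \<subseteq> g ` carrier Y"
    proof
      fix z assume "z \<in> carrier Z"
      then obtain p where p: "p \<in> carrier P" "z = \<epsilon> p" using \<epsilon>(2) by (metis imageE)
      have "(\<zero>\<^bsub>A\<^esub>, p) \<in> carrier ?AP" using p by simp
      then show "z \<in> g ` carrier Y"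
        using g(2) rhom_closed[OF Y(2)] p(2) by (metis imageI snd_conv)
    qed
  qed
  ultimately have "extension R A Y Z"
    unfolding extension_def using A Y(1) Z f g(1) by blast
  then show thesis using Y(2,3) ker by (intro that[of Y \<phi>]) simp_all
qed

section \<open>Direct limits and factorization of finitely presented modules\<close>

text \<open>
  A finitely presented module over \<open>B\<close> is encoded by a set \<open>S\<close> of generators, each of which carries
  its image in \<open>B\<close> as first component, and a set \<open>U\<close> of relations; the second component allows
  several generators with the same image. The property says that the homomorphism from this module
  to \<open>B\<close> factors through a member \<open>X\<close> of \<open>C\<close>, where \<open>m\<close> and \<open>h\<close> are the two factors.
\<close>

definition factors_through ::
  "('r, 'e) ring_scheme \<Rightarrow> ('r, 'c) rmod set \<Rightarrow> ('r, 'b) rmod \<Rightarrow>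
    ('b \<times> nat) set \<Rightarrow> ('b \<times> nat \<Rightarrow> 'r) set \<Rightarrow> bool"
  where "factors_through R C B S U \<longleftrightarrow>
    (\<exists>X\<in>C. \<exists>h\<in>rhom R X B. \<exists>m. (\<forall>s\<in>S. m s \<in> carrier X \<and> h (m s) = fst s) \<and>
       (\<forall>u\<in>U. lin_ext R X m u = \<zero>\<^bsub>X\<^esub>))"

abbreviation relations :: "('r, 'e) ring_scheme \<Rightarrow> ('r, 'b) rmod \<Rightarrow> ('b \<times> nat) set \<Rightarrow> ('b \<times> nat \<Rightarrow> 'r) set"
  where "relations R B S \<equiv> rker (free_rmod R S) B (lin_ext R B fst)"

text \<open>
  An index is a free module of finite rank with a map to \<open>B\<close>, together with a submodule of relations; it
  presents \<open>X\<close> if \<open>e\<close> identifies the quotient with \<open>X\<close>.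
\<close>

definition presentation ::
  "('r, 'e) ring_scheme \<Rightarrow> ('r, 'b) rmod \<Rightarrow> ('r, 'b) presentation_index \<Rightarrow> ('r, 'c) rmod \<Rightarrow>
    (('b \<times> nat \<Rightarrow> 'r) \<Rightarrow> 'c) \<Rightarrow> bool"
  where "presentation R B i X e \<longleftrightarrow>
    finite (fst i) \<and> fst i \<subseteq> carrier B \<times> UNIV \<and> right_module R X \<and>
    e \<in> rhom R (free_rmod R (fst i)) X \<and> e ` carrier (free_rmod R (fst i)) = carrier X \<and>
    rker (free_rmod R (fst i)) X e = snd i \<and> snd i \<subseteq> relations R B (fst i)"

lemma presentationD:
  assumes "presentation R B i X e"
  shows "finite (fst i)" "fst i \<subseteq> carrier B \<times> UNIV" "right_module R X"
    "e \<in> rhom R (free_rmod R (fst i)) X" "e ` carrier (free_rmod R (fst i)) = carrier X"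
    "rker (free_rmod R (fst i)) X e = snd i" "snd i \<subseteq> relations R B (fst i)"
  using assms by (simp_all add: presentation_def)

lemma rhom_free_mono:
  assumes "e \<in> rhom R (free_rmod R T) X" "S \<subseteq> T"
  shows "e \<in> rhom R (free_rmod R S) X"
  using assms subsetD[OF free_rmod_mono[OF assms(2), of R]] by (simp add: rhom_def Pi_iff)

text \<open>
  A factorization through \<open>X\<close> becomes a presentation of \<open>X\<close> once the map from the free module is
  made surjective. For this, add to \<open>S\<close> one new generator for each of finitely many generators \<open>x k\<close>
  of \<open>X\<close>, labelled by the image of \<open>x k\<close> in \<open>B\<close> and a number \<open>N + k\<close> that does not yet occur. The
  relations of the larger presentation include \<open>U\<close>, and they hold in \<open>B\<close> because the map to \<open>B\<close>
  passes through \<open>X\<close>.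
\<close>

lemma presentation_exists:
  fixes B :: "('r, 'b) rmod" and C :: "('r, 'c) rmod set"
  assumes B: "right_module R B" and C: "\<And>X. X \<in> C \<Longrightarrow> right_module R X \<and> finitely_generated R X"
    and S: "finite S" "S \<subseteq> carrier B \<times> UNIV" and U: "U \<subseteq> relations R B S"
    and fac: "factors_through R C B S U"
  obtains i X e where "X \<in> C" "presentation R B i X e" "S \<subseteq> fst i" "U \<subseteq> snd i"
proof -
  obtain X h m where X: "X \<in> C" and h: "h \<in> rhom R X B"
    and m: "\<And>s. s \<in> S \<Longrightarrow> m s \<in> carrier X" "\<And>s. s \<in> S \<Longrightarrow> h (m s) = fst s"
      "\<And>u. u \<in> U \<Longrightarrow> lin_ext R X m u = \<zero>\<^bsub>X\<^esub>"
    using fac unfolding factors_through_def by metis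
  have XM: "right_module R X" and fg: "finitely_generated R X" using C[OF X] by simp_all
  interpret X: right_module R X by fact
  obtain T where T: "finite T" "T \<subseteq> carrier X"
    "\<forall>K. rsubmodule R X K \<longrightarrow> T \<subseteq> K \<longrightarrow> K = carrier X"
    using fg by (rule finitely_generatedE)
  obtain n and x :: "nat \<Rightarrow> 'c" where x: "T = x ` {..<n}"
    using finite_imp_nat_seg_image_inj_on[OF T(1)] by (metis lessThan_def)
  define N where "N = Suc (Max (insert 0 (snd ` S)))"
  have N: "snd s < N" if "s \<in> S" for s
    using that S(1) by (simp add: N_def less_Suc_eq_le)
  define S' where "S' = S \<union> (\<lambda>k. (h (x k), N + k)) ` {..<n}"
  define m' where "m' s = (if s \<in> S then m s else x (snd s - N))" for s
  have new: "(h (x k), N + k) \<notin> S" for k using N[of "(h (x k), N + k)"] by auto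
  have xX: "x k \<in> carrier X" if "k < n" for k using T(2) x that by blast
  have m': "m' s \<in> carrier X \<and> h (m' s) = fst s" if "s \<in> S'" for s
    using that m(1,2) xX new unfolding S'_def m'_def by auto
  let ?F = "free_rmod R S'"
  let ?e = "lin_ext R X m'"
  have R: "ring R" by (rule X.R.ring_axioms)
  have F: "right_module R ?F" using R by (rule free_right_module)
  have e: "?e \<in> rhom R ?F X" using XM m' by (intro lin_ext_rhom) simp_all
  have S'B: "fst s \<in> carrier B" if "s \<in> S'" for s using m'[OF that] rhom_closed[OF h] by metis
  have "?e ` carrier ?F = carrier X"
  proof (rule T(3)[rule_format])
    show "rsubmodule R X (?e ` carrier ?F)"
      using e F XM rsubmodule_carrier[OF F] by (rule rsubmodule_image)
    show "T \<subseteq> ?e ` carrier ?F"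
    proof
      fix t assume "t \<in> T"
      then obtain k where k: "k < n" "t = x k" using x by auto
      let ?s = "(h (x k), N + k)"
      have s: "?s \<in> S'" using k by (simp add: S'_def)
      have "?e (unit_vector R ?s) = m' ?s" using XM s m' by (intro lin_ext_unit_vector) auto
      then have "?e (unit_vector R ?s) = t" using new k by (simp add: m'_def)
      then show "t \<in> ?e ` carrier ?F" using unit_vector_in[OF R s] by blast
    qed
  qed
  moreover have "rker ?F X ?e \<subseteq> relations R B S'"
  proof
    fix u assume "u \<in> rker ?F X ?e"
    then have u: "u \<in> carrier ?F" "?e u = \<zero>\<^bsub>X\<^esub>" by (simp_all add: rker_def)
    have "h (?e u) = lin_ext R B fst u"
      using h XM B u(1) by (rule rhom_lin_ext) (use m' in simp_all)
    then show "u \<in> relations R B S'" using u rhom_zero[OF h XM B] by (simp add: rker_def)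
  qed
  moreover have "U \<subseteq> rker ?F X ?e"
  proof
    fix u assume uU: "u \<in> U"
    then have u: "u \<in> carrier (free_rmod R S)" using U by (auto simp: rker_def)
    have "(\<lambda>y. y) (lin_ext R X m u) = lin_ext R X m' u"
    proof (rule rhom_lin_ext[OF _ XM XM u])
      show "(\<lambda>y. y) \<in> rhom R X X" by (simp add: rhom_def)
    qed (use m(1) in \<open>simp_all add: m'_def\<close>)
    then have "?e u = \<zero>\<^bsub>X\<^esub>" using m(3)[OF uU] by simp
    moreover have "u \<in> carrier ?F" using free_rmod_mono[of S S' R] u by (auto simp: S'_def)
    ultimately show "u \<in> rker ?F X ?e" by (simp add: rker_def)
  qed
  moreover have "finite S'" using S(1) by (simp add: S'_def)
  moreover have "S' \<subseteq> carrier B \<times> UNIV" using S'B by auto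
  ultimately have "presentation R B (S', rker ?F X ?e) X ?e" "U \<subseteq> rker ?F X ?e"
    using XM e by (simp_all add: presentation_def)
  then show thesis using X by (intro that[of X "(S', rker ?F X ?e)" ?e]) (simp_all add: S'_def)
qed

lemma presentation_transition:
  assumes i: "presentation R B i X e" and j: "presentation R B j Y d"
    and le: "fst i \<subseteq> fst j" "snd i \<subseteq> snd j"
  shows "\<exists>f\<in>rhom R X Y. (\<forall>u\<in>carrier (free_rmod R (fst i)). f (e u) = d u)"
proof -
  note i' = presentationD[OF i] and j' = presentationD[OF j]
  interpret X: right_module R X by (rule i'(3))
  have F: "right_module R (free_rmod R (fst i))" by (rule free_right_module[OF X.R.ring_axioms])
  show ?thesis
  proof (rule rhom_factor[OF i'(4,5) rhom_free_mono[OF j'(4) le(1)] F i'(3) j'(3)])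
    fix u assume "u \<in> carrier (free_rmod R (fst i))" "e u = \<zero>\<^bsub>X\<^esub>"
    then have "u \<in> snd i" unfolding i'(6)[symmetric] by (simp add: rker_def)
    then have "u \<in> rker (free_rmod R (fst j)) Y d" using le(2) j'(6) by blast
    then show "d u = \<zero>\<^bsub>Y\<^esub>" by (simp add: rker_def)
  qed
qed

lemma presentation_map:
  assumes B: "right_module R B" and i: "presentation R B i X e"
  shows "\<exists>g\<in>rhom R X B. (\<forall>u\<in>carrier (free_rmod R (fst i)). g (e u) = lin_ext R B fst u)"
proof -
  note i' = presentationD[OF i]
  interpret X: right_module R X by (rule i'(3))
  have F: "right_module R (free_rmod R (fst i))" by (rule free_right_module[OF X.R.ring_axioms])
  have l: "lin_ext R B fst \<in> rhom R (free_rmod R (fst i)) B"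
    using B by (rule lin_ext_rhom) (use i'(2) in auto)
  show ?thesis
  proof (rule rhom_factor[OF i'(4,5) l F i'(3) B])
    fix u assume "u \<in> carrier (free_rmod R (fst i))" "e u = \<zero>\<^bsub>X\<^esub>"
    then have "u \<in> snd i" unfolding i'(6)[symmetric] by (simp add: rker_def)
    then have "u \<in> relations R B (fst i)" using i'(7) by blast
    then show "lin_ext R B fst u = \<zero>\<^bsub>B\<^esub>" by (simp add: rker_def)
  qed
qed

lemma relations_mono:
  assumes "S \<subseteq> T"
  shows "relations R B S \<subseteq> relations R B T"
  using free_rmod_mono[OF assms] by (auto simp: rker_def)

text \<open>
  Lenzing's criterion. The system consists of all presentations of members of \<open>C\<close>, ordered by
  inclusion of generators and of relations. Given finitely many generators and relations of \<open>B\<close>,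
  some presentation contains them all, by the hypothesis and \<open>presentation_exists\<close>. Together with the
  finite generation of kernels, this makes the system directed. The map from its limit to \<open>B\<close> is onto
  because every element of \<open>B\<close> is a generator somewhere, and injective because every relation of \<open>B\<close>
  eventually holds.
\<close>

lemma dirlim_class_if_factors:
  fixes R :: "('r, 'e) ring_scheme" and B :: "('r, 'b) rmod" and C :: "('r, 'c) rmod set"
  assumes B: "right_module R B" and C: "\<And>X. X \<in> C \<Longrightarrow> FP2 TYPE('p) R X"
    and fac: "\<And>S U. finite S \<Longrightarrow> S \<subseteq> carrier B \<times> UNIV \<Longrightarrow> finite U \<Longrightarrow> U \<subseteq> relations R B S \<Longrightarrow>
      factors_through R C B S U"
  shows "B \<in> dirlim_class TYPE(('r, 'b) presentation_index) R C"
proof -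
  interpret B: right_module R B by fact
  have R: "ring R" by (rule B.R.ring_axioms)
  have F: "right_module R (free_rmod R S)" for S :: "('b \<times> nat) set" using R by (rule free_right_module)
  have C': "right_module R X \<and> finitely_generated R X" if "X \<in> C" for X
    using FP2_right_module[OF C[OF that]] FP2_finitely_generated[OF C[OF that]] by simp
  define I where "I = {i. \<exists>X e. X \<in> C \<and> presentation R B i X e}"
  define E where "E = {(i, j). i \<in> I \<and> j \<in> I \<and> fst i \<subseteq> fst j \<and> snd i \<subseteq> snd j}"
  have "\<forall>i\<in>I. \<exists>Xe. fst Xe \<in> C \<and> presentation R B i (fst Xe) (snd Xe)"
    unfolding I_def by auto
  then obtain Xe where Xe: "\<And>i. i \<in> I \<Longrightarrow> fst (Xe i) \<in> C \<and> presentation R B i (fst (Xe i)) (snd (Xe i))"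
    by (rule bchoice[elim_format]) blast
  define X where "X i = fst (Xe i)" for i
  define e where "e i = snd (Xe i)" for i
  have XC: "X i \<in> C" and pres: "presentation R B i (X i) (e i)" if "i \<in> I" for i
    using Xe[OF that] by (simp_all add: X_def e_def)
  note D = presentationD[OF pres]
  have "\<exists>f. (i, j) \<in> E \<longrightarrow> f \<in> rhom R (X i) (X j) \<and>
      (\<forall>u\<in>carrier (free_rmod R (fst i)). f (e i u) = e j u)" for i j
    using presentation_transition[OF pres pres, of i j] unfolding E_def by blast
  then obtain f where f: "\<And>i j. (i, j) \<in> E \<Longrightarrow> f i j \<in> rhom R (X i) (X j)"
    and fe: "\<And>i j u. (i, j) \<in> E \<Longrightarrow> u \<in> carrier (free_rmod R (fst i)) \<Longrightarrow> f i j (e i u) = e j u"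
    by metis
  have "\<exists>g. i \<in> I \<longrightarrow> g \<in> rhom R (X i) B \<and>
      (\<forall>u\<in>carrier (free_rmod R (fst i)). g (e i u) = lin_ext R B fst u)" for i
    using presentation_map[OF B pres, of i] by blast
  then obtain g where g: "\<And>i. i \<in> I \<Longrightarrow> g i \<in> rhom R (X i) B"
    and ge: "\<And>i u. i \<in> I \<Longrightarrow> u \<in> carrier (free_rmod R (fst i)) \<Longrightarrow> g i (e i u) = lin_ext R B fst u"
    by metis
  have eE: "\<exists>u. u \<in> carrier (free_rmod R (fst i)) \<and> x = e i u" if "i \<in> I" "x \<in> carrier (X i)" for i x
    using D(5)[OF that(1)] that(2) by (metis imageE)
  have ex: "\<exists>i\<in>I. S \<subseteq> fst i \<and> U \<subseteq> snd i"
    if SU: "finite S" "S \<subseteq> carrier B \<times> UNIV" "finite U" "U \<subseteq> relations R B S" for S U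
  proof -
    obtain i Y d where "Y \<in> C" "presentation R B i Y d" "S \<subseteq> fst i" "U \<subseteq> snd i"
      using B C' SU(1,2,4) fac[OF SU] by (rule presentation_exists)
    then show ?thesis unfolding I_def by blast
  qed
  \<comment> \<open>the relations at \<open>i\<close> are contained in those at \<open>j\<close> already if finitely many of them are\<close>
  have fg: "\<exists>U. finite U \<and> U \<subseteq> snd i \<and> (\<forall>j\<in>I. fst i \<subseteq> fst j \<longrightarrow> U \<subseteq> snd j \<longrightarrow> (i, j) \<in> E)"
    if i: "i \<in> I" for i
  proof -
    have "finitely_generated_in R (free_rmod R (fst i)) (snd i)"
      using FP2_kernel_finitely_generated[OF C[OF XC[OF i]] D(1)[OF i] D(4)[OF i] D(5)[OF i]]
      by (simp only: D(6)[OF i])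
    then obtain U where U: "finite U" "U \<subseteq> snd i"
      "\<forall>N. rsubmodule R (free_rmod R (fst i)) N \<and> U \<subseteq> N \<longrightarrow> snd i \<subseteq> N"
      unfolding finitely_generated_in_def by (elim exE conjE)
    have "(i, j) \<in> E" if j: "j \<in> I" "fst i \<subseteq> fst j" "U \<subseteq> snd j" for j
    proof -
      have "rsubmodule R (free_rmod R (fst j)) (snd j)"
        using rsubmodule_rker[OF D(4)[OF j(1)] F D(3)[OF j(1)]] by (simp only: D(6)[OF j(1)])
      then have "rsubmodule R (free_rmod R (fst i)) (snd j \<inter> carrier (free_rmod R (fst i)))"
        by (rule rsubmodule_free_Int[OF R])
      moreover have "U \<subseteq> snd j \<inter> carrier (free_rmod R (fst i))"
        using j(3) U(2) D(6)[OF i] by (auto simp: rker_def)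
      ultimately have "snd i \<subseteq> snd j" using U(3) by blast
      then show ?thesis using i j by (simp add: E_def)
    qed
    then show ?thesis using U(1,2) by blast
  qed
  have ds: "direct_system R I E X f"
  proof (rule direct_system.intro)
    show "partial_order_on I E"
      unfolding partial_order_on_def preorder_on_def
    proof (intro conjI)
      show "E \<subseteq> I \<times> I" "refl_on I E" by (auto simp: E_def refl_on_def)
      show "trans E" by (auto simp: E_def trans_def)
      show "antisym E" by (auto simp: E_def antisym_def prod_eq_iff)
    qed
    show "I \<noteq> {}" using ex[of "{}" "{}"] by auto
  next
    fix i j assume i: "i \<in> I" and j: "j \<in> I"
    obtain U where U: "finite U" "U \<subseteq> snd i" "\<forall>k\<in>I. fst i \<subseteq> fst k \<longrightarrow> U \<subseteq> snd k \<longrightarrow> (i, k) \<in> E"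
      using fg[OF i] by blast
    obtain V where V: "finite V" "V \<subseteq> snd j" "\<forall>k\<in>I. fst j \<subseteq> fst k \<longrightarrow> V \<subseteq> snd k \<longrightarrow> (j, k) \<in> E"
      using fg[OF j] by blast
    have "U \<union> V \<subseteq> relations R B (fst i \<union> fst j)"
      using U(2) V(2) D(7)[OF i] D(7)[OF j] relations_mono[of "fst i" "fst i \<union> fst j" R B]
        relations_mono[of "fst j" "fst i \<union> fst j" R B] by blast
    then obtain k where "k \<in> I" "fst i \<union> fst j \<subseteq> fst k" "U \<union> V \<subseteq> snd k"
      using ex[of "fst i \<union> fst j" "U \<union> V"] D(1,2)[OF i] D(1,2)[OF j] U(1) V(1) by auto
    then show "\<exists>k\<in>I. (i, k) \<in> E \<and> (j, k) \<in> E" using U(3) V(3) by (intro bexI[of _ k]) auto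
  next
    show "right_module R (X i)" if "i \<in> I" for i using D(3)[OF that] .
    show "f i j \<in> rhom R (X i) (X j)" if "(i, j) \<in> E" for i j using f[OF that] .
  next
    fix i x assume i: "i \<in> I" "x \<in> carrier (X i)"
    then have "(i, i) \<in> E" by (simp add: E_def)
    then show "f i i x = x" using eE[OF i] fe by metis
  next
    fix i j k x assume ij: "(i, j) \<in> E" and jk: "(j, k) \<in> E" and x: "x \<in> carrier (X i)"
    have i: "i \<in> I" and ik: "(i, k) \<in> E" and le: "fst i \<subseteq> fst j" using ij jk by (auto simp: E_def)
    obtain u where u: "u \<in> carrier (free_rmod R (fst i))" "x = e i u" using eE[OF i x] by blast
    have "u \<in> carrier (free_rmod R (fst j))" using u(1) free_rmod_mono[OF le] by blast
    then show "f j k (f i j x) = f i k x" using u fe[OF ij] fe[OF jk] fe[OF ik] by simp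
  qed
  then interpret direct_system R I E X f .
  have "g j (f i j x) = g i x" if ij: "(i, j) \<in> E" and x: "x \<in> carrier (X i)" for i j x
  proof -
    have i: "i \<in> I" "j \<in> I" "fst i \<subseteq> fst j" using ij by (simp_all add: E_def)
    obtain w where w: "w \<in> carrier (free_rmod R (fst i))" "x = e i w" using eE[OF i(1) x] by blast
    have "w \<in> carrier (free_rmod R (fst j))" using w(1) free_rmod_mono[OF i(3)] by blast
    then show ?thesis using w fe[OF ij] ge i by simp
  qed
  from dl_universal(1)[OF B g this]
  obtain u where u: "u \<in> rhom R L B" "\<forall>i\<in>I. \<forall>x\<in>carrier (X i). u (cls i x) = g i x"
    by blast
  have L: "right_module R L" by (rule dl_right_module)
  have ker: "Z = \<zero>\<^bsub>L\<^esub>" if Z: "Z \<in> carrier L" "u Z = \<zero>\<^bsub>B\<^esub>" for Z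
  proof -
    obtain i x where i: "i \<in> I" "x \<in> carrier (X i)" "Z = cls i x" using Z(1) by (rule cls_E)
    obtain w where w: "w \<in> carrier (free_rmod R (fst i))" "x = e i w" using eE[OF i(1,2)] by blast
    have "lin_ext R B fst w = \<zero>\<^bsub>B\<^esub>" using Z(2) u(2) i ge[OF i(1) w(1)] w(2) by simp
    then have wr: "w \<in> relations R B (fst i)" using w(1) by (simp add: rker_def)
    obtain U where U: "finite U" "U \<subseteq> snd i" "\<forall>k\<in>I. fst i \<subseteq> fst k \<longrightarrow> U \<subseteq> snd k \<longrightarrow> (i, k) \<in> E"
      using fg[OF i(1)] by blast
    have "insert w U \<subseteq> relations R B (fst i)" using wr U(2) D(7)[OF i(1)] by blast
    then obtain j where j: "j \<in> I" "fst i \<subseteq> fst j" "insert w U \<subseteq> snd j"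
      using ex[of "fst i" "insert w U"] D(1,2)[OF i(1)] U(1) by auto
    have ij: "(i, j) \<in> E" using U(3) j by simp
    have "w \<in> rker (free_rmod R (fst j)) (X j) (e j)" using j(3) D(6)[OF j(1)] by simp
    then have "f i j x = \<zero>\<^bsub>X j\<^esub>" using fe[OF ij w(1)] w(2) by (simp add: rker_def)
    then show ?thesis using cls_f[OF ij i(2)] i(3) cls_zero[OF j(1)] by simp
  qed
  have "inj_on u (carrier L)"
  proof (rule inj_onI)
    interpret L: right_module R L by (rule L)
    fix Y Z assume YZ: "Y \<in> carrier L" "Z \<in> carrier L" "u Y = u Z"
    then have "Y \<ominus>\<^bsub>L\<^esub> Z = \<zero>\<^bsub>L\<^esub>"
      using ker[of "Y \<ominus>\<^bsub>L\<^esub> Z"] rhom_eq_iff[OF u(1) L B YZ(1,2)] by simp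
    then show "Y = Z" using L.minus_eq_zero_iff YZ(1,2) by simp
  qed
  moreover have "u ` carrier L = carrier B"
  proof
    show "u ` carrier L \<subseteq> carrier B" using rhom_closed[OF u(1)] by blast
    show "carrier B \<subseteq> u ` carrier L"
    proof
      fix b assume b: "b \<in> carrier B"
      obtain i where i: "i \<in> I" "(b, 0) \<in> fst i" using ex[of "{(b, 0)}" "{}"] b by auto
      let ?v = "unit_vector R (b, 0 :: nat)"
      have v: "?v \<in> carrier (free_rmod R (fst i))" using R i(2) by (rule unit_vector_in)
      have x: "e i ?v \<in> carrier (X i)" using rhom_closed[OF D(4)[OF i(1)] v] .
      have "lin_ext R B fst ?v = fst (b, 0 :: nat)"
        using B i(2) by (rule lin_ext_unit_vector) (use D(2)[OF i(1)] in auto)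
      then have "u (cls i (e i ?v)) = b" using u(2) i(1) x ge[OF i(1) v] by simp
      then show "b \<in> u ` carrier L" using cls_in[OF i(1) x] by (metis imageI)
    qed
  qed
  ultimately have bij: "bij_betw u (carrier L) (carrier B)" by (simp add: bij_betw_def)
  have "rmod_iso R B L"
    unfolding rmod_iso_def using rhom_inv[OF u(1) bij L] bij_betw_inv_into[OF bij] by blast
  then show ?thesis unfolding dirlim_class_def using B ds XC by blast
qed

section \<open>Maps from projective modules into direct limits\<close>

text \<open>
  The direct limit of a system together with an injective homomorphism to \<open>T\<close>, described without the
  limit: it is enough to know the composites \<open>a i\<close>, and injectivity becomes the condition that what
  \<open>a i\<close> kills dies at a later index. In the extension, both \<open>A\<close> as a submodule of \<open>B\<close> and \<open>D\<close> itself
  are of this form.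
\<close>

locale exact_cocone = direct_system R I E M f
  for R :: "('r, 'e) ring_scheme" and I :: "'i set" and E and M :: "'i \<Rightarrow> ('r, 'm) rmod" and f +
  fixes T :: "('r, 't) rmod" and a :: "'i \<Rightarrow> 'm \<Rightarrow> 't"
  assumes target: "right_module R T"
    and leg: "i \<in> I \<Longrightarrow> a i \<in> rhom R (M i) T"
    and compat: "(i, j) \<in> E \<Longrightarrow> x \<in> carrier (M i) \<Longrightarrow> a j (f i j x) = a i x"
    and exact: "i \<in> I \<Longrightarrow> x \<in> carrier (M i) \<Longrightarrow> a i x = \<zero>\<^bsub>T\<^esub> \<Longrightarrow>
      \<exists>k. (i, k) \<in> E \<and> f i k x = \<zero>\<^bsub>M k\<^esub>"
begin

definition total_image :: "'t set"
  where "total_image = (\<Union>i\<in>I. a i ` carrier (M i))"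

lemma f_zero: "(i, j) \<in> E \<Longrightarrow> f i j \<zero>\<^bsub>M i\<^esub> = \<zero>\<^bsub>M j\<^esub>"
  using rhom_zero[OF homs modules modules] le_in[of i j] by simp

lemma eventually_zero:
  assumes i: "i \<in> I" and X: "finite X" "X \<subseteq> carrier (M i)" "\<And>x. x \<in> X \<Longrightarrow> a i x = \<zero>\<^bsub>T\<^esub>"
  shows "\<exists>k. (i, k) \<in> E \<and> (\<forall>x\<in>X. f i k x = \<zero>\<^bsub>M k\<^esub>)"
  using X
proof (induction X)
  case empty
  then show ?case using le_refl[OF i] by blast
next
  case (insert x X)
  obtain k where k: "(i, k) \<in> E" "\<forall>x\<in>X. f i k x = \<zero>\<^bsub>M k\<^esub>" using insert.IH insert.prems by auto
  obtain l where l: "(i, l) \<in> E" "f i l x = \<zero>\<^bsub>M l\<^esub>"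
    using exact[OF i, of x] insert.prems by auto
  obtain n where n: "(k, n) \<in> E" "(l, n) \<in> E" using ub le_in[OF k(1)] le_in[OF l(1)] by blast
  have "f i n x = \<zero>\<^bsub>M n\<^esub>"
    using comp[OF l(1) n(2), of x] l(2) f_zero[OF n(2)] insert.prems(1) by simp
  moreover have "f i n y = \<zero>\<^bsub>M n\<^esub>" if "y \<in> X" for y
    using comp[OF k(1) n(1), of y] k(2) that f_zero[OF n(1)] insert.prems(1) by auto
  ultimately show ?case using le_trans[OF k(1) n(1)] by auto
qed

lemma image_mono_leg:
  assumes "(i, j) \<in> E"
  shows "a i ` carrier (M i) \<subseteq> a j ` carrier (M j)"
proof
  fix t assume "t \<in> a i ` carrier (M i)"
  then obtain x where "x \<in> carrier (M i)" "t = a i x" by blast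
  then show "t \<in> a j ` carrier (M j)" using compat[OF assms] f_closed[OF assms] by (metis imageI)
qed

lemma eventually_lifts:
  assumes i: "i \<in> I" and Q: "finite Q" "Q \<subseteq> total_image"
  shows "\<exists>k. (i, k) \<in> E \<and> Q \<subseteq> a k ` carrier (M k)"
  using Q
proof (induction Q)
  case empty
  then show ?case using le_refl[OF i] by blast
next
  case (insert t Q)
  obtain k where k: "(i, k) \<in> E" "Q \<subseteq> a k ` carrier (M k)" using insert.IH insert.prems by auto
  obtain l where l: "l \<in> I" "t \<in> a l ` carrier (M l)" using insert.prems unfolding total_image_def by blast
  obtain n where n: "(k, n) \<in> E" "(l, n) \<in> E" using ub le_in[OF k(1)] l(1) by blast
  have "insert t Q \<subseteq> a n ` carrier (M n)"
    using k(2) l(2) image_mono_leg[OF n(1)] image_mono_leg[OF n(2)] by blast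
  then show ?case using le_trans[OF k(1) n(1)] by blast
qed

text \<open>
  Finitely many generators of \<open>P\<close> have images in the image of one \<open>a i\<close>, which is a submodule; so \<open>\<psi>\<close>
  maps all of \<open>P\<close> there and can be lifted along \<open>a i\<close>.
\<close>

lemma projective_factors:
  assumes P: "projective R P" "finitely_generated R P"
    and \<psi>: "\<psi> \<in> rhom R P T" "\<And>p. p \<in> carrier P \<Longrightarrow> \<psi> p \<in> total_image"
  shows "\<exists>i\<in>I. \<exists>\<mu>\<in>rhom R P (M i). \<forall>p\<in>carrier P. a i (\<mu> p) = \<psi> p"
proof -
  have PM: "right_module R P" using P(1) by (simp add: projective_def)
  obtain V where V: "finite V" "V \<subseteq> carrier P"
    "\<forall>K. rsubmodule R P K \<longrightarrow> V \<subseteq> K \<longrightarrow> K = carrier P"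
    using P(2) by (rule finitely_generatedE)
  obtain i0 where "i0 \<in> I" using nonempty by blast
  moreover have "\<psi> ` V \<subseteq> total_image" using V(2) \<psi>(2) by blast
  ultimately obtain i where i: "(i0, i) \<in> E" "\<psi> ` V \<subseteq> a i ` carrier (M i)"
    using eventually_lifts[of i0 "\<psi> ` V"] V(1) by blast
  have iI: "i \<in> I" using le_in[OF i(1)] by simp
  have Mi: "right_module R (M i)" using iI by (rule modules)
  let ?Im = "a i ` carrier (M i)"
  have Im: "rsubmodule R T ?Im"
    using leg[OF iI] Mi target rsubmodule_carrier[OF Mi] by (rule rsubmodule_image)
  have "{p \<in> carrier P. \<psi> p \<in> ?Im} = carrier P"
    using rsubmodule_vimage[OF \<psi>(1) PM target Im] V(2) i(2) by (intro V(3)[rule_format]) auto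
  then have in_Im: "\<psi> p \<in> ?Im" if "p \<in> carrier P" for p
    using that by (metis (lifting) mem_Collect_eq)
  have "a i \<in> rhom R (M i) (T\<lparr>carrier := ?Im\<rparr>)" using leg[OF iI] by (simp add: rhom_def)
  moreover have "\<psi> \<in> rhom R P (T\<lparr>carrier := ?Im\<rparr>)" using \<psi>(1) in_Im by (simp add: rhom_def)
  ultimately have "\<exists>\<mu>\<in>rhom R P (M i). \<forall>p\<in>carrier P. a i (\<mu> p) = \<psi> p"
    using projective_lift[OF P(1) Mi rsubmodule_right_module[OF target Im]] by simp
  then show ?thesis using iI by blast
qed

lemma finitely_generated_eventually_zero:
  assumes Q: "right_module R Q" "finitely_generated R Q" and i: "i \<in> I"
    and \<kappa>: "\<kappa> \<in> rhom R Q (M i)" "\<And>q. q \<in> carrier Q \<Longrightarrow> a i (\<kappa> q) = \<zero>\<^bsub>T\<^esub>"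
  shows "\<exists>k. (i, k) \<in> E \<and> (\<forall>q\<in>carrier Q. f i k (\<kappa> q) = \<zero>\<^bsub>M k\<^esub>)"
proof -
  obtain V where V: "finite V" "V \<subseteq> carrier Q"
    "\<forall>K. rsubmodule R Q K \<longrightarrow> V \<subseteq> K \<longrightarrow> K = carrier Q"
    using Q(2) by (rule finitely_generatedE)
  have "\<exists>k. (i, k) \<in> E \<and> (\<forall>x\<in>\<kappa> ` V. f i k x = \<zero>\<^bsub>M k\<^esub>)"
  proof (rule eventually_zero[OF i])
    show "finite (\<kappa> ` V)" using V(1) by simp
    show "\<kappa> ` V \<subseteq> carrier (M i)" using V(2) rhom_closed[OF \<kappa>(1)] by blast
    show "a i x = \<zero>\<^bsub>T\<^esub>" if "x \<in> \<kappa> ` V" for x using that V(2) \<kappa>(2) by blast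
  qed
  then obtain k where k: "(i, k) \<in> E" "\<forall>x\<in>\<kappa> ` V. f i k x = \<zero>\<^bsub>M k\<^esub>" by blast
  have Mk: "right_module R (M k)" using le_in[OF k(1)] by (intro modules) simp
  have "(\<lambda>q. f i k (\<kappa> q)) \<in> rhom R Q (M k)" using \<kappa>(1) homs[OF k(1)] by (rule rhom_comp)
  then have "rker Q (M k) (\<lambda>q. f i k (\<kappa> q)) = carrier Q"
    using rsubmodule_rker[of _ R Q "M k"] Q(1) Mk V(2) k(2)
    by (intro V(3)[rule_format]) (auto simp: rker_def)
  then have "f i k (\<kappa> q) = \<zero>\<^bsub>M k\<^esub>" if "q \<in> carrier Q" for q
    using that unfolding rker_def by (metis (mono_tags, lifting) mem_Collect_eq)
  then show ?thesis using k(1) by blast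
qed

end

text \<open>
  Finitely many generators can be lifted to one \<open>M i\<close>, and finitely many relations between them then
  hold after passing to a later index. In other words, a homomorphism from a finitely presented
  module, with generators \<open>S\<close> and relations \<open>U\<close>, to the direct limit factors through the system.
\<close>

lemma (in exact_cocone) lift_generators:
  assumes S: "finite S" and U: "finite U" "U \<subseteq> carrier (free_rmod R S)"
    and t: "\<And>s. s \<in> S \<Longrightarrow> t s \<in> total_image"
    and rel: "\<And>u. u \<in> U \<Longrightarrow> lin_ext R T t u = \<zero>\<^bsub>T\<^esub>"
  obtains i y where "i \<in> I" "\<And>s. s \<in> S \<Longrightarrow> y s \<in> carrier (M i)" "\<And>s. s \<in> S \<Longrightarrow> a i (y s) = t s"
    "\<And>u. u \<in> U \<Longrightarrow> lin_ext R (M i) y u = \<zero>\<^bsub>M i\<^esub>"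
proof -
  obtain i0 where "i0 \<in> I" using nonempty by blast
  then obtain j where j: "(i0, j) \<in> E" "t ` S \<subseteq> a j ` carrier (M j)"
    using eventually_lifts[of i0 "t ` S"] S t by blast
  have jI: "j \<in> I" using le_in[OF j(1)] by simp
  have Mj: "right_module R (M j)" using jI by (rule modules)
  have "\<forall>s\<in>S. \<exists>y. y \<in> carrier (M j) \<and> a j y = t s" using j(2) by (metis imageE image_subset_iff)
  then obtain z where z: "\<And>s. s \<in> S \<Longrightarrow> z s \<in> carrier (M j)" "\<And>s. s \<in> S \<Longrightarrow> a j (z s) = t s"
    by metis
  have "a j (lin_ext R (M j) z u) = \<zero>\<^bsub>T\<^esub>" if u: "u \<in> U" for u
  proof -
    have "a j (lin_ext R (M j) z u) = lin_ext R T t u"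
      by (rule rhom_lin_ext[OF leg[OF jI] Mj target subsetD[OF U(2) u]]) (simp_all add: z)
    then show ?thesis using rel[OF u] by simp
  qed
  moreover have zrhom: "lin_ext R (M j) z \<in> rhom R (free_rmod R S) (M j)"
    using Mj z(1) by (rule lin_ext_rhom)
  ultimately have "\<exists>k. (j, k) \<in> E \<and> (\<forall>x\<in>lin_ext R (M j) z ` U. f j k x = \<zero>\<^bsub>M k\<^esub>)"
    using rhom_closed[OF zrhom] U by (intro eventually_zero[OF jI]) auto
  then obtain k where k: "(j, k) \<in> E" "\<And>u. u \<in> U \<Longrightarrow> f j k (lin_ext R (M j) z u) = \<zero>\<^bsub>M k\<^esub>"
    by blast
  have kI: "k \<in> I" using le_in[OF k(1)] by simp
  show thesis
  proof (rule that[of k "\<lambda>s. f j k (z s)"])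
    show "k \<in> I" by fact
    show "f j k (z s) \<in> carrier (M k)" if "s \<in> S" for s using f_closed[OF k(1) z(1)[OF that]] .
    show "a k (f j k (z s)) = t s" if "s \<in> S" for s
      using compat[OF k(1) z(1)[OF that]] z(2)[OF that] by simp
    show "lin_ext R (M k) (\<lambda>s. f j k (z s)) u = \<zero>\<^bsub>M k\<^esub>" if u: "u \<in> U" for u
    proof -
      have "f j k (lin_ext R (M j) z u) = lin_ext R (M k) (\<lambda>s. f j k (z s)) u"
        by (rule rhom_lin_ext[OF homs[OF k(1)] Mj modules[OF kI] subsetD[OF U(2) u]]) (simp_all add: z)
      then show ?thesis using k(2)[OF u] by simp
    qed
  qed
qed

text \<open>
  This is the surjectivity of \<open>lim Ext\<^sup>1(Z, M\<^sub>i) \<rightarrow> Ext\<^sup>1(Z, lim M\<^sub>i)\<close> for an FP2-module \<open>Z\<close>: the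
  restriction of \<open>\<l>\<close> to the kernel of \<open>\<epsilon>\<close> represents a class in \<open>Ext\<^sup>1(Z, lim M\<^sub>i)\<close>, and \<open>\<nu>\<close> one that
  maps to it. The lift \<open>\<mu>\<close> of \<open>\<l> \<circ> d0\<close> to some \<open>M i\<close> need not vanish on the image of \<open>d1\<close>, but there
  its image in \<open>T\<close> is zero; since \<open>P2\<close> is finitely generated, it vanishes there at a later index, and
  therefore induces a map on the kernel of \<open>\<epsilon>\<close>.
\<close>

lemma (in exact_cocone) lift_resolution:
  assumes P: "projective R P0" "projective R P1" "finitely_generated R P1"
      "right_module R P2" "finitely_generated R P2"
    and Z: "right_module R Z"
    and \<epsilon>: "\<epsilon> \<in> rhom R P0 Z"
    and d0: "d0 \<in> rhom R P1 P0" "d0 ` carrier P1 = rker P0 Z \<epsilon>"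
    and d1: "d1 \<in> rhom R P2 P1" "d1 ` carrier P2 = rker P1 P0 d0"
    and \<l>: "\<l> \<in> rhom R P0 T" "\<And>p. p \<in> rker P0 Z \<epsilon> \<Longrightarrow> \<l> p \<in> total_image"
  obtains i \<nu> where "i \<in> I" "\<nu> \<in> rhom R (P0\<lparr>carrier := rker P0 Z \<epsilon>\<rparr>) (M i)"
    "\<And>p. p \<in> rker P0 Z \<epsilon> \<Longrightarrow> a i (\<nu> p) = \<l> p"
proof -
  let ?K = "rker P0 Z \<epsilon>"
  have P0: "right_module R P0" and P1: "right_module R P1" using P(1,2) by (simp_all add: projective_def)
  have K: "rsubmodule R P0 ?K" using \<epsilon> P0 Z by (rule rsubmodule_rker)
  have KM: "right_module R (P0\<lparr>carrier := ?K\<rparr>)" using P0 K by (rule rsubmodule_right_module)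
  have dK: "d0 q \<in> ?K" if "q \<in> carrier P1" for q using that d0(2) by blast
  have "(\<lambda>q. \<l> (d0 q)) \<in> rhom R P1 T" using d0(1) \<l>(1) by (rule rhom_comp)
  then obtain i \<mu> where i: "i \<in> I" and \<mu>: "\<mu> \<in> rhom R P1 (M i)"
    "\<And>q. q \<in> carrier P1 \<Longrightarrow> a i (\<mu> q) = \<l> (d0 q)"
    using projective_factors[OF P(2,3)] \<l>(2) dK by blast
  have "(\<lambda>r. \<mu> (d1 r)) \<in> rhom R P2 (M i)" using d1(1) \<mu>(1) by (rule rhom_comp)
  moreover have "a i (\<mu> (d1 r)) = \<zero>\<^bsub>T\<^esub>" if "r \<in> carrier P2" for r
  proof -
    have "d1 r \<in> rker P1 P0 d0" using d1(2) that by blast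
    then show ?thesis using \<mu>(2)[of "d1 r"] rhom_zero[OF \<l>(1) P0 target] by (simp add: rker_def)
  qed
  ultimately obtain k where k: "(i, k) \<in> E"
    "\<And>r. r \<in> carrier P2 \<Longrightarrow> f i k (\<mu> (d1 r)) = \<zero>\<^bsub>M k\<^esub>"
    using finitely_generated_eventually_zero[OF P(4,5) i] by blast
  have kI: "k \<in> I" using le_in[OF k(1)] by simp
  have "\<exists>\<nu>\<in>rhom R (P0\<lparr>carrier := ?K\<rparr>) (M k). \<forall>q\<in>carrier P1. \<nu> (d0 q) = f i k (\<mu> q)"
  proof (rule rhom_factor)
    show "d0 \<in> rhom R P1 (P0\<lparr>carrier := ?K\<rparr>)" using d0(1) dK by (simp add: rhom_def)
    show "d0 ` carrier P1 = carrier (P0\<lparr>carrier := ?K\<rparr>)" using d0(2) by simp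
    show "(\<lambda>q. f i k (\<mu> q)) \<in> rhom R P1 (M k)" using \<mu>(1) homs[OF k(1)] by (rule rhom_comp)
    show "right_module R (M k)" using kI by (rule modules)
    fix q assume "q \<in> carrier P1" "d0 q = \<zero>\<^bsub>P0\<lparr>carrier := ?K\<rparr>\<^esub>"
    then have "q \<in> d1 ` carrier P2" unfolding d1(2) by (simp add: rker_def)
    then show "f i k (\<mu> q) = \<zero>\<^bsub>M k\<^esub>" using k(2) by blast
  qed fact+
  then obtain \<nu> where \<nu>: "\<nu> \<in> rhom R (P0\<lparr>carrier := ?K\<rparr>) (M k)"
    "\<And>q. q \<in> carrier P1 \<Longrightarrow> \<nu> (d0 q) = f i k (\<mu> q)" by blast
  have "a k (\<nu> p) = \<l> p" if pK: "p \<in> ?K" for p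
  proof -
    obtain q where q: "q \<in> carrier P1" "p = d0 q" using pK unfolding d0(2)[symmetric] by blast
    then show ?thesis using \<nu>(2) \<mu>(2) compat[OF k(1) rhom_closed[OF \<mu>(1) q(1)]] by simp
  qed
  then show thesis using kI \<nu>(1) by (intro that[of k \<nu>]) simp_all
qed

lemma exact_cocone_of_direct_limit:
  assumes ds: "direct_system R I E M f" and iso: "rmod_iso R A (direct_limit I E M f)"
    and A: "right_module R A" and T: "right_module R T"
    and j: "j \<in> rhom R A T" "inj_on j (carrier A)"
  obtains a where "exact_cocone R I E M f T a" "(\<Union>i\<in>I. a i ` carrier (M i)) = j ` carrier A"
proof -
  interpret direct_system R I E M f by fact
  have LM: "right_module R L" by (rule dl_right_module)
  obtain h where h: "h \<in> rhom R A L" "bij_betw h (carrier A) (carrier L)"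
    using iso unfolding rmod_iso_def by blast
  define v where "v = inv_into (carrier A) h"
  have v: "v \<in> rhom R L A" unfolding v_def using h A by (rule rhom_inv)
  have vb: "bij_betw v (carrier L) (carrier A)" unfolding v_def using h(2) by (rule bij_betw_inv_into)
  define a where "a i x = j (v (cls i x))" for i x
  have jv: "(\<lambda>X. j (v X)) \<in> rhom R L T" using v j(1) by (rule rhom_comp)
  have "exact_cocone R I E M f T a"
  proof (intro exact_cocone.intro exact_cocone_axioms.intro ds)
    show "right_module R T" by fact
    show "a i \<in> rhom R (M i) T" if "i \<in> I" for i
      unfolding a_def using dl_cocone(1)[OF that] jv by (rule rhom_comp)
    show "a k (f i k x) = a i x" if "(i, k) \<in> E" "x \<in> carrier (M i)" for i k x
      using cls_f[OF that] by (simp add: a_def)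
  next
    fix i x assume i: "i \<in> I" and x: "x \<in> carrier (M i)" and z: "a i x = \<zero>\<^bsub>T\<^esub>"
    interpret Li: right_module R L by (rule LM)
    interpret Mi: right_module R "M i" using i by (rule modules)
    have "inj_on (\<lambda>X. j (v X)) (carrier L)"
      using comp_inj_on[of v "carrier L" j] vb j(2) by (simp add: bij_betw_def comp_def)
    moreover have "j (v (cls i x)) = j (v (cls i \<zero>\<^bsub>M i\<^esub>))"
      using z rhom_zero[OF jv LM T] cls_zero[OF i] by (simp add: a_def)
    ultimately have "cls i x = cls i \<zero>\<^bsub>M i\<^esub>"
      using cls_in[OF i x] cls_in[OF i Mi.M.zero_closed] by (auto dest: inj_onD)
    then obtain k where k: "(i, k) \<in> E" "f i k x = f i k \<zero>\<^bsub>M i\<^esub>"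
      using cls_eq_iff[OF i x i Mi.M.zero_closed] by blast
    have "f i k \<zero>\<^bsub>M i\<^esub> = \<zero>\<^bsub>M k\<^esub>"
      using rhom_zero[OF homs[OF k(1)] modules modules] le_in[OF k(1)] by simp
    then show "\<exists>k. (i, k) \<in> E \<and> f i k x = \<zero>\<^bsub>M k\<^esub>" using k by auto
  qed
  moreover have "(\<Union>i\<in>I. a i ` carrier (M i)) = j ` carrier A"
  proof -
    have "carrier L = (\<Union>i\<in>I. cls i ` carrier (M i))" 
    proof
      show "carrier L \<subseteq> (\<Union>i\<in>I. cls i ` carrier (M i))"
        by (rule subsetI, erule cls_E) blast
      show "(\<Union>i\<in>I. cls i ` carrier (M i)) \<subseteq> carrier L" using cls_in by blast
    qed
    then have "carrier A = v ` (\<Union>i\<in>I. cls i ` carrier (M i))" using vb by (simp add: bij_betw_def)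
    then show ?thesis by (simp add: a_def image_UN image_image)
  qed
  ultimately show thesis by (rule that)
qed

section \<open>Extensions of direct limits\<close>

lemma rhom_copair:
  assumes \<alpha>: "\<alpha> \<in> rhom R A B" and \<beta>: "\<beta> \<in> rhom R P B" and B: "right_module R B"
  shows "(\<lambda>x. \<alpha> (fst x) \<oplus>\<^bsub>B\<^esub> \<beta> (snd x)) \<in> rhom R (prod_rmod A P) B"
proof -
  interpret B: right_module R B by fact
  show ?thesis
    using rhom_closed[OF \<alpha>] rhom_closed[OF \<beta>] rhom_add[OF \<alpha>] rhom_add[OF \<beta>]
      rhom_ract[OF \<alpha>] rhom_ract[OF \<beta>]
    by (simp add: rhom_def Pi_iff B.M.a_ac B.ract_add_left)
qed

lemma lin_ext_pair:
  assumes A: "right_module R A" and P: "right_module R P" and u: "u \<in> carrier (free_rmod R S)"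
    and c: "\<And>s. s \<in> S \<Longrightarrow> c s \<in> carrier A" and p: "\<And>s. s \<in> S \<Longrightarrow> p s \<in> carrier P"
  shows "lin_ext R (prod_rmod A P) (\<lambda>s. (c s, p s)) u = (lin_ext R A c u, lin_ext R P p u)"
proof -
  have "fst (lin_ext R (prod_rmod A P) (\<lambda>s. (c s, p s)) u) = lin_ext R A c u"
    using fst_rhom prod_right_module[OF A P] A u by (rule rhom_lin_ext) (simp_all add: c p)
  moreover have "snd (lin_ext R (prod_rmod A P) (\<lambda>s. (c s, p s)) u) = lin_ext R P p u"
    using snd_rhom prod_right_module[OF A P] P u by (rule rhom_lin_ext) (simp_all add: c p)
  ultimately show ?thesis by (simp add: prod_eq_iff)
qed

text \<open>
  The type of the modules in \<open>C\<close> has room for an extension of \<open>Z\<close> by \<open>A\<close>, because \<open>C\<close> contains a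
  copy of \<open>A \<oplus> Z\<close>.
\<close>

lemma pair_embedding:
  fixes C :: "('r, 'c) rmod set"
  assumes sums: "closed_finite_direct_sums R C" and A: "A \<in> C" and Z: "Z \<in> C"
  obtains \<theta> :: "'c \<times> 'c \<Rightarrow> 'c" where "inj_on \<theta> (carrier A \<times> carrier Z)"
proof -
  define X where "X k = (if k = 0 then A else Z)" for k :: nat
  have "\<forall>k<2. X k \<in> C" using A Z by (simp add: X_def)
  then have "\<exists>S\<in>C. rmod_iso R S (direct_sum {..<2} X)"
    by (rule sums[unfolded closed_finite_direct_sums_def, THEN spec, THEN spec, THEN mp])
  then obtain S :: "('r, 'c) rmod" where "rmod_iso R S (direct_sum {..<2} X)" by blast
  then obtain h where h: "bij_betw h (carrier S) (carrier (direct_sum {..<2} X))"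
    unfolding rmod_iso_def by blast
  define w where "w x = (\<lambda>k\<in>{..<2::nat}. if k = 0 then fst x else snd x)" for x :: "'c \<times> 'c"
  have img: "w ` (carrier A \<times> carrier Z) \<subseteq> carrier (direct_sum {..<2} X)"
    by (auto simp: direct_sum_def w_def X_def split: if_splits)
  have "inj w"
  proof (rule injI)
    fix x y assume "w x = w y"
    then have "w x 0 = w y 0" "w x 1 = w y 1" by simp_all
    then show "x = y" by (simp add: w_def prod_eq_iff)
  qed
  then have "inj_on w (carrier A \<times> carrier Z)" by (rule inj_on_subset) simp
  moreover have "inj_on (inv_into (carrier S) h) (w ` (carrier A \<times> carrier Z))"
    using bij_betw_imp_inj_on[OF bij_betw_inv_into[OF h]] img by (rule inj_on_subset)
  ultimately have "inj_on (inv_into (carrier S) h \<circ> w) (carrier A \<times> carrier Z)"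
    by (rule comp_inj_on)
  then show thesis by (rule that)
qed

text \<open>
  The step which uses that \<open>C\<close> is closed under extensions. With \<open>P0\<close> projective and mapped onto a suitable
  \<open>Z = N j\<close> by \<open>\<epsilon>\<close>, a lift \<open>\<l>\<close> of \<open>P0 \<rightarrow> Z \<rightarrow> D\<close> to \<open>B\<close>, and \<open>\<nu>\<close> from \<open>lift_resolution\<close>, the pushout \<open>Y\<close> of
  \<open>P0\<close> and \<open>M i\<close> maps to \<open>B\<close> by \<open>(x, q) \<mapsto> a i x + \<l> q\<close>. A generator \<open>s\<close> with image \<open>y s = \<epsilon> (p s)\<close> in
  \<open>Z\<close> differs from \<open>\<l> (p s)\<close> by an element of \<open>A\<close>, that is, by \<open>a i (c s)\<close> for \<open>i\<close> large enough, and
  so it lifts to the class of \<open>(c s, p s)\<close>. A relation \<open>u\<close> between the generators holds in \<open>Z\<close>, hence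
  its value in \<open>Y\<close> comes from an element \<open>w u\<close> of \<open>M i\<close>. This element is zero in \<open>B\<close>, hence zero at a
  later index.
\<close>

lemma extension_factors_through:
  fixes R :: "('r, 'e) ring_scheme" and C :: "('r, 'c) rmod set" and B :: "('r, 'b) rmod"
    and D :: "('r, 'd) rmod"
  assumes sums: "closed_finite_direct_sums R C" and ext: "closed_extensions R C"
    and C: "\<And>X. X \<in> C \<Longrightarrow> FP2 TYPE('p) R X"
    and A: "exact_cocone R I E M f B a" "\<And>i. i \<in> I \<Longrightarrow> M i \<in> C"
    and D: "exact_cocone R J G N k D \<delta>" "\<And>j. j \<in> J \<Longrightarrow> N j \<in> C"
      "(\<Union>j\<in>J. \<delta> j ` carrier (N j)) = carrier D"
    and g: "g \<in> rhom R B D" "g ` carrier B = carrier D"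
      "rker B D g = (\<Union>i\<in>I. a i ` carrier (M i))"
    and S: "finite S" "S \<subseteq> carrier B \<times> UNIV" and U: "finite U" "U \<subseteq> relations R B S"
  shows "factors_through R C B S U"
proof -
  interpret A: exact_cocone R I E M f B a by fact
  interpret D: exact_cocone R J G N k D \<delta> by fact
  have BM: "right_module R B" by (rule A.target)
  have DM: "right_module R D" by (rule D.target)
  interpret B: right_module R B by (rule BM)
  have gker: "rker B D g = A.total_image" unfolding A.total_image_def by (rule g(3))
  have SB: "fst s \<in> carrier B" if "s \<in> S" for s using S(2) that by auto
  have UF: "U \<subseteq> carrier (free_rmod R S)" using U(2) by (auto simp: rker_def)
  have Urel: "lin_ext R B fst u = \<zero>\<^bsub>B\<^esub>" if "u \<in> U" for u using U(2) that by (auto simp: rker_def)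
  have "lin_ext R D (\<lambda>s. g (fst s)) u = \<zero>\<^bsub>D\<^esub>" if u: "u \<in> U" for u
  proof -
    have "g (lin_ext R B fst u) = lin_ext R D (\<lambda>s. g (fst s)) u"
      by (rule rhom_lin_ext[OF g(1) BM DM subsetD[OF UF u]]) (simp_all add: SB)
    then show ?thesis using Urel[OF u] rhom_zero[OF g(1) BM DM] by simp
  qed
  moreover have "g (fst s) \<in> D.total_image" if "s \<in> S" for s
    using rhom_closed[OF g(1) SB[OF that]] D(3) unfolding D.total_image_def by simp
  ultimately obtain j y where j: "j \<in> J" and y: "\<And>s. s \<in> S \<Longrightarrow> y s \<in> carrier (N j)"
    "\<And>s. s \<in> S \<Longrightarrow> \<delta> j (y s) = g (fst s)"
    "\<And>u. u \<in> U \<Longrightarrow> lin_ext R (N j) y u = \<zero>\<^bsub>N j\<^esub>"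
    using D.lift_generators[OF S(1) U(1) UF, of "\<lambda>s. g (fst s)"] by blast
  \<comment> \<open>the generators and relations now live over \<open>N j\<close>; the rest takes place over this module\<close>
  let ?Z = "N j"
  have ZC: "?Z \<in> C" using j by (rule D(2))
  have ZM: "right_module R ?Z" using j by (rule D.modules)
  obtain P0 P1 P2 :: "('r, 'p) rmod" and \<epsilon> d0 d1
    where P: "projective R P0" "projective R P1" "projective R P2"
      "finitely_generated R P1" "finitely_generated R P2"
      and \<epsilon>: "\<epsilon> \<in> rhom R P0 ?Z" "\<epsilon> ` carrier P0 = carrier ?Z"
      and d0: "d0 \<in> rhom R P1 P0" "d0 ` carrier P1 = rker P0 ?Z \<epsilon>"
      and d1: "d1 \<in> rhom R P2 P1" "d1 ` carrier P2 = rker P1 P0 d0"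
    by (rule FP2_resolution[OF C[OF ZC]]) (rule that)
  have P0: "right_module R P0" and P2: "right_module R P2" using P by (simp_all add: projective_def)
  interpret P0: right_module R P0 by (rule P0)
  let ?K = "rker P0 ?Z \<epsilon>"
  have "(\<lambda>p. \<delta> j (\<epsilon> p)) \<in> rhom R P0 D" using \<epsilon>(1) D.leg[OF j] by (rule rhom_comp)
  then obtain \<l> where \<l>: "\<l> \<in> rhom R P0 B" "\<And>p. p \<in> carrier P0 \<Longrightarrow> g (\<l> p) = \<delta> j (\<epsilon> p)"
    using projective_lift[OF P(1) BM DM g(1,2)] by blast
  have "\<l> p \<in> A.total_image" if "p \<in> ?K" for p
  proof -
    have "g (\<l> p) = \<zero>\<^bsub>D\<^esub>"
      using that \<l>(2)[of p] rhom_zero[OF D.leg[OF j] ZM DM] by (simp add: rker_def)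
    then show ?thesis
      unfolding gker[symmetric] using that rhom_closed[OF \<l>(1), of p] by (simp add: rker_def)
  qed
  then obtain i1 \<nu> where i1: "i1 \<in> I" and \<nu>: "\<nu> \<in> rhom R (P0\<lparr>carrier := ?K\<rparr>) (M i1)"
    "\<And>p. p \<in> ?K \<Longrightarrow> a i1 (\<nu> p) = \<l> p"
    using A.lift_resolution[OF P(1,2,4) P2 P(5) ZM \<epsilon>(1) d0 d1 \<l>(1)] by blast
  have "\<forall>s\<in>S. \<exists>p. p \<in> carrier P0 \<and> \<epsilon> p = y s" using \<epsilon>(2) y(1) by (metis imageE)
  then obtain p where p: "\<And>s. s \<in> S \<Longrightarrow> p s \<in> carrier P0" "\<And>s. s \<in> S \<Longrightarrow> \<epsilon> (p s) = y s"
    by metis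
  have lp: "\<l> (p s) \<in> carrier B" if "s \<in> S" for s using rhom_closed[OF \<l>(1) p(1)[OF that]] .
  have "fst s \<ominus>\<^bsub>B\<^esub> \<l> (p s) \<in> A.total_image" if s: "s \<in> S" for s
  proof -
    have "g (fst s) = g (\<l> (p s))" using \<l>(2) p y(2) s by simp
    then have "g (fst s \<ominus>\<^bsub>B\<^esub> \<l> (p s)) = \<zero>\<^bsub>D\<^esub>"
      using rhom_eq_iff[OF g(1) BM DM SB[OF s] lp[OF s]] by simp
    then show ?thesis unfolding gker[symmetric] using SB[OF s] lp[OF s] by (simp add: rker_def)
  qed
  then have "(\<lambda>s. fst s \<ominus>\<^bsub>B\<^esub> \<l> (p s)) ` S \<subseteq> A.total_image" by blast
  then obtain i2 where i2: "(i1, i2) \<in> E" "(\<lambda>s. fst s \<ominus>\<^bsub>B\<^esub> \<l> (p s)) ` S \<subseteq> a i2 ` carrier (M i2)"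
    using A.eventually_lifts[OF i1] S(1) by blast
  have "\<forall>s\<in>S. \<exists>x. x \<in> carrier (M i2) \<and> a i2 x = fst s \<ominus>\<^bsub>B\<^esub> \<l> (p s)"
    using i2(2) by (metis (lifting) imageE image_subset_iff)
  then obtain c where c: "\<And>s. s \<in> S \<Longrightarrow> c s \<in> carrier (M i2)"
    "\<And>s. s \<in> S \<Longrightarrow> a i2 (c s) = fst s \<ominus>\<^bsub>B\<^esub> \<l> (p s)"
    by metis
  have i2I: "i2 \<in> I" using A.le_in[OF i2(1)] by simp
  have M2: "right_module R (M i2)" using i2I by (rule A.modules)
  interpret M2: right_module R "M i2" by (rule M2)
  have c_p: "a i2 (c s) \<oplus>\<^bsub>B\<^esub> \<l> (p s) = fst s" if s: "s \<in> S" for s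
    using c(2)[OF s] SB[OF s] lp[OF s] by (simp add: a_minus_def B.M.a_assoc B.M.l_neg)
  have lin_p: "lin_ext R P0 p u \<in> ?K" if u: "u \<in> U" for u
  proof -
    have "\<epsilon> (lin_ext R P0 p u) = lin_ext R ?Z y u"
      by (rule rhom_lin_ext[OF \<epsilon>(1) P0 ZM subsetD[OF UF u]]) (simp_all add: p)
    then show ?thesis
      using y(3)[OF u] rhom_closed[OF lin_ext_rhom[OF P0 p(1)] subsetD[OF UF u]] by (simp add: rker_def)
  qed
  have lin_c: "lin_ext R (M i2) c u \<in> carrier (M i2)" if u: "u \<in> U" for u
    using rhom_closed[OF lin_ext_rhom[OF M2 c(1)] subsetD[OF UF u]] .
  \<comment> \<open>\<open>w u\<close> represents the value of the relation \<open>u\<close> in the pushout of \<open>P0\<close> and \<open>M i2\<close>\<close>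
  define w where "w u = lin_ext R (M i2) c u \<oplus>\<^bsub>M i2\<^esub> f i1 i2 (\<nu> (lin_ext R P0 p u))" for u
  have \<nu>c: "\<nu> q \<in> carrier (M i1)" if "q \<in> ?K" for q using rhom_closed[OF \<nu>(1), of q] that by simp
  have f12: "f i1 i2 (\<nu> q) \<in> carrier (M i2)" if "q \<in> ?K" for q
    using A.f_closed[OF i2(1) \<nu>c[OF that]] .
  have w_closed: "w u \<in> carrier (M i2)" if "u \<in> U" for u
    using lin_c[OF that] f12[OF lin_p[OF that]] by (simp add: w_def)
  have "a i2 (w u) = \<zero>\<^bsub>B\<^esub>" if u: "u \<in> U" for u
  proof -
    let ?H = "\<lambda>x. a i2 (fst x) \<oplus>\<^bsub>B\<^esub> \<l> (snd x)"
    have "a i2 (w u) = a i2 (lin_ext R (M i2) c u) \<oplus>\<^bsub>B\<^esub> a i2 (f i1 i2 (\<nu> (lin_ext R P0 p u)))"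
      unfolding w_def by (rule rhom_add[OF A.leg[OF i2I] lin_c[OF u] f12[OF lin_p[OF u]]])
    also have "\<dots> = a i2 (lin_ext R (M i2) c u) \<oplus>\<^bsub>B\<^esub> \<l> (lin_ext R P0 p u)"
      using A.compat[OF i2(1) \<nu>c[OF lin_p[OF u]]] \<nu>(2)[OF lin_p[OF u]] by simp
    also have "\<dots> = ?H (lin_ext R (prod_rmod (M i2) P0) (\<lambda>s. (c s, p s)) u)"
      using lin_ext_pair[OF M2 P0 subsetD[OF UF u], of c p] c(1) p(1) by simp
    also have "\<dots> = lin_ext R B fst u"
      by (rule rhom_lin_ext[OF rhom_copair[OF A.leg[OF i2I] \<l>(1) BM] prod_right_module[OF M2 P0] BM
          subsetD[OF UF u]])
        (simp_all add: c(1) p(1) c_p)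
    finally show ?thesis using Urel[OF u] by simp
  qed
  then have "\<exists>k. (i2, k) \<in> E \<and> (\<forall>x\<in>w ` U. f i2 k x = \<zero>\<^bsub>M k\<^esub>)"
    using U(1) w_closed by (intro A.eventually_zero[OF i2I]) auto
  then obtain i3 where i3: "(i2, i3) \<in> E" "\<And>u. u \<in> U \<Longrightarrow> f i2 i3 (w u) = \<zero>\<^bsub>M i3\<^esub>" by blast
  have i3I: "i3 \<in> I" using A.le_in[OF i3(1)] by simp
  have i13: "(i1, i3) \<in> E" using i2(1) i3(1) by (rule A.le_trans)
  \<comment> \<open>at the index \<open>i3\<close> all relations hold, so the data are transported there\<close>
  let ?A = "M i3"
  have AC: "?A \<in> C" using i3I by (rule A(2))
  have AM: "right_module R ?A" using i3I by (rule A.modules)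
  define \<nu>' where "\<nu>' q = f i1 i3 (\<nu> q)" for q
  have \<nu>': "\<nu>' \<in> rhom R (P0\<lparr>carrier := ?K\<rparr>) ?A"
    unfolding \<nu>'_def using \<nu>(1) A.homs[OF i13] by (rule rhom_comp)
  have a\<nu>': "a i3 (\<nu>' q) = \<l> q" if "q \<in> ?K" for q
    using A.compat[OF i13 \<nu>c[OF that]] \<nu>(2)[OF that] by (simp add: \<nu>'_def)
  define c' where "c' s = f i2 i3 (c s)" for s
  have c': "c' s \<in> carrier ?A" "a i3 (c' s) = a i2 (c s)" if "s \<in> S" for s
    using A.f_closed[OF i3(1) c(1)[OF that]] A.compat[OF i3(1) c(1)[OF that]] by (simp_all add: c'_def)
  have rel: "lin_ext R ?A c' u \<oplus>\<^bsub>?A\<^esub> \<nu>' (lin_ext R P0 p u) = \<zero>\<^bsub>?A\<^esub>" if u: "u \<in> U" for u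
  proof -
    have "f i2 i3 (lin_ext R (M i2) c u) = lin_ext R ?A c' u"
      by (rule rhom_lin_ext[OF A.homs[OF i3(1)] M2 AM subsetD[OF UF u]]) (simp_all add: c c'_def)
    moreover have "f i2 i3 (f i1 i2 (\<nu> (lin_ext R P0 p u))) = \<nu>' (lin_ext R P0 p u)"
      unfolding \<nu>'_def using A.comp[OF i2(1) i3(1) \<nu>c[OF lin_p[OF u]]] .
    ultimately show ?thesis
      using i3(2)[OF u] rhom_add[OF A.homs[OF i3(1)] lin_c[OF u] f12[OF lin_p[OF u]]]
      by (simp add: w_def)
  qed
  obtain \<theta> :: "'c \<times> 'c \<Rightarrow> 'c" where \<theta>: "inj_on \<theta> (carrier ?A \<times> carrier ?Z)"
    using sums AC ZC by (rule pair_embedding)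
  obtain Y :: "('r, 'c) rmod" and \<phi> where Y: "extension R ?A Y ?Z"
    and \<phi>: "\<phi> \<in> rhom R (prod_rmod ?A P0) Y" "\<phi> ` (carrier ?A \<times> carrier P0) = carrier Y"
      "\<And>x q. x \<in> carrier ?A \<Longrightarrow> q \<in> carrier P0 \<Longrightarrow>
        \<phi> (x, q) = \<zero>\<^bsub>Y\<^esub> \<longleftrightarrow> \<epsilon> q = \<zero>\<^bsub>?Z\<^esub> \<and> x \<oplus>\<^bsub>?A\<^esub> \<nu>' q = \<zero>\<^bsub>?A\<^esub>"
    using pushout_extension[OF AM P0 ZM \<epsilon> \<nu>' \<theta>] by blast
  have YC: "Y \<in> C" using ext AC ZC Y unfolding closed_extensions_def by blast
  have YM: "right_module R Y" using Y by (simp add: extension_def)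
  have AP: "right_module R (prod_rmod ?A P0)" using AM P0 by (rule prod_right_module)
  have H: "(\<lambda>x. a i3 (fst x) \<oplus>\<^bsub>B\<^esub> \<l> (snd x)) \<in> rhom R (prod_rmod ?A P0) B"
    using A.leg[OF i3I] \<l>(1) BM by (rule rhom_copair)
  have "\<exists>h\<in>rhom R Y B. \<forall>x\<in>carrier (prod_rmod ?A P0). h (\<phi> x) = a i3 (fst x) \<oplus>\<^bsub>B\<^esub> \<l> (snd x)"
  proof (rule rhom_factor[OF \<phi>(1) _ H AP YM BM])
    show "\<phi> ` carrier (prod_rmod ?A P0) = carrier Y" using \<phi>(2) by simp
    fix x assume "x \<in> carrier (prod_rmod ?A P0)" and z: "\<phi> x = \<zero>\<^bsub>Y\<^esub>"
    then have x: "fst x \<in> carrier ?A" "snd x \<in> carrier P0" by auto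
    have k: "snd x \<in> ?K" "fst x \<oplus>\<^bsub>?A\<^esub> \<nu>' (snd x) = \<zero>\<^bsub>?A\<^esub>"
      using \<phi>(3)[OF x] z x(2) by (simp_all add: rker_def)
    have "\<nu>' (snd x) \<in> carrier ?A" using rhom_closed[OF \<nu>', of "snd x"] k(1) by simp
    then have "a i3 (fst x) \<oplus>\<^bsub>B\<^esub> a i3 (\<nu>' (snd x)) = \<zero>\<^bsub>B\<^esub>"
      using rhom_add[OF A.leg[OF i3I] x(1)] k(2) rhom_zero[OF A.leg[OF i3I] AM BM] by metis
    then show "a i3 (fst x) \<oplus>\<^bsub>B\<^esub> \<l> (snd x) = \<zero>\<^bsub>B\<^esub>" using a\<nu>'[OF k(1)] by simp
  qed
  then obtain h where h: "h \<in> rhom R Y B"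
    "\<And>x. x \<in> carrier (prod_rmod ?A P0) \<Longrightarrow> h (\<phi> x) = a i3 (fst x) \<oplus>\<^bsub>B\<^esub> \<l> (snd x)"
    by blast
  have mem: "(c' s, p s) \<in> carrier (prod_rmod ?A P0)" if "s \<in> S" for s
    using c'(1)[OF that] p(1)[OF that] by simp
  have "\<phi> (c' s, p s) \<in> carrier Y \<and> h (\<phi> (c' s, p s)) = fst s" if s: "s \<in> S" for s
    using rhom_closed[OF \<phi>(1) mem[OF s]] h(2)[OF mem[OF s]] c'(2)[OF s] c_p[OF s] by simp
  moreover have "lin_ext R Y (\<lambda>s. \<phi> (c' s, p s)) u = \<zero>\<^bsub>Y\<^esub>" if u: "u \<in> U" for u
  proof -
    have uF: "u \<in> carrier (free_rmod R S)" using UF u by blast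
    have "\<phi> (lin_ext R (prod_rmod ?A P0) (\<lambda>s. (c' s, p s)) u) = lin_ext R Y (\<lambda>s. \<phi> (c' s, p s)) u"
      by (rule rhom_lin_ext[OF \<phi>(1) AP YM uF mem refl])
    moreover have "lin_ext R (prod_rmod ?A P0) (\<lambda>s. (c' s, p s)) u =
        (lin_ext R ?A c' u, lin_ext R P0 p u)"
      using AM P0 uF c'(1) p(1) by (rule lin_ext_pair)
    moreover have "\<phi> (lin_ext R ?A c' u, lin_ext R P0 p u) = \<zero>\<^bsub>Y\<^esub>"
      using \<phi>(3)[of "lin_ext R ?A c' u" "lin_ext R P0 p u"] lin_p[OF u] rel[OF u]
        rhom_closed[OF lin_ext_rhom[OF AM c'(1)] uF] by (simp add: rker_def)
    ultimately show ?thesis by simp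
  qed
  ultimately show ?thesis
    unfolding factors_through_def using YC h(1)
    by (intro bexI[of _ Y] bexI[of _ h] exI[of _ "\<lambda>s. \<phi> (c' s, p s)"]) blast+
qed

theorem proposition2p11:
  fixes R :: "('r, 'e) ring_scheme"
    and C :: "('r, 'c) rmod set"
    and A :: "('r, 'a) rmod" and B :: "('r, 'b) rmod" and D :: "('r, 'd) rmod"
  assumes "ring R"
    and "rmod_class R C"
    and "closed_finite_direct_sums R C"
    and "closed_extensions R C"
    and "\<forall>X\<in>C. FP2 TYPE('p) R X"
    and "A \<in> dirlim_class TYPE('i) R C"
    and "D \<in> dirlim_class TYPE('j) R C"
    and "extension R A B D"
  shows "B \<in> dirlim_class TYPE(('r, 'b) presentation_index) R C"
proof -
  from assms(8) obtain j g where j: "j \<in> rhom R A B" "inj_on j (carrier A)" "j ` carrier A = rker B D g"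
    and g: "g \<in> rhom R B D" "g ` carrier B = carrier D"
    and mods: "right_module R A" "right_module R B" "right_module R D"
    unfolding extension_def by blast
  from assms(6) obtain I :: "'i set" and E M f where A: "direct_system R I E M f" "\<forall>i\<in>I. M i \<in> C"
    "rmod_iso R A (direct_limit I E M f)"
    unfolding dirlim_class_def by blast
  from assms(7) obtain J :: "'j set" and G N k where D: "direct_system R J G N k" "\<forall>j\<in>J. N j \<in> C"
    "rmod_iso R D (direct_limit J G N k)"
    unfolding dirlim_class_def by blast
  obtain a where a: "exact_cocone R I E M f B a" "(\<Union>i\<in>I. a i ` carrier (M i)) = j ` carrier A"
    using A(1,3) mods(1,2) j(1,2) by (rule exact_cocone_of_direct_limit)
  have "(\<lambda>x. x) \<in> rhom R D D" "inj_on (\<lambda>x. x) (carrier D)" by (simp_all add: rhom_def)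
  then obtain \<delta> where \<delta>: "exact_cocone R J G N k D \<delta>"
    "(\<Union>j\<in>J. \<delta> j ` carrier (N j)) = (\<lambda>x. x) ` carrier D"
    by (rule exact_cocone_of_direct_limit[OF D(1,3) mods(3,3)])
  show ?thesis
  proof (rule dirlim_class_if_factors[OF mods(2)])
    show "FP2 TYPE('p) R X" if "X \<in> C" for X using assms(5) that by blast
    show "factors_through R C B S U"
      if "finite S" "S \<subseteq> carrier B \<times> UNIV" "finite U" "U \<subseteq> relations R B S" for S U
      using assms(3,4) _ a(1) _ \<delta>(1) _ _ g _ that
    proof (rule extension_factors_through[where 'p = 'p])
      show "rker B D g = (\<Union>i\<in>I. a i ` carrier (M i))" using a(2) j(3) by simp
      show "(\<Union>j\<in>J. \<delta> j ` carrier (N j)) = carrier D" using \<delta>(2) by simp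
    qed (use assms(5) A(2) D(2) in blast)+
  qed
qed
end
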